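(* Let $\mathbf r$ be a root of $\mathsf E_8$, and for each non-negative integer $n$ let $\phi^{(n)}=\phi^{(n)}_{\mathbf r}: W(\mathsf E_8)_{\mathbf r}\backslash\binom{N_{\mathbf r}(\mathsf E_8)/\sim_{\mathbf r}}{n}\to\Omega_n/{\sim_{\mathrm{sw}}}$ be the mapping defined in the context. The following hold. (i) For a non-negative integer $n\ne 6$, the mapping $\phi^{(n)}$ is bijective. (ii) The fibre of $[S(K_6)]$ under $\phi^{(6)}$ has exactly two elements, and the other fibres of $\phi^{(6)}$ have only one element.
   Context: Lattices. $\mathsf D_8:=\{\mathbf v\in\mathbb Z^8:(\mathbf v,\mathbf j)\in 2\mathbb Z\}$ and $\mathsf E_8:=\mathsf D_8\sqcup(\mathbf j/2+\mathsf D_8)$, where $\mathbf j$ is the all-one vector and $(\cdot,\cdot)$ the standard inner product. A root is a vector $\mathbf u$ of the lattice with $(\mathbf u,\mathbf u)=2$. The Weyl group $W(\mathsf E_8)$ is the group generated by the reflections $s_{\mathbf u}(\mathbf x)=\mathbf x-(\mathbf x,\mathbf u)\mathbf u$ over all roots $\mathbf u$; $W(\mathsf E_8)_{\mathbf r}$ is the stabilizer of $\mathbf r$. Sets of root classes. For a root $\mathbf r\in\mathsf E_8$, $N_{\mathbf r}(\mathsf E_8)$ is the set of roots $\mathbf u\in\mathsf E_8$ with $(\mathbf u,\mathbf r)=1$; on it, $\mathbf u\sim_{\mathbf r}\mathbf v$ iff $\mathbf u=\mathbf v$ or $\mathbf u=\mathbf r-\mathbf v$. The class of $\mathbf u$ is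 $[\mathbf u]_{\mathbf r}=\{\mathbf u,\mathbf r-\mathbf u\}$. $\binom{A}{n}$ is the set of $n$-element subsets of $A$. $W(\mathsf E_8)_{\mathbf r}$ acts on $N_{\mathbf r}(\mathsf E_8)/\sim_{\mathbf r}$ by $w([\mathbf u]_{\mathbf r})=[w(\mathbf u)]_{\mathbf r}$ and hence on $\binom{N_{\mathbf r}(\mathsf E_8)/\sim_{\mathbf r}}{n}$; the left quotient is the set of orbits. Seidel matrices. A Seidel matrix is a real symmetric matrix with zero diagonal and off-diagonal entries $\pm1$. $S\sim_{\mathrm{sw}}S'$ iff $P^\top SP=S'$ for some signed permutation matrix $P$; $[S]$ is the class of $S$. For a (finite simple) graph $G$ with adjacency matrix $A(G)$, $S(G):=J-I-2A(G)$. $\Omega_n$ is the set of Seidel matrices $S$ of order $n$ with largest eigenvalue at most $3$ and $\operatorname{rank}(3I-S)\le 7$ (for $n=0$, $\Omega_0$ consists of the empty matrix). $K_6$ is the complete graph on $6$ vertices. The mapping. For $n\ge 0$, $\phi^{(n)}$ sends the orbit $W(\mathsf E_8)_{\mathbf r}\{[\mathbf u_1]_{\mathbf r},\ldots,[\mathbf u_n]_{\mathbf r}\}$ to $[S(G)]$, where $G$ is the graph with $A(G)+2I=B^\top B$, $B=[\mathbf u_1,\ldots,\mathbf u_n]$ (the matrix with columns $\mathbf u_i$). (Representatives of distinct classes have inner product $0$ or $1$, so $G$ exists, and $[S(G)]$ lies in $\Omega_n/{\sim_{\mathrm{sw}}}$ and does not depend on the choices made.) *)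

theory Defs
  imports
    Complex_Main
    "HOL-Library.Ramsey"
    "HOL-Algebra.Bij"
    "HOL-Algebra.Generated_Groups"
    "Jordan_Normal_Form.Char_Poly"
    "Jordan_Normal_Form.DL_Rank"
begin

section \<open>The root lattice and its Weyl group\<close>

definition D8 :: "real vec set" where
  "D8 = {v \<in> carrier_vec 8. (\<forall>i<8. v $ i \<in> \<int>) \<and> (\<exists>k::int. v \<bullet> vec 8 (\<lambda>_. 1) = 2 * of_int k)}"

definition E8 :: "real vec set" where
  "E8 = D8 \<union> (\<lambda>v. vec 8 (\<lambda>_. 1 / 2) + v) ` D8"

definition E8_roots :: "real vec set" where
  "E8_roots = {u \<in> E8. u \<bullet> u = 2}"

text \<open>Transformations of Euclidean space are extensional functions on \<^term>\<open>carrier_vec 8\<close>, as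
  required for membership in \<^const>\<open>BijGroup\<close>.\<close>

definition root_reflection :: "real vec \<Rightarrow> real vec \<Rightarrow> real vec" where
  "root_reflection u = (\<lambda>x\<in>carrier_vec 8. x - (x \<bullet> u) \<cdot>\<^sub>v u)"

definition E8_Weyl :: "(real vec \<Rightarrow> real vec) set" where
  "E8_Weyl = generate (BijGroup (carrier_vec 8)) (root_reflection ` E8_roots)"

definition E8_Weyl_stab :: "real vec \<Rightarrow> (real vec \<Rightarrow> real vec) set" where
  "E8_Weyl_stab r = {w \<in> E8_Weyl. w r = r}"

section \<open>Root classes\<close>

definition root_nbrs :: "real vec \<Rightarrow> real vec set" where
  "root_nbrs r = {u \<in> E8_roots. u \<bullet> r = 1}"

definition root_rel :: "real vec \<Rightarrow> (real vec \<times> real vec) set" where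
  "root_rel r = {(u, v). u \<in> root_nbrs r \<and> v \<in> root_nbrs r \<and> (u = v \<or> u = r - v)}"

abbreviation root_class :: "real vec \<Rightarrow> real vec \<Rightarrow> real vec set" where
  "root_class r u \<equiv> root_rel r `` {u}"

definition root_classes :: "real vec \<Rightarrow> real vec set set" where
  "root_classes r = root_nbrs r // root_rel r"

text \<open>For \<open>w\<close> in the stabilizer of \<open>r\<close>, the class of \<open>w u\<close> is the image of the class of \<open>u\<close>
  under \<open>w\<close>, so the action on sets of classes is a twofold image.\<close>

definition class_orbit :: "real vec \<Rightarrow> real vec set set \<Rightarrow> real vec set set set" where
  "class_orbit r X = (\<lambda>w. (\<lambda>c. w ` c) ` X) ` E8_Weyl_stab r"

definition class_orbits :: "real vec \<Rightarrow> nat \<Rightarrow> real vec set set set set" where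
  "class_orbits r n = class_orbit r ` nsets (root_classes r) n"

section \<open>Seidel matrices\<close>

definition seidel_mats :: "nat \<Rightarrow> real mat set" where
  "seidel_mats n = {S \<in> carrier_mat n n. S\<^sup>T = S \<and> (\<forall>i<n. S $$ (i, i) = 0) \<and>
     (\<forall>i<n. \<forall>j<n. i \<noteq> j \<longrightarrow> S $$ (i, j) \<in> {1, -1})}"

definition signed_perm_mats :: "nat \<Rightarrow> real mat set" where
  "signed_perm_mats n = {P \<in> carrier_mat n n. (\<forall>i<n. \<forall>j<n. P $$ (i, j) \<in> {0, 1, -1}) \<and>
     (\<forall>i<n. \<exists>!j. j < n \<and> P $$ (i, j) \<noteq> 0) \<and> (\<forall>j<n. \<exists>!i. i < n \<and> P $$ (i, j) \<noteq> 0)}"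

definition sw_rel :: "nat \<Rightarrow> (real mat \<times> real mat) set" where
  "sw_rel n = {(S, S'). S \<in> seidel_mats n \<and> S' \<in> seidel_mats n \<and>
     (\<exists>P\<in>signed_perm_mats n. P\<^sup>T * S * P = S')}"

abbreviation sw_class :: "nat \<Rightarrow> real mat \<Rightarrow> real mat set" where
  "sw_class n S \<equiv> sw_rel n `` {S}"

text \<open>A real symmetric matrix has only real eigenvalues, so its largest eigenvalue is at most
  \<open>3\<close> iff all its real eigenvalues are; this also admits the empty matrix for \<open>n = 0\<close>.\<close>

definition Omega :: "nat \<Rightarrow> real mat set" where
  "Omega n = {S \<in> seidel_mats n. (\<forall>e. eigenvalue S e \<longrightarrow> e \<le> 3) \<and>
     vec_space.rank n (3 \<cdot>\<^sub>m 1\<^sub>m n - S) \<le> 7}"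

section \<open>Graphs\<close>

text \<open>A finite simple graph on the vertices \<open>0, \<dots>, n - 1\<close> is given by its set of
  two-element edges.\<close>

definition simple_graph :: "nat \<Rightarrow> nat set set \<Rightarrow> bool" where
  "simple_graph n E \<longleftrightarrow> E \<subseteq> nsets {..<n} 2"

definition adj_mat :: "nat \<Rightarrow> nat set set \<Rightarrow> real mat" where
  "adj_mat n E = mat n n (\<lambda>(i, j). if {i, j} \<in> E then 1 else 0)"

definition seidel_of_graph :: "nat \<Rightarrow> nat set set \<Rightarrow> real mat" where
  "seidel_of_graph n E = mat n n (\<lambda>_. 1) - 1\<^sub>m n - 2 \<cdot>\<^sub>m adj_mat n E"

definition complete_edges :: "nat \<Rightarrow> nat set set" where
  "complete_edges n = nsets {..<n} 2"

section \<open>The mapping from orbits to switching classes\<close>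

text \<open>The list \<open>us\<close> enumerates one representative of each class in a member of the orbit \<open>Q\<close>;
  the matrix \<open>B\<close> is \<^term>\<open>mat_of_cols 8 us\<close>.\<close>

definition phi :: "real vec \<Rightarrow> nat \<Rightarrow> real vec set set set \<Rightarrow> real mat set" where
  "phi r n Q = (THE C. \<exists>us E.
     length us = n \<and> set us \<subseteq> root_nbrs r \<and>
     root_class r ` set us \<in> nsets (root_classes r) n \<and>
     Q = class_orbit r (root_class r ` set us) \<and>
     simple_graph n E \<and>
     adj_mat n E + 2 \<cdot>\<^sub>m 1\<^sub>m n = (mat_of_cols 8 us)\<^sup>T * mat_of_cols 8 us \<and>
     C = sw_class n (seidel_of_graph n E))"

end

theory Submission
  imports Defs
begin

text \<open>
  Projecting the roots \<open>u\<close> with \<open>(u, r) = 1\<close> orthogonally to \<open>r\<close> turns the 28 classes into 28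
  equiangular lines whose doubled Gram matrices are the matrices \<open>3I - S\<close>.

  Call a \<^emph>\<open>triple\<close> three classes with pairwise orthogonal representatives \<open>u\<^sub>1, u\<^sub>2, u\<^sub>3\<close>, and put
  \<open>u\<^sub>4 = 2r - u\<^sub>1 - u\<^sub>2 - u\<^sub>3\<close>. Every other class has a representative \<open>x\<close> with \<open>(x, u\<^sub>1) = 1\<close>, and then
  \<open>(x, u\<^sub>a) = 1\<close> for exactly one \<open>a > 1\<close>, so these classes fall into three \<^emph>\<open>pillars\<close>; a pillar consists
  of four orthogonal pairs \<open>x, u\<^sub>1 + u\<^sub>a - x\<close>.
  All arguments split according to whether there is no triple (type \<open>A\<close>), only one pillar is
  occupied (type \<open>D\<close>), or at least two pillars are (type \<open>E\<close>).

  Surjectivity: \<open>S\<close> defines an integral semidefinite form on the free abelian group on \<open>n\<close> roots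
  and \<open>r\<close>. In each of the three cases the form has an explicit generating system whose Gram
  matrix occurs in \<open>E8\<close>, and integral combinations stay in \<open>E8\<close>.

  Injectivity: if \<open>x, y\<close> are roots with \<open>(x, y) = 1\<close>, the reflection in \<open>x - y\<close> exchanges them and fixes all
  vectors with equal products with \<open>x\<close> and \<open>y\<close>. Hence an isometric correspondence is extended one root at a
  time, except if \<open>x\<close> and \<open>y\<close> are an orthogonal pair of a pillar. That is impossible if another pillar is
  occupied, and otherwise is repaired by exchanging two of the \<open>u\<^sub>i\<close> as well. Without a triple there is
  no such repair, and six classes can be moved to exactly two standard positions, of which only one extends to
  seven.
\<close>

section \<open>Integral semidefinite forms\<close>

text \<open>The form attached to a Seidel matrix may be degenerate. Equality is therefore read
  modulo the radical (\<open>eqv\<close>), "generated by" becomes "in every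
  \<open>eqv_subgroup\<close> containing", and the embedding into \<open>E8\<close> is a relation
  that preserves products. A generating system has a model in \<open>E8\<close> only if it is short,
  so its length must be bounded in each type. In types A and D the bound comes from the rank:
  \<open>3I - S\<close> has the entries \<open>2(u, v) - 1\<close>, and a clique of eight, or a
  triple with five roots of pairwise product 1 in one pillar, would force rank 8. In type E it comes
  from Bessel's inequality inside the form. For injectivity, one reflection handles only two roots
  with product 1. Longer moves need the roots with prescribed products to be connected under this
  relation, a finite question that is evaluated on lists of integers. The number 6 has its origin in
  one such list: beyond \<open>r\<close> and five clique roots exactly three roots remain, and one
  of them is orthogonal to the other two.\<close>

locale semidefinite_form =
  fixes B :: "'v::ab_group_add \<Rightarrow> 'v \<Rightarrow> int"
  assumes B_sym: "B x y = B y x"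
    and B_add: "B (x + y) z = B x z + B y z"
    and B_nonneg: "0 \<le> B x x"
begin

lemma B_add_right: "B z (x + y) = B z x + B z y"
  using B_add B_sym by metis

lemma B_zero: "B 0 z = 0"
  using B_add[of 0 0 z] by simp

lemma B_minus: "B (- x) z = - B x z"
  using B_add[of x "- x" z] B_zero by simp

lemma B_minus_right: "B z (- x) = - B z x"
  using B_minus B_sym by metis

lemma B_diff: "B (x - y) z = B x z - B y z"
  using B_add[of x "- y" z] B_minus by simp

lemma B_diff_right: "B z (x - y) = B z x - B z y"
  using B_diff B_sym by metis

lemmas B_simps = B_add B_add_right B_diff B_diff_right B_minus B_minus_right

text \<open>For null \<open>x\<close> the norm of \<open>y + k x\<close> is affine in
  \<open>k\<close> with slope \<open>2 * B x y\<close>; a negative slope makes it negative already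
  at \<open>k = B y y + 1\<close>.\<close>

lemma null_orthogonal_nonneg:
  assumes "B x x = 0"
  shows "0 \<le> B x y"
proof (rule ccontr)
  assume neg: "\<not> 0 \<le> B x y"
  \<comment> \<open>The vectors form a mere abelian group, so the multiple \<open>k x\<close> is
    built by iterated addition.\<close>
  define z where "z k = ((+) x ^^ k) y" for k
  have z: "z 0 = y" "z (Suc k) = x + z k" for k by (simp_all add: z_def)
  have zx: "B (z k) x = B y x" for k
    by (induction k) (simp_all add: z B_simps assms)
  have iter: "B (z k) (z k) = B y y + 2 * int k * B x y" for k
  proof (induction k)
    case (Suc k)
    then show ?case
      using zx[of k] B_sym[of x "z k"] B_sym[of x y] by (simp add: z B_simps assms) (simp add: algebra_simps)
  qed (simp add: z)
  have "int (nat (B y y + 1)) = B y y + 1" using B_nonneg[of y] by simp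
  then have "B y y + 2 * (B y y + 1) * B x y \<ge> 0"
    using iter[of "nat (B y y + 1)"] B_nonneg by metis
  moreover have "(B y y + 1) * B x y \<le> (B y y + 1) * (-1)"
    using neg B_nonneg[of y] by (intro mult_left_mono) auto
  ultimately show False using B_nonneg[of y] by (simp add: algebra_simps)
qed

lemma null_orthogonal:
  assumes "B x x = 0"
  shows "B x y = 0"
  using null_orthogonal_nonneg[OF assms, of y] null_orthogonal_nonneg[OF assms, of "- y"]
  by (simp add: B_simps)

text \<open>Equality modulo the radical: for a semidefinite form the null vectors are exactly the
  radical (\<open>null_orthogonal\<close>).\<close>

definition eqv :: "'v \<Rightarrow> 'v \<Rightarrow> bool" where
  "eqv x y \<longleftrightarrow> B (x - y) (x - y) = 0"

lemma eqv_cong: "eqv x y \<Longrightarrow> B x z = B y z"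
  using null_orthogonal[of "x - y" z] by (simp add: eqv_def B_simps)

lemma eqv_iff: "eqv x y \<longleftrightarrow> (\<forall>z. B x z = B y z)"
proof
  assume "\<forall>z. B x z = B y z"
  then show "eqv x y" by (simp add: eqv_def B_diff)
qed (simp add: eqv_cong)

text \<open>Quantifying over all such \<open>C\<close> that contain given generators expresses
  membership in their integral span modulo the radical.\<close>

definition eqv_subgroup :: "('v \<Rightarrow> bool) \<Rightarrow> bool" where
  "eqv_subgroup C \<longleftrightarrow> (\<forall>x y. C x \<longrightarrow> C y \<longrightarrow> C (x - y)) \<and> (\<forall>x y. eqv x y \<longrightarrow> C y \<longrightarrow> C x)"

lemma eqv_subgroup_diff: "eqv_subgroup C \<Longrightarrow> C x \<Longrightarrow> C y \<Longrightarrow> C (x - y)"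
  by (simp add: eqv_subgroup_def)

lemma eqv_subgroup_eqv: "eqv_subgroup C \<Longrightarrow> eqv x y \<Longrightarrow> C y \<Longrightarrow> C x"
  by (auto simp add: eqv_subgroup_def)

lemma eqv_subgroup_add:
  assumes "eqv_subgroup C" "C x" "C y" shows "C (x + y)"
proof -
  have "C (x - (y - y - y))"
    using assms by (intro eqv_subgroup_diff[OF assms(1)])
  then show ?thesis by simp
qed

definition nbr :: "'v \<Rightarrow> 'v \<Rightarrow> bool" where
  "nbr r u \<longleftrightarrow> B u u = 2 \<and> B u r = 1"

lemma nbrD: "nbr r u \<Longrightarrow> B u u = 2" "nbr r u \<Longrightarrow> B u r = 1"
  by (simp_all add: nbr_def)

context
  fixes r :: 'v
  assumes r: "B r r = 2"
begin

lemma nbr_compl: "nbr r u \<Longrightarrow> nbr r (r - u)"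
  using B_sym[of r u] by (simp add: nbr_def B_simps r)

text \<open>Nonnegative norms of \<open>u - v\<close> and \<open>u + v - r\<close> leave only the
  products -1, 0, 1, 2, and each extreme value makes one of these two vectors null.\<close>

lemma nbr_cases:
  assumes "nbr r u" "nbr r v"
  shows "B u v = 0 \<or> B u v = 1 \<or> eqv u v \<or> eqv u (r - v)"
proof -
  have "0 \<le> B (u - v) (u - v)" "0 \<le> B (u + v - r) (u + v - r)" by (rule B_nonneg)+
  then have "B u v \<le> 2" "- 1 \<le> B u v"
    using nbrD[OF assms(1)] nbrD[OF assms(2)] r B_sym[of r u] B_sym[of r v] B_sym[of v u]
    by (simp_all add: B_simps)
  moreover have "eqv u v" if "B u v = 2"
    using that nbrD[OF assms(1)] nbrD[OF assms(2)] B_sym[of v u] by (simp add: eqv_def B_simps)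
  moreover have "eqv u (r - v)" if "B u v = - 1"
    using that nbrD[OF assms(1)] nbrD[OF assms(2)] r B_sym[of r u] B_sym[of r v] B_sym[of v u]
    by (simp add: eqv_def B_simps)
  moreover have "B u v = - 1 \<or> B u v = 0 \<or> B u v = 1 \<or> B u v = 2"
    using calculation(1,2) by presburger
  ultimately show ?thesis by blast
qed

text \<open>A longest list cannot be prolonged, so each candidate violates \<open>R\<close> with
  some member. With \<open>R\<close> as "product 1", \<open>nbr_cases\<close> then leaves only
  products that put the candidate into the span of the list and the triple.\<close>

lemma exists_maximal_list:
  assumes bound: "\<And>fs. \<lbrakk>set fs \<subseteq> F; sorted_wrt R fs\<rbrakk> \<Longrightarrow> length fs \<le> (k::nat)"
  shows "\<exists>fs. set fs \<subseteq> F \<and> sorted_wrt R fs \<and> length fs \<le> k \<and> (\<forall>e\<in>F. \<exists>f\<in>set fs. \<not> R e f)"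
proof -
  let ?P = "\<lambda>fs. set fs \<subseteq> F \<and> sorted_wrt R fs"
  have "?P []" by simp
  then obtain fs where fs: "?P fs" and max: "\<And>gs. ?P gs \<Longrightarrow> length gs \<le> length fs"
    using ex_has_greatest_nat[of ?P "[]" length "k + 1"] bound
    by (metis (no_types, lifting) le_imp_less_Suc Suc_eq_plus1)
  have "\<exists>f\<in>set fs. \<not> R e f" if "e \<in> F" for e
  proof (rule ccontr)
    assume "\<not> ?thesis"
    then have "?P (e # fs)" using fs that by auto
    then show False using max by fastforce
  qed
  then show ?thesis using fs bound by blast
qed

text \<open>The lattice spanned by \<open>r, u1, u2, u3, x, y\<close> and \<open>fs\<close> is of type \<open>E\<^sub>6\<close> or \<open>E\<^sub>7\<close> if \<open>fs\<close> has
  length \<open>0\<close> or \<open>1\<close>, and of type \<open>E\<^sub>8\<close> otherwise.\<close>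

lemma cover_two_pillars:
  assumes u: "nbr r u1" "nbr r u2" "nbr r u3" "B u1 u2 = 0" "B u1 u3 = 0" "B u2 u3 = 0"
    and x: "nbr r x" "B x u1 = 1" "B x u2 = 1" "B x u3 = 0"
    and y: "nbr r y" "B y u1 = 1" "B y u2 = 0" "B y u3 = 1" "B x y = 1"
  shows "\<exists>fs. length fs \<le> 3 \<and> sorted_wrt (\<lambda>e f. B e f = 1) fs \<and>
    (\<forall>f\<in>set fs. nbr r f \<and> B f u1 = 1 \<and> B f u2 = 1 \<and> B f u3 = 0 \<and> B f x = 1 \<and> B f y = 1) \<and>
    (\<forall>C u. eqv_subgroup C \<longrightarrow> (\<forall>b\<in>set ([r, u1, u2, u3, x, y] @ fs). C b) \<longrightarrow> nbr r u \<longrightarrow> C u)"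
proof -
  \<comment> \<open>The product with \<open>y\<close> selects one member of each orthogonal pair in
    the pillar of \<open>u2\<close>, because the two products with \<open>y\<close> add up to
    \<open>B u1 y + B u2 y = 1\<close>.\<close>
  let ?F = "{f. nbr r f \<and> B f u1 = 1 \<and> B f u2 = 1 \<and> B f u3 = 0 \<and> B f x = 1 \<and> B f y = 1}"
  note gram' = u(4-6) x(2-4) y(2-5) r nbrD(1)[OF u(1)] nbrD(1)[OF u(2)] nbrD(1)[OF u(3)] nbrD(1)[OF x(1)]
    nbrD(1)[OF y(1)] nbrD(2)[OF u(1)] nbrD(2)[OF u(2)] nbrD(2)[OF u(3)] nbrD(2)[OF x(1)] nbrD(2)[OF y(1)]
  note gram = gram' gram'[THEN trans[OF B_sym]]
  have FD: "B f f = 2" "B f r = 1" "B f u1 = 1" "B f u2 = 1" "B f u3 = 0" "B f x = 1" "B f y = 1"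
    "B r f = 1" "B u1 f = 1" "B u2 f = 1" "B u3 f = 0" "B x f = 1" "B y f = 1" if "f \<in> ?F" for f
  proof -
    show "B f f = 2" "B f r = 1" "B f u1 = 1" "B f u2 = 1" "B f u3 = 0" "B f x = 1" "B f y = 1"
      using that by (simp_all add: nbr_def)
    then show "B r f = 1" "B u1 f = 1" "B u2 f = 1" "B u3 f = 0" "B x f = 1" "B y f = 1"
      using B_sym[of r f] B_sym[of u1 f] B_sym[of u2 f] B_sym[of u3 f] B_sym[of x f] B_sym[of y f] by simp_all
  qed
  have len: "length fs \<le> 3" if fs: "set fs \<subseteq> ?F" "sorted_wrt (\<lambda>e f. B e f = 1) fs" for fs
  proof -
    \<comment> \<open>\<open>f + f - u1 - u2\<close> is the difference of the orthogonal pair of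
      \<open>f\<close>. For the members of \<open>fs\<close> these differences have norm 4, are
      pairwise orthogonal and orthogonal to \<open>r\<close>, the triple and \<open>x\<close>, and
      have product 1 with \<open>y\<close>.\<close>
    define s where "s gs = sum_list (map (\<lambda>f. f + f - u1 - u2) gs)" for gs
    have s_Cons: "s (g # gs) = (g + g - u1 - u2) + s gs" for g gs by (simp add: s_def)
    have s_Nil: "s [] = 0" by (simp add: s_def)
    have s1: "B (s gs) u1 = 0 \<and> B (s gs) u2 = 0 \<and> B (s gs) u3 = 0 \<and> B (s gs) r = 0
        \<and> B (s gs) x = 0 \<and> B (s gs) y = int (length gs)"
      if "set gs \<subseteq> ?F" for gs
      using that
    proof (induction gs)
      case (Cons g gs)
      then have "g \<in> ?F" "set gs \<subseteq> ?F" by auto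
      with Cons.IH FD[OF this(1)] show ?case by (simp add: s_Cons B_simps gram)
    qed (simp add: s_Nil B_zero)
    have s2: "B (s gs) e = 0"
      if "set gs \<subseteq> ?F" "\<forall>f\<in>set gs. B f e = 1" "e \<in> ?F" for gs e
      using that(1,2)
    proof (induction gs)
      case (Cons g gs)
      then have "set gs \<subseteq> ?F" "B g e = 1" "\<forall>f\<in>set gs. B f e = 1" by auto
      with Cons.IH show ?case by (simp add: s_Cons B_simps gram FD[OF that(3)])
    qed (simp add: s_Nil B_zero)
    have s3: "B (s gs) (s gs) = 4 * int (length gs)"
      if "set gs \<subseteq> ?F" "sorted_wrt (\<lambda>e f. B e f = 1) gs" for gs
      using that
    proof (induction gs)
      case Nil
      then show ?case by (simp add: s_Nil B_zero)
    next
      case (Cons g gs)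
      have g: "g \<in> ?F" and gs: "set gs \<subseteq> ?F" using Cons.prems by auto
      have "\<forall>f\<in>set gs. B f g = 1" using Cons.prems B_sym by auto
      then have sg: "B (s gs) g = 0"
        using s2[of gs g] g gs by auto
      have IH: "B (s gs) (s gs) = 4 * int (length gs)"
        using Cons.IH gs Cons.prems by simp
      from s1[OF gs] have "B (s gs) u1 = 0" "B (s gs) u2 = 0" by auto
      note zero = this sg
      show ?case
        using IH by (simp add: s_Cons B_simps gram FD[OF g] zero zero[THEN trans[OF B_sym]])
    qed
    \<comment> \<open>Bessel's inequality: the pair difference of \<open>y\<close> has product 2
      with that of \<open>x\<close> and with that of each \<open>f\<close>, and these are orthogonal
      of norm 4. \<open>?z\<close> is twice the residue of the projection onto them.\<close>
    let ?z = "(y + y - u1 - u3) + (y + y - u1 - u3) - (x + x - u1 - u2) - s fs"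
    have "0 \<le> B ?z ?z" by (rule B_nonneg)
    also have "B ?z ?z = 4 * (3 - int (length fs))"
    proof -
      have z: "B (s fs) u1 = 0" "B (s fs) u2 = 0" "B (s fs) u3 = 0" "B (s fs) x = 0"
        "B (s fs) y = int (length fs)" using s1[OF fs(1)] by auto
      show ?thesis
        using s3[OF fs] by (simp add: B_simps gram z z[THEN trans[OF B_sym]])
    qed
    finally show ?thesis by simp
  qed
  from exists_maximal_list[of ?F "\<lambda>e f. B e f = 1" 3] len
  obtain fs where fs: "set fs \<subseteq> ?F" "sorted_wrt (\<lambda>e f. B e f = 1) fs" "length fs \<le> 3"
    and max: "\<And>e. e \<in> ?F \<Longrightarrow> \<exists>f\<in>set fs. B e f \<noteq> 1" by blast
  \<comment> \<open>All members of \<open>?F\<close> have product 1 with \<open>y\<close>, whereas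
    \<open>r - f\<close> and the antipode \<open>u1 + u2 - f\<close> have product 0 with it; this
    excludes both alternatives to \<open>eqv e f\<close>.\<close>
  have F_cover: "\<exists>f\<in>set fs. eqv e f" if e: "e \<in> ?F" for e
  proof -
    obtain f where f: "f \<in> set fs" "B e f \<noteq> 1" using max[OF e] by blast
    then have fF: "f \<in> ?F" using fs by auto
    have "\<not> eqv e (r - f)"
    proof
      assume "eqv e (r - f)"
      from eqv_cong[OF this, of y] show False by (simp add: B_simps gram FD[OF e] FD[OF fF])
    qed
    moreover have "B e f \<noteq> 0"
    proof
      assume "B e f = 0"
      then have "eqv (e + f) (u1 + u2)"
        by (simp add: eqv_def B_simps gram FD[OF e] FD[OF fF] B_sym[of f e])
      from eqv_cong[OF this, of y] show False by (simp add: B_simps gram FD[OF e] FD[OF fF])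
    qed
    ultimately have "eqv e f" using nbr_cases[of e f] e fF f(2) by auto
    then show ?thesis using f by blast
  qed
  have cover: "C u" if C: "eqv_subgroup C" and base: "\<forall>b\<in>set ([r, u1, u2, u3, x, y] @ fs). C b"
    and w: "nbr r u" for C u
  proof -
    have Cr: "C r" and Cu: "C u1" "C u2" "C u3" and Cx: "C x" and Cy: "C y"
      using base by auto
    note Cd = eqv_subgroup_diff[OF C] and Ca = eqv_subgroup_add[OF C] and Ce = eqv_subgroup_eqv[OF C]
    have CF: "C e" if "e \<in> ?F" for e
      using F_cover[OF that] base Ce by auto
    have compl: "C v" if "C (r - v)" for v
      using Cd[OF Cr that] by simp
    \<comment> \<open>A product -1 or 2 with a root of \<open>C\<close> already means membership in
      \<open>C\<close> modulo the radical, so below all products may be taken to be 0 or 1.\<close>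
    have close: "C v \<or> B v b = 0 \<or> B v b = 1" if "nbr r v" "nbr r b" "C b" for v b
      using nbr_cases[OF that(1,2)] Ce[of v b] Ce[of v "r - b"] Cd[OF Cr that(3)] that(3) by blast
    let ?u4 = "r + r - u1 - u2 - u3"
    have u4: "nbr r ?u4" "C ?u4"
      using Cr Cu by (auto simp: nbr_def B_simps gram intro!: Cd Ca)
    have main: "C v" if v: "nbr r v" and v1: "B v u1 = 1" for v
    proof -
      note vr = nbrD[OF v] v1
      note vs = vr vr[THEN trans[OF B_sym]]
      \<comment> \<open>The product with \<open>?u4\<close> is \<open>1 - B v u2 - B v u3\<close>;
        its range forbids that both products are 1.\<close>
      have pil: "C v \<or> B v u2 = 1 \<and> B v u3 = 0 \<or> B v u2 = 0 \<and> B v u3 = 1 \<or> B v u2 = 0 \<and> B v u3 = 0"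
        using close[OF v u(2) Cu(2)] close[OF v u(3) Cu(3)] close[OF v u4]
        by (auto simp: B_simps vs)
      have xy: "C v \<or> (B v x = 0 \<or> B v x = 1) \<and> (B v y = 0 \<or> B v y = 1)"
        using close[OF v x(1) Cx] close[OF v y(1) Cy] by auto
      consider "C v" | (p2) "B v u2 = 1" "B v u3 = 0" | (p3) "B v u2 = 0" "B v u3 = 1"
        | (p4) "B v u2 = 0" "B v u3 = 0" using pil by blast
      then show ?thesis
      proof cases
        case p2
        note g = vs p2 p2[THEN trans[OF B_sym]] gram
        have n: "nbr r (u1 + u2 - v)"
          by (simp add: nbr_def B_simps g)
        have bck: "C v" if "C (u1 + u2 - v)"
          using Cd[OF Ca[OF Cu(1,2)] that] by simp
        \<comment> \<open>Here the antipode has product 2 with \<open>x\<close>, so it agrees with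
          \<open>x\<close> modulo the radical.\<close>
        have "C v" if "B v x = 0"
          using close[OF n x(1) Cx] bck that by (simp add: B_simps g)
        moreover have "C v" if "B v x = 1" "B v y = 1"
          using CF[of v] that v v1 p2 by simp
        moreover have "C v" if "B v x = 1" "B v y = 0"
          using CF[of "u1 + u2 - v"] n bck that by (simp add: B_simps g)
        ultimately show ?thesis using xy by blast
      next
        case p3
        have *: "C w" if w: "nbr r w" "B w u1 = 1" "B w u2 = 0" "B w u3 = 1" "B w y = 1" "B w x = 1" for w
        proof -
          note w' = nbrD[OF w(1)] w(2-)
          \<comment> \<open>Translation by \<open>y - x + u2 - u3\<close> leads from the pillar of
            \<open>u3\<close> into that of \<open>u2\<close>, where \<open>CF\<close>
            applies.\<close>
          have "w + y - x + u2 - u3 \<in> ?F"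
            by (simp add: nbr_def B_simps gram w' w'[THEN trans[OF B_sym]])
          then have "C (w + y - x + u2 - u3)" by (rule CF)
          from Cd[OF Ca[OF Cd[OF Ca[OF this Cu(3)] Cu(2)] Cx] Cy] show ?thesis by simp
        qed
        note g = vs p3 p3[THEN trans[OF B_sym]] gram
        have n: "nbr r (u1 + u3 - v)"
          by (simp add: nbr_def B_simps g)
        have bck: "C v" if "C (u1 + u3 - v)"
          using Cd[OF Ca[OF Cu(1,3)] that] by simp
        have y0: "C v" if "B v y = 0"
          using close[OF n y(1) Cy] bck that by (simp add: B_simps g)
        moreover have "C v" if "B v x = 1" "B v y = 1"
          using *[of v] that v v1 p3 by auto
        moreover have "C v" if "B v x = 0" "B v y = 1"
          using *[of "u1 + u3 - v"] n bck that by (simp add: B_simps g)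
        ultimately show ?thesis using xy by blast
      next
        case p4
        note g = vs p4 p4[THEN trans[OF B_sym]] gram
        let ?a = "r + r - u2 - u3 - v"
        have *: "C w" if w: "nbr r w" "B w u1 = 1" "B w u2 = 0" "B w u3 = 0" "B w y = 1" "B w x = 1" for w
        proof -
          note w' = nbrD[OF w(1)] w(2-)
          \<comment> \<open>The fourth pillar is carried into that of \<open>u2\<close> as well,
            this time with a change of sign of \<open>w\<close>.\<close>
          have "y - w + r - u3 \<in> ?F"
            by (simp add: nbr_def B_simps gram w' w'[THEN trans[OF B_sym]])
          then have "C (y - w + r - u3)" by (rule CF)
          from Cd[OF Cd[OF Ca[OF Cy Cr] Cu(3)] this] show ?thesis by simp
        qed
        have **: "C w" if w: "nbr r w" "B w u1 = 1" "B w u2 = 0" "B w u3 = 0" "B w y = 0" "B w x = 1" for w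
        proof -
          note w' = nbrD[OF w(1)] w(2-)
          \<comment> \<open>These products determine \<open>w\<close> modulo the radical.\<close>
          have "eqv w (x - y + r - u2)"
            by (simp add: eqv_def B_simps gram w' w'[THEN trans[OF B_sym]])
          moreover have "C (x - y + r - u2)"
            by (intro Cd Ca Cu Cr Cx Cy)
          ultimately show ?thesis by (rule Ce)
        qed
        have n: "nbr r ?a"
          by (simp add: nbr_def B_simps g)
        have bck: "C v" if "C ?a"
          using Cd[OF Cd[OF Cd[OF Ca[OF Cr Cr] Cu(2)] Cu(3)] that] by simp
        have "C v" if "B v x = 1" "B v y = 1"
          using *[of v] that v v1 p4 by auto
        moreover have "C v" if "B v x = 1" "B v y = 0"
          using **[of v] that v v1 p4 by auto
        moreover have "C v" if "B v x = 0" "B v y = 0"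
          using *[of ?a] n bck that by (simp add: B_simps g)
        moreover have "C v" if "B v x = 0" "B v y = 1"
          using **[of ?a] n bck that by (simp add: B_simps g)
        ultimately show ?thesis using xy by blast
      qed
    qed
    show "C u"
    proof -
      consider "C u" | "B u u1 = 0" | "B u u1 = 1" using close[OF w u(1) Cu(1)] by blast
      then show ?thesis
      proof cases
        case 2
        then have "B (r - u) u1 = 1" by (simp add: B_simps gram)
        then show ?thesis using main[OF nbr_compl[OF w]] compl by blast
      qed (use main w in auto)
    qed
  qed
  show ?thesis
  proof (intro exI[of _ fs] conjI allI impI)
    show "\<forall>f\<in>set fs. nbr r f \<and> B f u1 = 1 \<and> B f u2 = 1 \<and> B f u3 = 0 \<and> B f x = 1 \<and> B f y = 1"
      using fs(1) by blast
  qed (rule fs cover; assumption)+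
qed
end
end

section \<open>The lattice E8\<close>

lemma E8_carrier: "v \<in> E8 \<Longrightarrow> v \<in> carrier_vec 8"
  by (auto simp: E8_def D8_def)

lemma E8_root_carrier: "v \<in> E8_roots \<Longrightarrow> v \<in> carrier_vec 8"
  by (auto simp: E8_roots_def E8_carrier)

lemma scalar_prod_sum8: "x \<in> carrier_vec 8 \<Longrightarrow> y \<in> carrier_vec 8 \<Longrightarrow> x \<bullet> y = (\<Sum>i<8. x $ i * y $ i)"
  by (auto simp: scalar_prod_def lessThan_atLeast0)

text \<open>Adding \<open>j/2\<close> changes the coordinate sum by 4, so one parity condition
  serves both cosets and only the common shift \<open>h\<close> of the coordinates tells them
  apart.\<close>

lemma E8_iff:
  "v \<in> E8 \<longleftrightarrow> v \<in> carrier_vec 8 \<and>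
    (\<exists>h\<in>{0, 1/2}. \<forall>i<8. v $ i - h \<in> \<int>) \<and> (\<Sum>i<8. v $ i) / 2 \<in> \<int>"
proof -
  have D8: "d \<in> D8 \<longleftrightarrow> d \<in> carrier_vec 8 \<and> (\<forall>i<8. d $ i \<in> \<int>) \<and> (\<Sum>i<8. d $ i) / 2 \<in> \<int>" for d :: "real vec"
  proof -
    have "(\<exists>k::int. s = 2 * of_int k) \<longleftrightarrow> s / 2 \<in> \<int>" for s :: real
      by (auto simp: Ints_def image_iff field_simps)
    then show ?thesis by (auto simp: D8_def scalar_prod_def lessThan_atLeast0)
  qed
  let ?h = "vec 8 (\<lambda>_. 1 / 2) :: real vec"
  have half: "v \<in> (\<lambda>d. ?h + d) ` D8 \<longleftrightarrow> v \<in> carrier_vec 8 \<and> v - ?h \<in> D8"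
  proof
    assume "v \<in> carrier_vec 8 \<and> v - ?h \<in> D8"
    moreover from this have "?h + (v - ?h) = v" by auto
    ultimately show "v \<in> (\<lambda>d. ?h + d) ` D8" by (metis image_eqI)
  next
    assume "v \<in> (\<lambda>d. ?h + d) ` D8"
    then obtain d where d: "d \<in> D8" "v = ?h + d" by auto
    then have "v - ?h = d" "v \<in> carrier_vec 8" by (auto simp: D8)
    then show "v \<in> carrier_vec 8 \<and> v - ?h \<in> D8" using d by simp
  qed
  have "(\<Sum>i<8. v $ i - 1 / 2) = (\<Sum>i<8. v $ i) - 4"
    by (simp add: sum_subtractf)
  then have "(\<Sum>i<8. (v - ?h) $ i) / 2 \<in> \<int> \<longleftrightarrow> (\<Sum>i<8. v $ i) / 2 - 2 \<in> \<int>"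
    by (simp add: diff_divide_distrib)
  also have "\<dots> \<longleftrightarrow> (\<Sum>i<8. v $ i) / 2 \<in> \<int>"
    by (metis Ints_add Ints_diff Ints_numeral diff_add_cancel)
  finally show ?thesis
    by (auto simp: E8_def half D8)
qed

lemma E8_diff:
  assumes "v \<in> E8" "w \<in> E8"
  shows "v - w \<in> E8"
proof -
  from assms obtain h h' where h: "h \<in> {0, 1/2}" "\<forall>i<8. v $ i - h \<in> \<int>"
    and h': "h' \<in> {0, 1/2}" "\<forall>i<8. w $ i - h' \<in> \<int>"
    and s: "(\<Sum>i<8. v $ i) / 2 \<in> \<int>" "(\<Sum>i<8. w $ i) / 2 \<in> \<int>"
    and c: "v \<in> carrier_vec 8" "w \<in> carrier_vec 8"
    unfolding E8_iff by blast
  have "(\<Sum>i<8. (v - w) $ i) / 2 = (\<Sum>i<8. v $ i) / 2 - (\<Sum>i<8. w $ i) / 2"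
    using c by (simp add: sum_subtractf diff_divide_distrib)
  then have sum: "(\<Sum>i<8. (v - w) $ i) / 2 \<in> \<int>" using Ints_diff[OF s] by (simp only:)
  \<comment> \<open>The difference of the shifts may be -1/2, which is the shift 1/2 up to the
    integer 1.\<close>
  let ?g = "if h = h' then 0 else 1/2 :: real"
  have "(v - w) $ i - ?g \<in> \<int>" if "i < 8" for i
  proof -
    have int: "v $ i - h \<in> \<int>" "w $ i - h' \<in> \<int>" using h h' that by auto
    then have *: "(v $ i - h) - (w $ i - h') \<in> \<int>" "(v $ i - h) - (w $ i - h') - 1 \<in> \<int>" by auto
    have "(v - w) $ i - ?g = (v $ i - h) - (w $ i - h') \<or> (v - w) $ i - ?g = (v $ i - h) - (w $ i - h') - 1"
      using h(1) h'(1) c that by auto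
    then show ?thesis using * by metis
  qed
  then show ?thesis
    using c sum unfolding E8_iff by (intro conjI bexI[of _ ?g]) auto
qed

lemma E8_scalar_prod_Ints:
  assumes "v \<in> E8" "w \<in> E8"
  shows "v \<bullet> w \<in> \<int>"
proof -
  from assms obtain h h' where h: "h \<in> {0, 1/2}" "\<forall>i<8. v $ i - h \<in> \<int>"
    and h': "h' \<in> {0, 1/2}" "\<forall>i<8. w $ i - h' \<in> \<int>"
    and s: "(\<Sum>i<8. v $ i) / 2 \<in> \<int>" "(\<Sum>i<8. w $ i) / 2 \<in> \<int>"
    and c: "v \<in> carrier_vec 8" "w \<in> carrier_vec 8"
    unfolding E8_iff by blast
  \<comment> \<open>The mixed terms involve only coordinate sums. Their halves are integers by the
    parity condition, and so are the remaining factors \<open>2 * h\<close> and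
    \<open>2 * h'\<close>.\<close>
  have "v \<bullet> w = (\<Sum>i<8. (v $ i - h) * (w $ i - h') + h' * v $ i + h * w $ i - h * h')"
    using c by (simp add: scalar_prod_sum8 algebra_simps)
  also have "\<dots> = (\<Sum>i<8. (v $ i - h) * (w $ i - h')) + 2 * h' * ((\<Sum>i<8. v $ i) / 2)
      + 2 * h * ((\<Sum>i<8. w $ i) / 2) - 8 * h * h'"
    by (simp add: sum.distrib sum_subtractf) (simp only: sum_distrib_left[symmetric])
  also have "\<dots> \<in> \<int>"
  proof -
    have half: "h \<noteq> 0 \<Longrightarrow> h = 1/2" "h' \<noteq> 0 \<Longrightarrow> h' = 1/2" using h(1) h'(1) by blast+
    have "2 * h' \<in> \<int>" "2 * h \<in> \<int>" "8 * h * h' \<in> \<int>"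
      by (cases "h = 0"; cases "h' = 0"; simp add: half)+
    moreover have "(\<Sum>i<8. (v $ i - h) * (w $ i - h')) \<in> \<int>"
      using h(2) h'(2) by (intro Ints_sum Ints_mult) simp_all
    ultimately show ?thesis using s by (intro Ints_diff Ints_add Ints_mult[OF _ s(1)] Ints_mult[OF _ s(2)])
  qed
  finally show ?thesis .
qed

lemma E8_int_smult:
  assumes "v \<in> E8" "c \<in> \<int>"
  shows "c \<cdot>\<^sub>v v \<in> E8"
proof -
  note cv = E8_carrier[OF assms(1)]
  have v0: "0\<^sub>v 8 \<in> E8" using E8_diff[OF assms(1,1)] cv by simp
  have neg: "- w \<in> E8" if "w \<in> E8" for w
    using E8_diff[OF v0 that] E8_carrier[OF that] by simp
  have nat: "real k \<cdot>\<^sub>v v \<in> E8" for k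
  proof (induction k)
    case 0
    have "0 \<cdot>\<^sub>v v = 0\<^sub>v 8" using cv by auto
    then show ?case using v0 by simp
  next
    case (Suc k)
    have "real (Suc k) \<cdot>\<^sub>v v = real k \<cdot>\<^sub>v v - (- v)"
      using cv by (auto simp: algebra_simps)
    then show ?case using E8_diff[OF Suc neg[OF assms(1)]] by simp
  qed
  from assms(2) obtain k :: int where k: "c = of_int k" by (auto elim: Ints_cases)
  show ?thesis
  proof (cases "k \<ge> 0")
    case True
    then have "c = real (nat k)" using k by simp
    then show ?thesis using nat by simp
  next
    case False
    then have "c \<cdot>\<^sub>v v = - (real (nat (- k)) \<cdot>\<^sub>v v)" using k cv by auto
    then show ?thesis using nat neg by simp
  qed
qed

lemmas ip8_simps = minus_scalar_prod_distrib[where n = 8] scalar_prod_minus_distrib[where n = 8]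
  smult_scalar_prod_distrib[where n = 8] scalar_prod_smult_distrib[where n = 8]

lemma vec8_eqI:
  assumes "x \<in> carrier_vec 8" "y \<in> carrier_vec 8" "(x - y) \<bullet> (x - y) = (0 :: real)"
  shows "x = y"
proof -
  have "(\<Sum>i<8. (x $ i - y $ i)\<^sup>2) = 0"
    using assms by (simp add: scalar_prod_sum8 power2_eq_square)
  then have "\<forall>i<8. x $ i = y $ i"
    by (subst (asm) sum_nonneg_eq_0_iff) auto
  then show ?thesis using assms by (intro eq_vecI) auto
qed

lemma scalar_prod_self_nonneg8: "x \<in> carrier_vec 8 \<Longrightarrow> 0 \<le> x \<bullet> (x :: real vec)"
  by (simp add: scalar_prod_sum8 sum_nonneg)

section \<open>The Weyl group\<close>

lemma root_reflection_apply:
  "x \<in> carrier_vec 8 \<Longrightarrow> root_reflection u x = x - (x \<bullet> u) \<cdot>\<^sub>v u"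
  by (simp add: root_reflection_def)

lemma root_reflection_involution:
  assumes "u \<in> E8_roots" "x \<in> carrier_vec 8"
  shows "root_reflection u (root_reflection u x) = x"
proof -
  note u = E8_root_carrier[OF assms(1)]
  have "u \<bullet> u = 2" using assms by (simp add: E8_roots_def)
  then have "(x - (x \<bullet> u) \<cdot>\<^sub>v u) - ((x - (x \<bullet> u) \<cdot>\<^sub>v u) \<bullet> u) \<cdot>\<^sub>v u = x"
    using u assms by (intro eq_vecI) (auto simp: ip8_simps algebra_simps)
  then show ?thesis
    using assms u by (simp add: root_reflection_apply)
qed

lemma root_reflection_Bij:
  assumes "u \<in> E8_roots"
  shows "root_reflection u \<in> Bij (carrier_vec 8)"
proof -
  have maps: "root_reflection u x \<in> carrier_vec 8" if "x \<in> carrier_vec 8" for x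
    using that E8_root_carrier[OF assms] by (simp add: root_reflection_apply)
  have "bij_betw (root_reflection u) (carrier_vec 8) (carrier_vec 8)"
    by (rule bij_betwI[where g = "root_reflection u"])
      (auto simp: maps root_reflection_involution[OF assms])
  then show ?thesis by (simp add: Bij_def root_reflection_def)
qed

lemma E8_Weyl_subgroup: "subgroup E8_Weyl (BijGroup (carrier_vec 8))"
  unfolding E8_Weyl_def
  by (rule group.generate_is_subgroup[OF group_BijGroup])
    (auto simp: BijGroup_def root_reflection_Bij)

lemma E8_Weyl_Bij: "w \<in> E8_Weyl \<Longrightarrow> w \<in> Bij (carrier_vec 8)"
  using subgroup.subset[OF E8_Weyl_subgroup] by (auto simp: BijGroup_def)

lemma E8_Weyl_carrier: "w \<in> E8_Weyl \<Longrightarrow> x \<in> carrier_vec 8 \<Longrightarrow> w x \<in> carrier_vec 8"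
  using E8_Weyl_Bij Bij_imp_funcset by blast

lemma E8_Weyl_id: "(\<lambda>x\<in>carrier_vec 8. x) \<in> E8_Weyl"
  using subgroup.one_closed[OF E8_Weyl_subgroup] by (simp add: BijGroup_def)

lemma E8_Weyl_compose:
  assumes "w \<in> E8_Weyl" "w' \<in> E8_Weyl"
  shows "compose (carrier_vec 8) w w' \<in> E8_Weyl"
  using subgroup.m_closed[OF E8_Weyl_subgroup assms] E8_Weyl_Bij[OF assms(1)] E8_Weyl_Bij[OF assms(2)]
  by (simp add: BijGroup_def)

lemma E8_Weyl_inverse:
  assumes w: "w \<in> E8_Weyl"
  obtains w' where "w' \<in> E8_Weyl" "\<And>x. x \<in> carrier_vec 8 \<Longrightarrow> w' (w x) = x"
    "\<And>x. x \<in> carrier_vec 8 \<Longrightarrow> w (w' x) = x"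
proof -
  interpret G: group "BijGroup (carrier_vec 8)" by (rule group_BijGroup)
  let ?w' = "inv\<^bsub>BijGroup (carrier_vec 8)\<^esub> w"
  have w': "?w' \<in> E8_Weyl" using w by (rule subgroup.m_inv_closed[OF E8_Weyl_subgroup])
  have "w \<in> carrier (BijGroup (carrier_vec 8))"
    using E8_Weyl_Bij[OF w] by (simp add: BijGroup_def)
  then have eq: "compose (carrier_vec 8) ?w' w = (\<lambda>x\<in>carrier_vec 8. x)"
    "compose (carrier_vec 8) w ?w' = (\<lambda>x\<in>carrier_vec 8. x)"
    using G.l_inv[of w] G.r_inv[of w] E8_Weyl_Bij[OF w] E8_Weyl_Bij[OF w'] by (auto simp: BijGroup_def)
  have "?w' (w x) = x" "w (?w' x) = x" if "x \<in> carrier_vec 8" for x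
    using fun_cong[OF eq(1), of x] fun_cong[OF eq(2), of x] that by (auto simp: compose_def)
  then show ?thesis using that w' by blast
qed

lemma root_reflection_Weyl: "u \<in> E8_roots \<Longrightarrow> root_reflection u \<in> E8_Weyl"
  unfolding E8_Weyl_def by (auto intro: generate.incl)

text \<open>Inverses of generators give no separate case because a reflection is its own
  inverse.\<close>

lemma E8_Weyl_induct [consumes 1, case_names id reflection compose]:
  assumes "w \<in> E8_Weyl"
    and "P (\<lambda>x\<in>carrier_vec 8. x)"
    and "\<And>u. u \<in> E8_roots \<Longrightarrow> P (root_reflection u)"
    and "\<And>w w'. w \<in> E8_Weyl \<Longrightarrow> w' \<in> E8_Weyl \<Longrightarrow> P w \<Longrightarrow> P w' \<Longrightarrow> P (compose (carrier_vec 8) w w')"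
  shows "P w"
  using assms(1) unfolding E8_Weyl_def
proof (induction rule: generate.induct)
  case one
  have eq: "\<one>\<^bsub>BijGroup (carrier_vec 8)\<^esub> = (\<lambda>x\<in>carrier_vec 8. x :: real vec)"
    unfolding BijGroup_def by (rule monoid.select_convs(2))
  show ?case unfolding eq by (rule assms(2))
next
  case (incl h)
  then show ?case using assms(3) by auto
next
  case (inv h)
  then obtain u where u: "u \<in> E8_roots" "h = root_reflection u" by auto
  interpret G: group "BijGroup (carrier_vec 8)" by (rule group_BijGroup)
  have B: "h \<in> Bij (carrier_vec 8)" using root_reflection_Bij u by simp
  have "compose (carrier_vec 8) h h = (\<lambda>x\<in>carrier_vec 8. x)"
    using root_reflection_involution[OF u(1)] by (auto simp: compose_def u(2))
  then have "inv\<^bsub>BijGroup (carrier_vec 8)\<^esub> h = h"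
    using B by (intro G.inv_equality) (auto simp: BijGroup_def)
  then show ?case using assms(3) u by auto
next
  case (eng h1 h2)
  then have h: "h1 \<in> E8_Weyl" "h2 \<in> E8_Weyl" by (auto simp: E8_Weyl_def)
  have "h1 \<otimes>\<^bsub>BijGroup (carrier_vec 8)\<^esub> h2 = compose (carrier_vec 8) h1 h2"
    using E8_Weyl_Bij[OF h(1)] E8_Weyl_Bij[OF h(2)] by (simp add: BijGroup_def)
  then show ?case using assms(4)[OF h eng.IH] by simp
qed

lemma E8_Weyl_scalar_prod:
  assumes "w \<in> E8_Weyl" "x \<in> carrier_vec 8" "y \<in> carrier_vec 8"
  shows "w x \<bullet> w y = x \<bullet> y"
  using assms
proof (induction arbitrary: x y rule: E8_Weyl_induct)
  case (reflection u)
  note u = E8_root_carrier[OF reflection(1)]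
  have "u \<bullet> u = 2" using reflection by (simp add: E8_roots_def)
  moreover have "u \<bullet> y = y \<bullet> u" using u reflection comm_scalar_prod by blast
  ultimately show ?case
    using u reflection by (simp add: root_reflection_apply ip8_simps algebra_simps)
qed (auto simp: compose_def E8_Weyl_carrier)

lemma E8_Weyl_diff:
  assumes "w \<in> E8_Weyl" "x \<in> carrier_vec 8" "y \<in> carrier_vec 8"
  shows "w (x - y) = w x - w y"
  using assms
proof (induction arbitrary: x y rule: E8_Weyl_induct)
  case (reflection u)
  note u = E8_root_carrier[OF reflection(1)]
  show ?case
    using u reflection by (simp add: root_reflection_apply ip8_simps) (auto simp: algebra_simps)
qed (auto simp: compose_def E8_Weyl_carrier)

lemma E8_Weyl_E8:
  assumes "w \<in> E8_Weyl" "x \<in> E8"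
  shows "w x \<in> E8"
  using assms
proof (induction arbitrary: x rule: E8_Weyl_induct)
  case (reflection u)
  then show ?case
    by (auto simp: root_reflection_apply E8_carrier E8_roots_def intro!: E8_diff E8_int_smult E8_scalar_prod_Ints)
qed (auto simp: compose_def E8_carrier)

lemma E8_Weyl_roots: "w \<in> E8_Weyl \<Longrightarrow> x \<in> E8_roots \<Longrightarrow> w x \<in> E8_roots"
  by (auto simp: E8_roots_def E8_Weyl_E8 E8_Weyl_scalar_prod E8_carrier)

section \<open>The list of roots\<close>

text \<open>Vectors of \<open>E8\<close> are represented by the list of their doubled coordinates.\<close>

definition half_vec :: "int list \<Rightarrow> real vec" where
  "half_vec xs = vec_of_list (map (\<lambda>i. of_int i / 2) xs)"

fun dotl :: "int list \<Rightarrow> int list \<Rightarrow> int" where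
  "dotl (x # xs) (y # ys) = x * y + dotl xs ys"
| "dotl _ _ = 0"

lemma half_vec_carrier: "length xs = 8 \<Longrightarrow> half_vec xs \<in> carrier_vec 8"
  by (rule carrier_vecI) (simp add: half_vec_def)

lemma dotl_sum: "length xs = length ys \<Longrightarrow> dotl xs ys = (\<Sum>i<length xs. xs ! i * ys ! i)"
  by (induction xs ys rule: dotl.induct) (auto simp del: sum.lessThan_Suc simp: sum.lessThan_Suc_shift)

lemma half_vec_scalar_prod:
  assumes "length xs = 8" "length ys = 8"
  shows "half_vec xs \<bullet> half_vec ys = of_int (dotl xs ys) / 4"
proof -
  have "half_vec xs \<bullet> half_vec ys = (\<Sum>i<8. of_int (xs ! i * ys ! i) / 4)"
    using assms half_vec_carrier by (simp add: scalar_prod_sum8) (simp add: half_vec_def vec_of_list_index)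
  also have "\<dots> = of_int (dotl xs ys) / 4"
    using assms by (simp add: dotl_sum sum_divide_distrib)
  finally show ?thesis .
qed

text \<open>Lists over 0, 2, -2 with exactly \<open>b\<close> nonzero entries. For
  \<open>b < 4\<close> they are all doubled integral vectors of norm \<open>b\<close>; from norm 4
  on an entry 4 would be possible.\<close>

fun even_lists :: "nat \<Rightarrow> nat \<Rightarrow> int list list" where
  "even_lists 0 b = (if b = 0 then [[]] else [])"
| "even_lists (Suc n) b = map ((#) 0) (even_lists n b) @
    (if b = 0 then [] else concat (map (\<lambda>xs. [2 # xs, -2 # xs]) (even_lists n (b - 1))))"

fun odd_lists :: "nat \<Rightarrow> int list list" where
  "odd_lists 0 = [[]]"
| "odd_lists (Suc n) = concat (map (\<lambda>xs. [1 # xs, -1 # xs]) (odd_lists n))"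

text \<open>The 112 integral and the 128 half-integral roots. In doubled coordinates the parity
  condition is divisibility of the sum by 4, which two entries 2 or -2 satisfy by
  themselves.\<close>

definition root_lists :: "int list list" where
  "root_lists = even_lists 8 2 @ filter (\<lambda>xs. sum_list xs mod 4 = 0) (odd_lists 8)"

lemma even_lists_complete:
  assumes "\<forall>x\<in>set xs. even x" "dotl xs xs = 4 * int b" "b < 4"
  shows "xs \<in> set (even_lists (length xs) b)"
  using assms
proof (induction xs arbitrary: b)
  case (Cons x xs)
  have nonneg: "0 \<le> dotl ys ys" for ys by (induction ys) auto
  obtain y where y: "x = 2 * y" using Cons.prems(1) by auto
  have "4 * (y * y) + dotl xs xs = 4 * int b" using Cons.prems(2) y by simp
  then have eq: "dotl xs xs = 4 * (int b - y * y)" by simp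
  then have yb: "y * y \<le> int b" using nonneg[of xs] by simp
  then have "\<bar>y\<bar> * \<bar>y\<bar> < 2 * 2" using Cons.prems(3) by simp
  then have "\<bar>y\<bar> < 2" by (metis abs_ge_zero mult_mono not_less zero_le_numeral)
  then consider "y = 0" | "y = 1" | "y = -1" by force
  then show ?case
  proof cases
    case 1
    then show ?thesis using Cons.IH[of b] Cons.prems eq y by simp
  next
    case 2
    then have "xs \<in> set (even_lists (length xs) (b - 1))" "b \<noteq> 0"
      using Cons.IH[of "b - 1"] Cons.prems eq yb by auto
    then show ?thesis using y 2 by auto
  next
    case 3
    then have "xs \<in> set (even_lists (length xs) (b - 1))" "b \<noteq> 0"
      using Cons.IH[of "b - 1"] Cons.prems eq yb by auto
    then show ?thesis using y 3 by auto
  qed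
qed simp

text \<open>Odd squares are at least 1, so a sum of squares not exceeding the length forces every
  square to be 1.\<close>

lemma odd_lists_complete:
  assumes "\<forall>x\<in>set xs. odd x" "dotl xs xs \<le> int (length xs)"
  shows "xs \<in> set (odd_lists (length xs))"
  using assms
proof (induction xs)
  case (Cons x xs)
  have lower: "int (length ys) \<le> dotl ys ys" if "\<forall>y\<in>set ys. odd y" for ys
    using that
  proof (induction ys)
    case (Cons y ys)
    then have "1 \<le> y * y" by (metis dvd_0_right list.set_intros(1) not_one_le_zero zless_imp_add1_zle
          add_0 linorder_not_less mult_eq_0_iff zero_less_mult_iff not_less_iff_gr_or_eq)
    then show ?case using Cons by simp
  qed simp
  have "x * x \<le> 1" using Cons.prems lower[of xs] by simp
  then have "\<bar>x\<bar> * \<bar>x\<bar> < 2 * 2" by simp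
  then have "\<bar>x\<bar> < 2" by (metis abs_ge_zero mult_mono not_less zero_le_numeral)
  moreover have "x \<noteq> 0" using Cons.prems by auto
  ultimately consider "x = 1" | "x = -1" by force
  then have "xs \<in> set (odd_lists (length xs))" using Cons by cases auto
  then show ?case using \<open>x \<noteq> 0\<close> \<open>\<bar>x\<bar> < 2\<close> by (auto intro!: bexI[of _ xs])
qed simp

lemma length_even_lists: "xs \<in> set (even_lists n b) \<Longrightarrow> length xs = n"
  by (induction n b arbitrary: xs rule: even_lists.induct) (auto split: if_splits)

lemma length_odd_lists: "xs \<in> set (odd_lists n) \<Longrightarrow> length xs = n"
  by (induction n arbitrary: xs) auto

lemma length_root_lists: "xs \<in> set root_lists \<Longrightarrow> length xs = 8"
  by (auto simp: root_lists_def dest: length_even_lists length_odd_lists)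

lemma even_lists_sound: "xs \<in> set (even_lists n b) \<Longrightarrow>
    (\<forall>x\<in>set xs. even x) \<and> dotl xs xs = 4 * int b \<and> (sum_list xs - 2 * int b) mod 4 = 0"
proof (induction n b arbitrary: xs rule: even_lists.induct)
  case (2 n b)
  from 2(3) consider ys where "xs = 0 # ys" "ys \<in> set (even_lists n b)" |
    ys where "b \<noteq> 0" "ys \<in> set (even_lists n (b - 1))" "xs = 2 # ys \<or> xs = -2 # ys"
    by (auto split: if_splits)
  then show ?case
  proof cases
    case 1
    then show ?thesis using 2(1)[of ys] by simp
  next
    case 2
    then have "int (b - 1) = int b - 1" by simp
    then show ?thesis using 2 "2.IH"(2)[of ys] by (auto; presburger)
  qed
qed (auto split: if_splits)

lemma odd_lists_sound: "xs \<in> set (odd_lists n) \<Longrightarrow> (\<forall>x\<in>set xs. odd x) \<and> dotl xs xs = int n"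
  by (induction n arbitrary: xs) auto

lemma half_vec_E8_iff:
  assumes "length xs = 8"
  shows "half_vec xs \<in> E8 \<longleftrightarrow> ((\<forall>x\<in>set xs. even x) \<or> (\<forall>x\<in>set xs. odd x)) \<and> sum_list xs mod 4 = 0"
proof -
  have Z: "(of_int k / 2 :: real) \<in> \<int> \<longleftrightarrow> even k" for k
    using of_int_div_of_int_in_Ints_iff[of k 2, where ?'a = real] by simp
  have Z1: "(of_int k / 2 - 1 / 2 :: real) \<in> \<int> \<longleftrightarrow> odd k" for k
    using Z[of "k - 1"] by (simp add: diff_divide_distrib)
  have "(\<Sum>i<8. half_vec xs $ i) / 2 = of_int (sum_list xs) / 4"
    using assms by (simp add: half_vec_def vec_of_list_index sum_list_sum_nth lessThan_atLeast0 flip: sum_divide_distrib)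
  then have S: "(\<Sum>i<8. half_vec xs $ i) / 2 \<in> \<int> \<longleftrightarrow> sum_list xs mod 4 = 0"
    using of_int_div_of_int_in_Ints_iff[of "sum_list xs" 4, where ?'a = real]
    by (metis mod_eq_0_iff_dvd of_int_numeral zero_neq_numeral)
  have "(\<forall>i<8. half_vec xs $ i - 0 \<in> \<int>) \<longleftrightarrow> (\<forall>x\<in>set xs. even x)"
    "(\<forall>i<8. half_vec xs $ i - 1/2 \<in> \<int>) \<longleftrightarrow> (\<forall>x\<in>set xs. odd x)"
    using assms by (simp_all add: half_vec_def vec_of_list_index Z Z1 all_set_conv_all_nth)
  then show ?thesis
    using half_vec_carrier[OF assms] unfolding E8_iff S by simp
qed

text \<open>This makes questions about products of roots decidable by evaluation on
  \<open>root_lists\<close>.\<close>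

lemma E8_roots_eq: "E8_roots = half_vec ` set root_lists"
proof (intro equalityI subsetI)
  fix u assume "u \<in> E8_roots"
  then have u: "u \<in> E8" "u \<bullet> u = 2" and c: "u \<in> carrier_vec 8" by (auto simp: E8_roots_def E8_carrier)
  obtain h where h: "h \<in> {0, 1/2}" "\<forall>i<8. u $ i - h \<in> \<int>" using u(1) unfolding E8_iff by blast
  have ex: "\<exists>k::int. u $ i = of_int k / 2" if "i < 8" for i
  proof -
    from h that obtain k :: int where "u $ i - h = of_int k" by (auto elim: Ints_cases)
    then have "u $ i = of_int (if h = 0 then 2 * k else 2 * k + 1) / 2" using h(1) by auto
    then show ?thesis by blast
  qed
  define xs where "xs = map (\<lambda>i. SOME k::int. u $ i = of_int k / 2) [0..<8]"
  have len: "length xs = 8" by (simp add: xs_def)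
  have ux: "u = half_vec xs"
  proof (intro eq_vecI)
    fix i assume "i < dim_vec (half_vec xs)"
    then have i: "i < 8" using half_vec_carrier[OF len] by auto
    then show "u $ i = half_vec xs $ i"
      using someI_ex[OF ex[OF i]] len by (simp add: half_vec_def vec_of_list_index) (simp add: xs_def)
  qed (use c half_vec_carrier[OF len] in auto)
  have "dotl xs xs = 8" using u(2) half_vec_scalar_prod[OF len len] ux by simp
  moreover have "((\<forall>x\<in>set xs. even x) \<or> (\<forall>x\<in>set xs. odd x)) \<and> sum_list xs mod 4 = 0"
    using u(1) half_vec_E8_iff[OF len] ux by simp
  ultimately have "xs \<in> set root_lists"
    using even_lists_complete[of xs 2] odd_lists_complete[of xs] len by (auto simp: root_lists_def)
  then show "u \<in> half_vec ` set root_lists" using ux by blast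
next
  fix u assume "u \<in> half_vec ` set root_lists"
  then obtain xs where xs: "xs \<in> set root_lists" "u = half_vec xs" by auto
  have len: "length xs = 8" using xs length_root_lists by blast
  have "dotl xs xs = 8 \<and> ((\<forall>x\<in>set xs. even x) \<or> (\<forall>x\<in>set xs. odd x)) \<and> sum_list xs mod 4 = 0"
  proof (cases "xs \<in> set (even_lists 8 2)")
    case True
    from even_lists_sound[OF this] have "(sum_list xs - 4) mod 4 = 0" by simp
    then have "sum_list xs mod 4 = 0" by presburger
    then show ?thesis using even_lists_sound[OF True] by simp
  next
    case False
    then have "xs \<in> set (odd_lists 8)" "sum_list xs mod 4 = 0" using xs by (auto simp: root_lists_def)
    then show ?thesis using odd_lists_sound[of xs 8] by simp
  qed
  then show "u \<in> E8_roots"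
    using half_vec_E8_iff[OF len] half_vec_scalar_prod[OF len len] xs by (simp add: E8_roots_def)
qed

section \<open>Transitivity of the Weyl group\<close>

lemma E8_root_diff:
  assumes "u \<in> E8_roots" "v \<in> E8_roots" "u \<bullet> v = 1"
  shows "u - v \<in> E8_roots"
proof -
  have "u \<in> carrier_vec 8" "v \<in> carrier_vec 8" "v \<bullet> u = 1"
    using assms E8_root_carrier comm_scalar_prod by metis+
  then show ?thesis using assms by (auto simp: E8_roots_def E8_diff ip8_simps)
qed

section \<open>Orbits under pointwise stabilizers\<close>

definition conj_fixing :: "real vec set \<Rightarrow> real vec \<Rightarrow> real vec \<Rightarrow> bool" where
  "conj_fixing T x y \<longleftrightarrow> (\<exists>w\<in>E8_Weyl. (\<forall>t\<in>T. w t = t) \<and> w x = y)"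

text \<open>The difference of two roots with product 1 is a root that has product 1 with
  \<open>x\<close> and -1 with \<open>y\<close>; vectors with equal products are orthogonal to
  it.\<close>

lemma reflection_swap:
  assumes "x \<in> E8_roots" "y \<in> E8_roots" "x \<bullet> y = 1"
  shows "root_reflection (x - y) x = y" "root_reflection (x - y) y = x"
    and "\<And>t. t \<in> carrier_vec 8 \<Longrightarrow> t \<bullet> x = t \<bullet> y \<Longrightarrow> root_reflection (x - y) t = t"
proof -
  have c: "x \<in> carrier_vec 8" "y \<in> carrier_vec 8" and xy: "y \<bullet> x = 1"
    using assms E8_root_carrier comm_scalar_prod by metis+
  note n = assms(1,2)[unfolded E8_roots_def, simplified, THEN conjunct2]
  show "root_reflection (x - y) x = y" "root_reflection (x - y) y = x"
    using c n xy assms(3) by (auto simp: root_reflection_apply ip8_simps intro!: eq_vecI)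
  show "root_reflection (x - y) t = t" if "t \<in> carrier_vec 8" "t \<bullet> x = t \<bullet> y" for t
    using c that by (auto simp: root_reflection_apply ip8_simps intro!: eq_vecI)
qed

lemma conj_fixing_adjacent:
  assumes "T \<subseteq> carrier_vec 8" "x \<in> E8_roots" "y \<in> E8_roots" "x \<bullet> y = 1" "\<forall>t\<in>T. t \<bullet> x = t \<bullet> y"
  shows "conj_fixing T x y"
  unfolding conj_fixing_def
  using assms reflection_swap[OF assms(2-4)]
  by (intro bexI[of _ "root_reflection (x - y)"] root_reflection_Weyl E8_root_diff) auto

lemma conj_fixing_refl: "T \<subseteq> carrier_vec 8 \<Longrightarrow> x \<in> carrier_vec 8 \<Longrightarrow> conj_fixing T x x"
  unfolding conj_fixing_def by (intro bexI[OF _ E8_Weyl_id]) auto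

lemma conj_fixing_trans:
  assumes T: "T \<subseteq> carrier_vec 8" "x \<in> carrier_vec 8" and xy: "conj_fixing T x y" and yz: "conj_fixing T y z"
  shows "conj_fixing T x z"
proof -
  from xy obtain w where w: "w \<in> E8_Weyl" "\<forall>t\<in>T. w t = t" "w x = y" unfolding conj_fixing_def by blast
  from yz obtain w' where w': "w' \<in> E8_Weyl" "\<forall>t\<in>T. w' t = t" "w' y = z" unfolding conj_fixing_def by blast
  have "\<forall>t\<in>T. compose (carrier_vec 8) w' w t = t"
    using T w(2) w'(2) by (auto simp: compose_def)
  moreover have "compose (carrier_vec 8) w' w x = z"
    using T w(3) w'(3) by (simp add: compose_def)
  ultimately show ?thesis
    using E8_Weyl_compose[OF w'(1) w(1)] unfolding conj_fixing_def by blast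
qed

text \<open>A certificate for the connectedness of \<open>L\<close> under the relation \<open>(x, y) = 1\<close>: each hub is
  adjacent to an earlier one, and each element of \<open>L\<close> to some hub.\<close>

fun hub_chain :: "int list list \<Rightarrow> int list list \<Rightarrow> int list list \<Rightarrow> bool" where
  "hub_chain L hs [] \<longleftrightarrow> list_all (\<lambda>x. list_ex (\<lambda>h. x = h \<or> dotl x h = 4) hs) L"
| "hub_chain L hs (g # gs) \<longleftrightarrow> g \<in> set L \<and> list_ex (\<lambda>h. dotl g h = 4) hs \<and> hub_chain L (g # hs) gs"

text \<open>The prescribed values refer to doubled coordinates: 4 stands for product 1.\<close>

definition roots_with_products :: "(int list \<times> int) list \<Rightarrow> int list list" where
  "roots_with_products ts = filter (\<lambda>x. list_all (\<lambda>(t, c). dotl x t = c) ts) root_lists"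

text \<open>All members of \<open>L\<close> have the same products with \<open>T\<close>, so each
  edge of the chain is realized by a reflection fixing \<open>T\<close>, and connectedness puts
  \<open>L\<close> into one orbit.\<close>

lemma hub_chain_conj:
  assumes L: "\<And>x. x \<in> set L \<Longrightarrow> x \<in> set root_lists"
    "\<And>x y t. x \<in> set L \<Longrightarrow> y \<in> set L \<Longrightarrow> t \<in> T \<Longrightarrow> t \<bullet> half_vec x = t \<bullet> half_vec y"
    and T: "T \<subseteq> carrier_vec 8"
    and hs: "set hs \<subseteq> set L" "\<forall>h\<in>set hs. conj_fixing T (half_vec h) p"
    and "hub_chain L hs gs" "x \<in> set L"
  shows "conj_fixing T (half_vec x) p"
  using hs assms(6,7)
proof (induction gs arbitrary: hs)
  have step: "conj_fixing T (half_vec x) p"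
    if "x \<in> set L" "h \<in> set L" "dotl x h = 4" "conj_fixing T (half_vec h) p" for x h
  proof -
    have "half_vec x \<in> E8_roots" "half_vec h \<in> E8_roots" using that L E8_roots_eq by auto
    moreover have "half_vec x \<bullet> half_vec h = 1"
      using that L length_root_lists by (simp add: half_vec_scalar_prod)
    ultimately have "conj_fixing T (half_vec x) (half_vec h)"
      using L(2)[OF that(1,2)] T by (intro conj_fixing_adjacent) auto
    with T show ?thesis
      using that E8_root_carrier \<open>half_vec x \<in> E8_roots\<close> by (metis conj_fixing_trans)
  qed
  {
    case Nil
    then obtain h where "h \<in> set hs" "x = h \<or> dotl x h = 4" by (auto simp: list_all_iff list_ex_iff)
    then show ?case using step[of x h] Nil by auto
  next
    case (Cons g gs)
    then obtain h where h: "h \<in> set hs" "dotl g h = 4" by (auto simp: list_ex_iff)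
    have "conj_fixing T (half_vec g) p" using step[of g h] h Cons.prems by auto
    then show ?case using Cons.prems Cons.IH[of "g # hs"] by auto
  }
qed

lemma roots_with_products_iff:
  assumes "x \<in> E8_roots" and ps: "\<forall>t\<in>set ps. length t = 8" and "length ps = length cs"
  shows "list_all2 (\<lambda>t c. x \<bullet> half_vec t = of_int c / 4) ps cs \<longleftrightarrow> x \<in> half_vec ` set (roots_with_products (zip ps cs))"
proof
  assume a: "list_all2 (\<lambda>t c. x \<bullet> half_vec t = of_int c / 4) ps cs"
  obtain y where y: "y \<in> set root_lists" "x = half_vec y" using assms(1) E8_roots_eq by auto
  have "y \<in> set (roots_with_products (zip ps cs))"
    using a y ps length_root_lists[OF y(1)]
    by (force simp: roots_with_products_def list_all_iff list_all2_iff half_vec_scalar_prod dest: set_zip_leftD)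
  then show "x \<in> half_vec ` set (roots_with_products (zip ps cs))" using y by blast
next
  assume "x \<in> half_vec ` set (roots_with_products (zip ps cs))"
  then obtain y where y: "y \<in> set root_lists" "x = half_vec y" "\<forall>(t, c)\<in>set (zip ps cs). dotl y t = c"
    by (auto simp: roots_with_products_def list_all_iff)
  then show "list_all2 (\<lambda>t c. x \<bullet> half_vec t = of_int c / 4) ps cs"
    using ps length_root_lists[OF y(1)] assms(3)
    by (force simp: list_all2_iff half_vec_scalar_prod dest: set_zip_leftD)
qed

text \<open>One step of a Witt type extension: once \<open>ts\<close> has reached the positions
  \<open>ps\<close>, the image of \<open>x\<close> is a root with the products \<open>cs\<close>,
  and the certificate connects all such roots to \<open>p\<close> while \<open>ps\<close> stays
  fixed.\<close>

lemma move_next: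
  assumes ok: "p \<in> set (roots_with_products (zip ps cs))" "hub_chain (roots_with_products (zip ps cs)) [p] hs"
    and w: "w \<in> E8_Weyl" "map w ts = map half_vec ps" and ts: "set ts \<subseteq> carrier_vec 8"
    and ps: "\<forall>t\<in>set ps. length t = 8"
    and x: "x \<in> E8_roots" "list_all2 (\<lambda>t c. x \<bullet> t = of_int c / 4) ts cs"
  shows "\<exists>w\<in>E8_Weyl. map w (ts @ [x]) = map half_vec (ps @ [p])"
proof -
  let ?L = "roots_with_products (zip ps cs)"
  have len: "length ts = length ps" "length ts = length cs"
    using map_eq_imp_length_eq[OF w(2)] list_all2_lengthD[OF x(2)] by auto
  have nth: "w (ts ! i) = half_vec (ps ! i)" if "i < length ps" for i
    using w(2) len that by (metis nth_map)
  have "list_all2 (\<lambda>t c. w x \<bullet> half_vec t = of_int c / 4) ps cs"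
    unfolding list_all2_conv_all_nth
  proof (intro conjI allI impI)
    fix i assume i: "i < length ps"
    have "ts ! i \<in> carrier_vec 8" using i ts len by (metis nth_mem subsetD)
    then have "w x \<bullet> half_vec (ps ! i) = x \<bullet> ts ! i"
      using E8_Weyl_scalar_prod[OF w(1) E8_root_carrier[OF x(1)]] nth[OF i] by metis
    then show "w x \<bullet> half_vec (ps ! i) = of_int (cs ! i) / 4"
      using x(2) i len by (auto simp: list_all2_conv_all_nth)
  qed (use len in simp)
  then have "w x \<in> half_vec ` set ?L"
    using roots_with_products_iff[of "w x" ps cs] E8_Weyl_roots[OF w(1) x(1)] ps len by auto
  then obtain y where y: "y \<in> set ?L" "w x = half_vec y" by blast
  have L: "z \<in> set root_lists" if "z \<in> set ?L" for z
    using that by (auto simp: roots_with_products_def)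
  have T: "half_vec ` set ps \<subseteq> carrier_vec 8" using ps half_vec_carrier by auto
  have prods: "t \<bullet> half_vec z = t \<bullet> half_vec z'" if z: "z \<in> set ?L" "z' \<in> set ?L" "t \<in> half_vec ` set ps" for t z z'
  proof -
    obtain i where i: "i < length ps" "t = half_vec (ps ! i)" using z(3) by (auto simp: in_set_conv_nth)
    then have "(ps ! i, cs ! i) \<in> set (zip ps cs)" using len by (auto simp: in_set_conv_nth intro!: exI[of _ i])
    then have "dotl z (ps ! i) = cs ! i" "dotl z' (ps ! i) = cs ! i"
      using z by (fastforce simp: roots_with_products_def list_all_iff)+
    moreover have "length (ps ! i) = 8" "length z = 8" "length z' = 8"
      using i ps L z length_root_lists by (auto simp: all_set_conv_all_nth)
    ultimately have "half_vec z \<bullet> t = half_vec z' \<bullet> t" using i by (simp add: half_vec_scalar_prod)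
    then show ?thesis
      using \<open>length z = 8\<close> \<open>length z' = 8\<close> T z(3) half_vec_carrier by (metis comm_scalar_prod subsetD)
  qed
  have "conj_fixing (half_vec ` set ps) (half_vec p) (half_vec p)"
    using T L[OF ok(1)] length_root_lists half_vec_carrier by (blast intro: conj_fixing_refl)
  then have "\<forall>h\<in>set [p]. conj_fixing (half_vec ` set ps) (half_vec h) (half_vec p)" "set [p] \<subseteq> set ?L"
    using ok(1) by simp_all
  then have "conj_fixing (half_vec ` set ps) (half_vec y) (half_vec p)"
    by (intro hub_chain_conj[OF L prods T _ _ ok(2) y(1)])
  then obtain v where v: "v \<in> E8_Weyl" "\<forall>t\<in>set ps. v (half_vec t) = half_vec t" "v (half_vec y) = half_vec p"
    unfolding conj_fixing_def by auto
  have "map (compose (carrier_vec 8) v w) ts = map v (map w ts)"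
    using ts by (auto simp: compose_def)
  also have "\<dots> = map half_vec ps" unfolding w(2) using v(2) by simp
  finally have "map (compose (carrier_vec 8) v w) (ts @ [x]) = map half_vec (ps @ [p])"
    using v(3) y(2) E8_root_carrier[OF x(1)] by (simp add: compose_def)
  then show ?thesis using E8_Weyl_compose[OF v(1) w(1)] by blast
qed

text \<open>Standard positions: \<open>r0l\<close> for \<open>r\<close>, and \<open>a1l, a2l, a3l\<close> for a triple. The roots \<open>a1l, b2l, \<dots>, b7l\<close> have
  pairwise products \<open>1\<close>; replacing \<open>b6l\<close> by \<open>c6l\<close> gives the six roots that do not extend to seven.\<close>

definition r0l :: "int list" where "r0l = [2,2,0,0,0,0,0,0]"
definition a1l :: "int list" where "a1l = [2,0,2,0,0,0,0,0]"
definition a2l :: "int list" where "a2l = [2,0,-2,0,0,0,0,0]"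
definition a3l :: "int list" where "a3l = [0,2,0,2,0,0,0,0]"
definition b2l :: "int list" where "b2l = [2,0,0,2,0,0,0,0]"
definition b3l :: "int list" where "b3l = [2,0,0,0,2,0,0,0]"
definition b4l :: "int list" where "b4l = [2,0,0,0,0,2,0,0]"
definition b5l :: "int list" where "b5l = [2,0,0,0,0,0,2,0]"
definition b6l :: "int list" where "b6l = [2,0,0,0,0,0,0,2]"
definition b7l :: "int list" where "b7l = [1,1,1,1,1,1,1,1]"
definition c6l :: "int list" where "c6l = [2,0,0,0,0,0,0,-2]"

lemmas list_defs = r0l_def a1l_def a2l_def a3l_def b2l_def b3l_def b4l_def b5l_def b6l_def b7l_def c6l_def

section \<open>Evaluated certificates for the standard positions\<close>

lemma hub_r0: "r0l \<in> set (roots_with_products (zip [] []))"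
  "hub_chain (roots_with_products (zip [] [])) [r0l] [[2, 0, 2, 0, 0, 0, 0, 0], [0, 2, -2, 0, 0, 0, 0, 0],
    [-2, 0, -2, 0, 0, 0, 0, 0], [-2, -2, 0, 0, 0, 0, 0, 0], [2, -2, 0, 0, 0, 0, 0, 0], [-2, 2, 0, 0, 0, 0, 0, 0],
    [1, 1, 1, 1, 1, 1, 1, 1], [1, 1, 1, 1, -1, -1, -1, -1], [2, 0, 0, -2, 0, 0, 0, 0], [0, 0, 0, 0, 2, 2, 0, 0],
    [0, 0, 0, 0, -2, -2, 0, 0], [0, 0, 0, 0, 2, 0, 2, 0], [0, 0, 0, 0, -2, 0, -2, 0]]"
  unfolding list_defs by code_simp+

lemma hub_a1: "a1l \<in> set (roots_with_products (zip [r0l] [4]))"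
  "hub_chain (roots_with_products (zip [r0l] [4])) [a1l] [b2l, a2l, [0, 2, 2, 0, 0, 0, 0, 0]]"
  unfolding list_defs by code_simp+

lemma hub_a2: "a2l \<in> set (roots_with_products (zip [r0l, a1l] [4, 0]))"
  "hub_chain (roots_with_products (zip [r0l, a1l] [4, 0])) [a2l]
    [[1, 1, -1, 1, 1, 1, 1, -1], [0, 2, 0, 2, 0, 0, 0, 0], [0, 2, 0, 0, 2, 0, 0, 0]]"
  unfolding list_defs by code_simp+

lemma hub_a3: "a3l \<in> set (roots_with_products (zip [r0l, a1l, a2l] [4, 0, 0]))"
  "hub_chain (roots_with_products (zip [r0l, a1l, a2l] [4, 0, 0])) [a3l] [[0, 2, 0, 0, 2, 0, 0, 0]]"
  unfolding list_defs by code_simp+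

lemma hub_b2: "b2l \<in> set (roots_with_products (zip [r0l, a1l] [4, 4]))"
  "hub_chain (roots_with_products (zip [r0l, a1l] [4, 4])) [b2l] [b3l, [2, 0, 0, -2, 0, 0, 0, 0], b7l]"
  unfolding list_defs by code_simp+

lemma hub_b3: "b3l \<in> set (roots_with_products (zip [r0l, a1l, b2l] [4, 4, 4]))"
  "hub_chain (roots_with_products (zip [r0l, a1l, b2l] [4, 4, 4])) [b3l] [b4l, [2, 0, 0, 0, -2, 0, 0, 0]]"
  unfolding list_defs by code_simp+

lemma hub_b4: "b4l \<in> set (roots_with_products (zip [r0l, a1l, b2l, b3l] [4, 4, 4, 4]))"
  "hub_chain (roots_with_products (zip [r0l, a1l, b2l, b3l] [4, 4, 4, 4])) [b4l] [b5l, [2, 0, 0, 0, 0, -2, 0, 0]]"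
  unfolding list_defs by code_simp+

lemma hub_b5: "b5l \<in> set (roots_with_products (zip [r0l, a1l, b2l, b3l, b4l] [4, 4, 4, 4, 4]))"
  "hub_chain (roots_with_products (zip [r0l, a1l, b2l, b3l, b4l] [4, 4, 4, 4, 4])) [b5l] [c6l]"
  unfolding list_defs by code_simp+

text \<open>The origin of the exceptional case: \<open>c6l\<close> is orthogonal to
  \<open>b6l\<close> and \<open>b7l\<close>, which have product 1 with each other, so the relation
  "product 1" has two components on these three roots.\<close>

lemma products_b6: "set (roots_with_products (zip [r0l, a1l, b2l, b3l, b4l, b5l] [4, 4, 4, 4, 4, 4])) = {b6l, c6l, b7l}"
proof -
  have "roots_with_products (zip [r0l, a1l, b2l, b3l, b4l, b5l] [4, 4, 4, 4, 4, 4]) = [b6l, c6l, b7l]"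
    unfolding list_defs by code_simp
  then show ?thesis by simp
qed

lemma products_c6: "roots_with_products (zip [r0l, a1l, b2l, b3l, b4l, b5l, c6l] [4, 4, 4, 4, 4, 4, 4]) = []"
  unfolding list_defs by code_simp

definition has_neighbours :: "int list list \<Rightarrow> bool" where
  "has_neighbours L \<longleftrightarrow> list_all (\<lambda>y. list_ex (\<lambda>z. dotl z y = 4) L) L"

text \<open>One line for each pillar. The difference of an orthogonal pair is not a root, so moving
  one member to the other needs a stopover; a neighbour in the same pillar provides it.\<close>

lemma pillar_neighbours:
  "has_neighbours (roots_with_products (zip [r0l, a1l, a2l, a3l] [4, 4, 4, 0]))"
  "has_neighbours (roots_with_products (zip [r0l, a1l, a2l, a3l] [4, 4, 0, 4]))"
  "has_neighbours (roots_with_products (zip [r0l, a1l, a2l, a3l] [4, 4, 0, 0]))"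
  unfolding list_defs by code_simp+

section \<open>Neighbours of a root and transport of triples\<close>

lemma root_nbrsD:
  assumes "u \<in> root_nbrs r"
  shows "u \<in> E8_roots" "u \<bullet> r = 1" "u \<bullet> u = 2" "u \<in> carrier_vec 8" "u \<in> E8"
  using assms by (auto simp: root_nbrs_def E8_roots_def E8_carrier)

lemmas ip8_add_simps = add_scalar_prod_distrib[where n = 8] scalar_prod_add_distrib[where n = 8]

context
  fixes r :: "real vec"
  assumes r: "r \<in> E8_roots"
begin

lemma r_facts: "r \<in> carrier_vec 8" "r \<bullet> r = 2" "r \<in> E8"
  using r by (auto simp: E8_roots_def E8_carrier)

lemma root_nbrs_sym: "u \<in> root_nbrs r \<Longrightarrow> r \<bullet> u = 1"
  using root_nbrsD r_facts comm_scalar_prod by metis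

lemma root_nbrs_compl:
  assumes "u \<in> root_nbrs r" shows "r - u \<in> root_nbrs r"
  using root_nbrsD[OF assms] root_nbrs_sym[OF assms] r_facts
  by (auto simp: root_nbrs_def E8_roots_def E8_diff ip8_simps)

lemma root_nbrs_compl_compl:
  assumes "u \<in> root_nbrs r" shows "r - (r - u) = u"
  using root_nbrsD[OF assms] r_facts by (auto intro!: eq_vecI)

text \<open>The counterpart of \<open>nbr_cases\<close> inside \<open>E8\<close>, where definiteness
  turns null differences into equalities.\<close>

lemma root_nbrs_cases:
  assumes u: "u \<in> root_nbrs r" and v: "v \<in> root_nbrs r"
  shows "u \<bullet> v = 0 \<or> u \<bullet> v = 1 \<or> u = v \<or> u = r - v"
proof -
  note c = root_nbrsD(4)[OF u] root_nbrsD(4)[OF v] r_facts(1)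
  note ip = root_nbrsD(2,3)[OF u] root_nbrsD(2,3)[OF v] root_nbrs_sym[OF u] root_nbrs_sym[OF v]
    r_facts(2) comm_scalar_prod[OF c(2) c(1)]
  obtain k :: int where k: "u \<bullet> v = of_int k"
    using E8_scalar_prod_Ints[OF root_nbrsD(5)[OF u] root_nbrsD(5)[OF v]] by (auto elim: Ints_cases)
  have n1: "(u - v) \<bullet> (u - v) = 4 - 2 * of_int k"
    using c ip k by (simp add: ip8_simps)
  have n2: "(u - (r - v)) \<bullet> (u - (r - v)) = 2 + 2 * of_int k"
    using c ip k by (simp add: ip8_simps)
  have "0 \<le> (u - v) \<bullet> (u - v)" "0 \<le> (u - (r - v)) \<bullet> (u - (r - v))"
    using c by (auto intro!: scalar_prod_self_nonneg8)
  then have "k \<le> 2" "-1 \<le> k" unfolding n1 n2 by linarith+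
  then consider "k = 2" | "k = -1" | "k = 0" | "k = 1" by force
  then show ?thesis
  proof cases
    case 1
    then have "u = v" using c n1 by (intro vec8_eqI) auto
    then show ?thesis by simp
  next
    case 2
    then have "u = r - v" using c n2 by (intro vec8_eqI) auto
    then show ?thesis by simp
  qed (use k in auto)
qed

lemma move_triple:
  assumes u: "u1 \<in> root_nbrs r" "u2 \<in> root_nbrs r" "u3 \<in> root_nbrs r"
    and orth: "u1 \<bullet> u2 = 0" "u1 \<bullet> u3 = 0" "u2 \<bullet> u3 = 0"
  shows "\<exists>w\<in>E8_Weyl. w r = half_vec r0l \<and> w u1 = half_vec a1l \<and> w u2 = half_vec a2l \<and> w u3 = half_vec a3l"
proof -
  note c = u[THEN root_nbrsD(4)] r_facts(1)
  have sym: "u2 \<bullet> u1 = 0" "u3 \<bullet> u1 = 0" "u3 \<bullet> u2 = 0"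
    using orth c comm_scalar_prod by metis+
  have l: "length r0l = 8" "length a1l = 8" "length a2l = 8" by (simp_all add: list_defs)
  obtain w0 where w0: "w0 \<in> E8_Weyl" "map w0 ([] @ [r]) = map half_vec ([] @ [r0l])"
    using move_next[OF hub_r0 E8_Weyl_id, of "[]" r] r by auto
  obtain w1 where w1: "w1 \<in> E8_Weyl" "map w1 ([r] @ [u1]) = map half_vec ([r0l] @ [a1l])"
    using move_next[OF hub_a1 w0(1), of "[r]" u1] w0(2) l c u[THEN root_nbrsD(1)] u[THEN root_nbrsD(2)] by auto
  obtain w2 where w2: "w2 \<in> E8_Weyl" "map w2 ([r, u1] @ [u2]) = map half_vec ([r0l, a1l] @ [a2l])"
    using move_next[OF hub_a2 w1(1), of "[r, u1]" u2] w1(2) l c u[THEN root_nbrsD(1)] u[THEN root_nbrsD(2)] sym by auto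
  obtain w3 where w3: "w3 \<in> E8_Weyl" "map w3 ([r, u1, u2] @ [u3]) = map half_vec ([r0l, a1l, a2l] @ [a3l])"
    using move_next[OF hub_a3 w2(1), of "[r, u1, u2]" u3] w2(2) l c u[THEN root_nbrsD(1)] u[THEN root_nbrsD(2)] sym by auto
  then show ?thesis by auto
qed

text \<open>The triple is moved to its standard position, where evaluation finds the neighbour,
  which is then moved back.\<close>

lemma pillar_neighbour:
  assumes a: "a1 \<in> root_nbrs r" "a2 \<in> root_nbrs r" "a3 \<in> root_nbrs r"
    and orth: "a1 \<bullet> a2 = 0" "a1 \<bullet> a3 = 0" "a2 \<bullet> a3 = 0"
    and y: "y \<in> root_nbrs r" and y1: "y \<bullet> a1 = 1"
    and pattern: "y \<bullet> a2 = 1 \<and> y \<bullet> a3 = 0 \<or> y \<bullet> a2 = 0 \<and> y \<bullet> a3 = 1 \<or> y \<bullet> a2 = 0 \<and> y \<bullet> a3 = 0"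
  shows "\<exists>z\<in>root_nbrs r. z \<bullet> y = 1 \<and> z \<bullet> a1 = 1 \<and> z \<bullet> a2 = y \<bullet> a2 \<and> z \<bullet> a3 = y \<bullet> a3"
proof -
  note c = a[THEN root_nbrsD(4)] root_nbrsD(4)[OF y] r_facts(1)
  obtain w where w: "w \<in> E8_Weyl" and wr: "w r = half_vec r0l" "w a1 = half_vec a1l" "w a2 = half_vec a2l" "w a3 = half_vec a3l"
    using move_triple[OF a orth] by blast
  obtain w' where w': "w' \<in> E8_Weyl" "\<And>x. x \<in> carrier_vec 8 \<Longrightarrow> w' (w x) = x" "\<And>x. x \<in> carrier_vec 8 \<Longrightarrow> w (w' x) = x"
    using E8_Weyl_inverse[OF w] by blast
  obtain c2 c3 where c23: "(c2, c3) \<in> {(4, 0), (0, 4), (0, 0)}" "y \<bullet> a2 = of_int c2 / 4" "y \<bullet> a3 = of_int c3 / 4"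
  proof -
    have "y \<bullet> a2 = of_int 4 / 4 \<and> y \<bullet> a3 = of_int 0 / 4 \<or> y \<bullet> a2 = of_int 0 / 4 \<and> y \<bullet> a3 = of_int 4 / 4
       \<or> y \<bullet> a2 = of_int 0 / 4 \<and> y \<bullet> a3 = of_int 0 / 4" using pattern by simp
    then show ?thesis using that by blast
  qed
  let ?ps = "[r0l, a1l, a2l, a3l]" and ?cs = "[4, 4, c2, c3]"
  let ?L = "roots_with_products (zip ?ps ?cs)"
  have ps: "\<forall>t\<in>set ?ps. length t = 8" by (simp add: list_defs)
  have eq: "w x \<bullet> half_vec r0l = x \<bullet> r" "w x \<bullet> half_vec a1l = x \<bullet> a1" "w x \<bullet> half_vec a2l = x \<bullet> a2"
    "w x \<bullet> half_vec a3l = x \<bullet> a3" if "x \<in> carrier_vec 8" for x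
    unfolding wr[symmetric] using E8_Weyl_scalar_prod[OF w] that c by blast+
  have "w y \<in> half_vec ` set ?L"
    using roots_with_products_iff[of "w y" ?ps ?cs] ps E8_Weyl_roots[OF w root_nbrsD(1)[OF y]]
      eq[OF c(4)] y1 c23(2,3) root_nbrsD(2)[OF y] by auto
  then obtain yl where yl: "yl \<in> set ?L" "w y = half_vec yl" by blast
  have "has_neighbours ?L" using c23(1) pillar_neighbours by auto
  then obtain zl where zl: "zl \<in> set ?L" "dotl zl yl = 4"
    using yl(1) by (auto simp: has_neighbours_def list_all_iff list_ex_iff)
  have roots: "zl \<in> set root_lists" "yl \<in> set root_lists"
    using zl yl by (auto simp: roots_with_products_def)
  define z where "z = w' (half_vec zl)"
  have hz: "half_vec zl \<in> E8_roots" using roots E8_roots_eq by auto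
  then have z: "z \<in> E8_roots" "z \<in> carrier_vec 8" "w z = half_vec zl"
    using E8_Weyl_roots[OF w'(1)] w'(3) E8_root_carrier unfolding z_def by auto
  have "list_all2 (\<lambda>t c. half_vec zl \<bullet> half_vec t = of_int c / 4) ?ps ?cs"
    using roots_with_products_iff[of "half_vec zl" ?ps ?cs] ps hz zl(1) by simp
  then have "z \<bullet> r = 1" "z \<bullet> a1 = 1" "z \<bullet> a2 = y \<bullet> a2" "z \<bullet> a3 = y \<bullet> a3"
    using eq[OF z(2)] z(3) c23 by simp_all
  moreover have "z \<bullet> y = 1"
    using E8_Weyl_scalar_prod[OF w z(2) c(4)] z(3) yl(2) zl(2) roots length_root_lists
    by (simp add: half_vec_scalar_prod)
  ultimately show ?thesis using z(1) by (auto simp: root_nbrs_def)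
qed

end

section \<open>Subsets containing an orthogonal triple\<close>

lemma compose_step:
  assumes w: "w \<in> E8_Weyl" and s: "s \<in> E8_Weyl"
    and u: "\<forall>j\<in>J. u j \<in> carrier_vec 8 \<and> w (u j) = v j \<and> s (v j) = v j"
    and i: "u i \<in> carrier_vec 8" "s (w (u i)) = v i"
  shows "\<exists>c\<in>E8_Weyl. (\<forall>x\<in>carrier_vec 8. c x = s (w x)) \<and> (\<forall>j\<in>insert i J. c (u j) = v j)"
  using u i by (intro bexI[OF _ E8_Weyl_compose[OF s w]]) (auto simp: compose_def)

text \<open>The products (1, 0), (0, 1), (0, 0) with \<open>a2\<close>, \<open>a3\<close> name the
  three pillars; (1, 1) marks the complement of the fourth root of the triple.\<close>

definition pillar_bits :: "real vec \<Rightarrow> real vec \<Rightarrow> real vec \<Rightarrow> real vec \<Rightarrow> bool" where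
  "pillar_bits a1 a2 a3 x \<longleftrightarrow> x \<bullet> a1 = 1 \<and> x \<bullet> a2 \<in> {0, 1} \<and> x \<bullet> a3 \<in> {0, 1}"

definition agree :: "real vec \<Rightarrow> real vec \<Rightarrow> real vec \<Rightarrow> real vec \<Rightarrow> ('i \<Rightarrow> real vec) \<Rightarrow> ('i \<Rightarrow> real vec) \<Rightarrow> 'i set \<Rightarrow> bool" where
  "agree r a1 a2 a3 u v J \<longleftrightarrow>
    (\<exists>w\<in>E8_Weyl. w r = r \<and> w a1 = a1 \<and> w a2 = a2 \<and> w a3 = a3 \<and> (\<forall>j\<in>J. w (u j) = v j))"

context
  fixes r a1 a2 a3 :: "real vec"
  assumes r: "r \<in> E8_roots"
    and a: "a1 \<in> root_nbrs r" "a2 \<in> root_nbrs r" "a3 \<in> root_nbrs r"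
    and orth: "a1 \<bullet> a2 = 0" "a1 \<bullet> a3 = 0" "a2 \<bullet> a3 = 0"
begin

lemma carriers: "a1 \<in> carrier_vec 8" "a2 \<in> carrier_vec 8" "a3 \<in> carrier_vec 8" "r \<in> carrier_vec 8"
  using a[THEN root_nbrsD(4)] r_facts[OF r] by auto

lemma orth_sym: "a2 \<bullet> a1 = 0" "a3 \<bullet> a1 = 0" "a3 \<bullet> a2 = 0"
  using orth carriers comm_scalar_prod by metis+

lemmas triple_products = orth orth_sym a[THEN root_nbrsD(2)] a[THEN root_nbrsD(3)]
  a[THEN root_nbrs_sym[OF r]] r_facts(2)[OF r]

lemma products_of_nbr:
  assumes "x \<in> root_nbrs r"
  shows "x \<in> carrier_vec 8" "x \<bullet> r = 1" "x \<bullet> x = 2" "r \<bullet> x = 1" "a1 \<bullet> x = x \<bullet> a1" "a2 \<bullet> x = x \<bullet> a2" "a3 \<bullet> x = x \<bullet> a3"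
  using root_nbrsD[OF assms] root_nbrs_sym[OF r assms] carriers comm_scalar_prod by metis+

text \<open>In the notation of the overview the right side is \<open>r - u4\<close>, so this is the
  class of the fourth root.\<close>

lemma nbr_fourth:
  assumes x: "x \<in> root_nbrs r" "x \<bullet> a1 = 1" "x \<bullet> a2 = 1" "x \<bullet> a3 = 1"
  shows "x = a1 + a2 + a3 - r"
proof (rule vec8_eqI)
  note p = products_of_nbr[OF x(1)]
  show "(x - (a1 + a2 + a3 - r)) \<bullet> (x - (a1 + a2 + a3 - r)) = 0"
    using p carriers by (simp add: ip8_simps ip8_add_simps triple_products x)
qed (use products_of_nbr[OF x(1)] carriers in auto)

lemma nbr_fourth_compl:
  assumes x: "x \<in> root_nbrs r" "x \<bullet> a1 = 0" "x \<bullet> a2 = 0" "x \<bullet> a3 = 0"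
  shows "x = r - (a1 + a2 + a3 - r)"
proof -
  have "r - x = a1 + a2 + a3 - r"
    using x carriers root_nbrs_compl[OF r x(1)] products_of_nbr[OF x(1)]
    by (intro nbr_fourth) (auto simp: ip8_simps triple_products)
  then show ?thesis using root_nbrs_compl_compl[OF r x(1)] by simp
qed

lemma nbr_determined:
  assumes "x \<in> root_nbrs r" "y \<in> root_nbrs r"
    and "x \<bullet> a1 = y \<bullet> a1" "x \<bullet> a2 = y \<bullet> a2" "x \<bullet> a3 = y \<bullet> a3"
    and "x \<bullet> a1 = c" "x \<bullet> a2 = c" "x \<bullet> a3 = c" "c \<in> {0, 1}"
  shows "x = y"
  using nbr_fourth[of x] nbr_fourth[of y] nbr_fourth_compl[of x] nbr_fourth_compl[of y] assms by auto

lemma antipodal_sum2: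
  assumes x: "x \<in> root_nbrs r" "x \<bullet> a1 = 1" "x \<bullet> a2 = 1" "x \<bullet> a3 = 0"
    and y: "y \<in> root_nbrs r" "y \<bullet> a1 = 1" "y \<bullet> a2 = 1" "y \<bullet> a3 = 0" and xy: "x \<bullet> y = 0"
  shows "x + y = a1 + a2"
proof (rule vec8_eqI)
  note p = products_of_nbr[OF x(1)] products_of_nbr[OF y(1)]
  have "y \<bullet> x = 0" using xy comm_scalar_prod p by metis
  then show "(x + y - (a1 + a2)) \<bullet> (x + y - (a1 + a2)) = 0"
    using p carriers by (simp add: ip8_simps ip8_add_simps triple_products x y xy)
qed (use products_of_nbr[OF x(1)] products_of_nbr[OF y(1)] carriers in auto)

lemma antipodal_sum3:
  assumes x: "x \<in> root_nbrs r" "x \<bullet> a1 = 1" "x \<bullet> a2 = 0" "x \<bullet> a3 = 1"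
    and y: "y \<in> root_nbrs r" "y \<bullet> a1 = 1" "y \<bullet> a2 = 0" "y \<bullet> a3 = 1" and xy: "x \<bullet> y = 0"
  shows "x + y = a1 + a3"
proof (rule vec8_eqI)
  note p = products_of_nbr[OF x(1)] products_of_nbr[OF y(1)]
  have "y \<bullet> x = 0" using xy comm_scalar_prod p by metis
  then show "(x + y - (a1 + a3)) \<bullet> (x + y - (a1 + a3)) = 0"
    using p carriers by (simp add: ip8_simps ip8_add_simps triple_products x y xy)
qed (use products_of_nbr[OF x(1)] products_of_nbr[OF y(1)] carriers in auto)

text \<open>The sum is \<open>a1\<close> plus the fourth root \<open>r + r - a1 - a2 - a3\<close>,
  in analogy with the other two pillars.\<close>

lemma antipodal_sum4:
  assumes x: "x \<in> root_nbrs r" "x \<bullet> a1 = 1" "x \<bullet> a2 = 0" "x \<bullet> a3 = 0"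
    and y: "y \<in> root_nbrs r" "y \<bullet> a1 = 1" "y \<bullet> a2 = 0" "y \<bullet> a3 = 0" and xy: "x \<bullet> y = 0"
  shows "x + y = r + r - a2 - a3"
proof (rule vec8_eqI)
  note p = products_of_nbr[OF x(1)] products_of_nbr[OF y(1)]
  have "y \<bullet> x = 0" using xy comm_scalar_prod p by metis
  then show "(x + y - (r + r - a2 - a3)) \<bullet> (x + y - (r + r - a2 - a3)) = 0"
    using p carriers by (simp add: ip8_simps ip8_add_simps triple_products x y xy)
qed (use products_of_nbr[OF x(1)] products_of_nbr[OF y(1)] carriers in auto)

text \<open>\<open>x + y\<close> is \<open>a1\<close> plus the root naming the pillar, which
  contributes 1 for \<open>a1\<close> and 1 more exactly if \<open>t\<close> lies in the same
  pillar. The odd value is the useful one: it rules out equal products of \<open>t\<close> with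
  \<open>x\<close> and \<open>y\<close>.\<close>

lemma antipodal_product:
  assumes x: "x \<in> root_nbrs r" "pillar_bits a1 a2 a3 x" and y: "y \<in> root_nbrs r"
    and eq: "x \<bullet> a1 = y \<bullet> a1" "x \<bullet> a2 = y \<bullet> a2" "x \<bullet> a3 = y \<bullet> a3" and xy: "x \<bullet> y = 0"
    and t: "t \<in> root_nbrs r" "pillar_bits a1 a2 a3 t" "t \<bullet> a2 \<noteq> 1 \<or> t \<bullet> a3 \<noteq> 1"
  shows "t \<bullet> x + t \<bullet> y = (if t \<bullet> a2 = x \<bullet> a2 \<and> t \<bullet> a3 = x \<bullet> a3 then 2 else 1)"
proof -
  note c = products_of_nbr(1)[OF x(1)] products_of_nbr(1)[OF y(1)] carriers products_of_nbr(1)[OF t(1)]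
  have split: "t \<bullet> x + t \<bullet> y = t \<bullet> (x + y)" using c by (simp add: ip8_add_simps)
  have "\<not> (x \<bullet> a2 = 1 \<and> x \<bullet> a3 = 1)"
    using nbr_determined[of x y 1] x y eq xy root_nbrsD(3)[OF y] by (auto simp: pillar_bits_def)
  then consider "x \<bullet> a2 = 1" "x \<bullet> a3 = 0" | "x \<bullet> a2 = 0" "x \<bullet> a3 = 1" | "x \<bullet> a2 = 0" "x \<bullet> a3 = 0"
    using x(2) by (auto simp: pillar_bits_def)
  then show ?thesis
  proof cases
    case 1
    then have "x + y = a1 + a2" using x y eq xy by (intro antipodal_sum2) (auto simp: pillar_bits_def)
    then show ?thesis unfolding split using c 1 t by (auto simp: ip8_add_simps pillar_bits_def)
  next
    case 2
    then have "x + y = a1 + a3" using x y eq xy by (intro antipodal_sum3) (auto simp: pillar_bits_def)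
    then show ?thesis unfolding split using c 2 t by (auto simp: ip8_add_simps pillar_bits_def)
  next
    case 3
    then have "x + y = r + r - a2 - a3" using x y eq xy by (intro antipodal_sum4) (auto simp: pillar_bits_def)
    then show ?thesis unfolding split using c 3 t root_nbrsD(2)[OF t(1)]
      by (auto simp: ip8_add_simps ip8_simps pillar_bits_def)
  qed
qed

section \<open>Extending an isometric correspondence root by root\<close>

context
  fixes R :: "'i set" and u v :: "'i \<Rightarrow> real vec"
  assumes fin: "finite R"
    and uv: "\<And>i. i \<in> R \<Longrightarrow> u i \<in> root_nbrs r" "\<And>i. i \<in> R \<Longrightarrow> v i \<in> root_nbrs r"
    and gram: "\<And>i j. i \<in> R \<Longrightarrow> j \<in> R \<Longrightarrow> u i \<bullet> u j = v i \<bullet> v j"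
    and grama: "\<And>i. i \<in> R \<Longrightarrow> u i \<bullet> a1 = v i \<bullet> a1" "\<And>i. i \<in> R \<Longrightarrow> u i \<bullet> a2 = v i \<bullet> a2"
      "\<And>i. i \<in> R \<Longrightarrow> u i \<bullet> a3 = v i \<bullet> a3"
begin

text \<open>A product 1 of the transported \<open>u i\<close> with \<open>v i\<close> is settled by
  one reflection, and -1 is excluded because both have product 1 with \<open>a1\<close>. Only
  orthogonality is left to the hypothesis \<open>path\<close>.\<close>

lemma agree_insert:
  assumes J: "J \<subseteq> R" "agree r a1 a2 a3 u v J" and i: "i \<in> R" and bi: "pillar_bits a1 a2 a3 (u i)"
    and path: "\<And>y. \<lbrakk>y \<in> root_nbrs r; y \<bullet> a1 = v i \<bullet> a1; y \<bullet> a2 = v i \<bullet> a2; y \<bullet> a3 = v i \<bullet> a3;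
      \<forall>j\<in>J. v j \<bullet> y = v j \<bullet> v i; y \<bullet> v i = 0\<rbrakk> \<Longrightarrow> conj_fixing ({r, a1, a2, a3} \<union> v ` J) y (v i)"
  shows "agree r a1 a2 a3 u v (insert i J)"
proof -
  from J obtain w where w: "w \<in> E8_Weyl" and fw: "w r = r" "w a1 = a1" "w a2 = a2" "w a3 = a3"
    and wJ: "\<forall>j\<in>J. w (u j) = v j" unfolding agree_def by blast
  let ?y = "w (u i)" and ?T = "{r, a1, a2, a3} \<union> v ` J"
  note cui = root_nbrsD(4)[OF uv(1)[OF i]] and cvi = root_nbrsD(4)[OF uv(2)[OF i]]
  have prod: "?y \<bullet> w x = u i \<bullet> x" if "x \<in> carrier_vec 8" for x
    using E8_Weyl_scalar_prod[OF w cui that] .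
  have y: "?y \<in> root_nbrs r"
    using E8_Weyl_roots[OF w root_nbrsD(1)[OF uv(1)[OF i]]] prod[OF carriers(4)] fw(1) root_nbrsD(2)[OF uv(1)[OF i]]
    by (simp add: root_nbrs_def)
  have ya: "?y \<bullet> a1 = v i \<bullet> a1" "?y \<bullet> a2 = v i \<bullet> a2" "?y \<bullet> a3 = v i \<bullet> a3"
    using prod[OF carriers(1)] prod[OF carriers(2)] prod[OF carriers(3)] fw grama[OF i] by auto
  have yJ: "\<forall>j\<in>J. v j \<bullet> ?y = v j \<bullet> v i"
  proof
    fix j assume j: "j \<in> J"
    then have jR: "j \<in> R" using J by auto
    have "?y \<bullet> v j = v i \<bullet> v j" using prod[OF root_nbrsD(4)[OF uv(1)[OF jR]]] wJ j gram[OF i jR] by auto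
    then show "v j \<bullet> ?y = v j \<bullet> v i"
      using cvi root_nbrsD(4)[OF y] root_nbrsD(4)[OF uv(2)[OF jR]] comm_scalar_prod by metis
  qed
  have T: "?T \<subseteq> carrier_vec 8" using carriers J root_nbrsD(4)[OF uv(2)] by auto
  have Teq: "\<forall>t\<in>?T. t \<bullet> ?y = t \<bullet> v i"
    using yJ ya products_of_nbr[OF y] products_of_nbr[OF uv(2)[OF i]] by auto
  have "conj_fixing ?T ?y (v i)"
  proof -
    have "?y \<noteq> r - v i" using ya(1) bi grama[OF i] carriers cvi
      by (auto simp: pillar_bits_def ip8_simps triple_products)
    then consider "?y \<bullet> v i = 0" | "?y \<bullet> v i = 1" | "?y = v i"
      using root_nbrs_cases[OF r y uv(2)[OF i]] by blast
    then show ?thesis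
    proof cases
      case 1
      then show ?thesis using path[OF y ya yJ] by blast
    next
      case 2
      then show ?thesis using conj_fixing_adjacent[OF T _ _ _ Teq] root_nbrsD(1)[OF y] root_nbrsD(1)[OF uv(2)[OF i]] by blast
    next
      case 3
      then show ?thesis using conj_fixing_refl[OF T cvi] by simp
    qed
  qed
  then obtain s where s: "s \<in> E8_Weyl" "\<forall>t\<in>?T. s t = t" "s ?y = v i" unfolding conj_fixing_def by blast
  have "\<exists>c\<in>E8_Weyl. (\<forall>x\<in>carrier_vec 8. c x = s (w x)) \<and> (\<forall>j\<in>insert i J. c (u j) = v j)"
    using wJ s J root_nbrsD(4)[OF uv(1)] i by (intro compose_step[OF w s(1)]) auto
  then show ?thesis using carriers s(2) fw unfolding agree_def by (metis UnI1 insertI1 insertI2)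
qed

lemma agree_two_pillars:
  assumes bits: "\<And>i. i \<in> R \<Longrightarrow> pillar_bits a1 a2 a3 (u i)"
    and k: "k \<in> R" "\<not> (u k \<bullet> a2 = 1 \<and> u k \<bullet> a3 = 1)" and l: "l \<in> R" "\<not> (u l \<bullet> a2 = 1 \<and> u l \<bullet> a3 = 1)"
    and kl: "u k \<bullet> a2 \<noteq> u l \<bullet> a2 \<or> u k \<bullet> a3 \<noteq> u l \<bullet> a3"
  shows "agree r a1 a2 a3 u v R"
proof -
  have bv: "pillar_bits a1 a2 a3 (v i)" if "i \<in> R" for i using bits[OF that] grama[OF that] by (simp add: pillar_bits_def)
  \<comment> \<open>A root \<open>v m\<close> outside the pillar of \<open>i\<close> would have
    equal products with \<open>y\<close> and \<open>v i\<close> whose sum is 1, impossible for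
    integers.\<close>
  have no_antipode: False
    if i: "i \<in> R" and m: "m \<in> R" "\<not> (u m \<bullet> a2 = 1 \<and> u m \<bullet> a3 = 1)" "u m \<bullet> a2 \<noteq> u i \<bullet> a2 \<or> u m \<bullet> a3 \<noteq> u i \<bullet> a3"
      and y: "y \<in> root_nbrs r" "y \<bullet> a1 = v i \<bullet> a1" "y \<bullet> a2 = v i \<bullet> a2" "y \<bullet> a3 = v i \<bullet> a3"
      "v m \<bullet> y = v m \<bullet> v i" "y \<bullet> v i = 0" for i m y
  proof -
    have yi: "v i \<bullet> y = 0" using y(6) root_nbrsD(4)[OF y(1)] root_nbrsD(4)[OF uv(2)[OF i]] comm_scalar_prod by metis
    have "v m \<bullet> v i + v m \<bullet> y = 1"
      using antipodal_product[OF uv(2)[OF i] bv[OF i] y(1) _ _ _ yi uv(2)[OF m(1)] bv[OF m(1)]] y(2-4) m grama[OF i] grama[OF m(1)]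
      by auto
    then have "2 * (v m \<bullet> y) = 1" using y(5) by simp
    moreover obtain z :: int where "v m \<bullet> y = of_int z"
      using E8_scalar_prod_Ints[OF root_nbrsD(5)[OF uv(2)[OF m(1)]] root_nbrsD(5)[OF y(1)]] by (auto elim: Ints_cases)
    ultimately have "of_int (2 * z) = (of_int 1 :: real)" by simp
    then have "2 * z = 1" by (simp only: of_int_eq_iff)
    then show False by presburger
  qed
  have a0: "agree r a1 a2 a3 u v {}" unfolding agree_def using carriers by (intro bexI[OF _ E8_Weyl_id]) auto
  \<comment> \<open>Nothing but \<open>r\<close> and the triple has to stay fixed yet, so two
    reflections through a neighbour \<open>z\<close> in the same pillar lead from \<open>y\<close>
    to \<open>v k\<close>.\<close>
  have ak: "agree r a1 a2 a3 u v {k}"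
  proof (rule agree_insert[OF _ a0 k(1) bits[OF k(1)]])
    fix y assume y: "y \<in> root_nbrs r" "y \<bullet> a1 = v k \<bullet> a1" "y \<bullet> a2 = v k \<bullet> a2" "y \<bullet> a3 = v k \<bullet> a3" "y \<bullet> v k = 0"
    note vk = uv(2)[OF k(1)]
    have cy: "y \<in> carrier_vec 8" "v k \<in> carrier_vec 8" using root_nbrsD(4) y(1) vk by auto
    have b: "pillar_bits a1 a2 a3 y" using bv[OF k(1)] y by (simp add: pillar_bits_def)
    have np: "y \<bullet> a2 \<noteq> 1 \<or> y \<bullet> a3 \<noteq> 1" using k grama[OF k(1)] y by auto
    obtain z where z: "z \<in> root_nbrs r" "z \<bullet> y = 1" "z \<bullet> a1 = 1" "z \<bullet> a2 = y \<bullet> a2" "z \<bullet> a3 = y \<bullet> a3"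
      using pillar_neighbour[OF r a orth y(1)] b np by (auto simp: pillar_bits_def)
    have "pillar_bits a1 a2 a3 z" using b z by (simp add: pillar_bits_def)
    then have "z \<bullet> y + z \<bullet> v k = 2"
      using antipodal_product[OF y(1) b vk y(2-5) z(1)] z np by auto
    then have zk: "z \<bullet> v k = 1" using z by simp
    have yz: "y \<bullet> z = 1" using z cy root_nbrsD(4)[OF z(1)] comm_scalar_prod by metis
    have T: "{r, a1, a2, a3} \<subseteq> carrier_vec 8" using carriers by auto
    have "conj_fixing {r, a1, a2, a3} y z"
      using z y b yz products_of_nbr[OF y(1)] products_of_nbr[OF z(1)] root_nbrsD(1)
      by (intro conj_fixing_adjacent[OF T]) (auto simp: pillar_bits_def)
    moreover have "conj_fixing {r, a1, a2, a3} z (v k)"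
      using z y b zk products_of_nbr[OF vk] products_of_nbr[OF z(1)] root_nbrsD(1) vk
      by (intro conj_fixing_adjacent[OF T]) (auto simp: pillar_bits_def)
    ultimately show "conj_fixing ({r, a1, a2, a3} \<union> v ` {}) y (v k)"
      using conj_fixing_trans[OF T cy(1)] by auto
  qed simp
  have kl': "agree r a1 a2 a3 u v {l, k}"
    by (rule agree_insert[OF _ ak l(1) bits[OF l(1)]])
      (use no_antipode[OF l(1) k] kl k in auto)
  have "agree r a1 a2 a3 u v (S \<union> {l, k})" if "S \<subseteq> R" for S
    using finite_subset[OF that fin] that
  proof (induction S rule: finite_induct)
    case empty
    then show ?case using kl' by simp
  next
    case (insert i S)
    then have iR: "i \<in> R" and IH: "agree r a1 a2 a3 u v (S \<union> {l, k})" by auto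
    have "agree r a1 a2 a3 u v (insert i (S \<union> {l, k}))"
    proof (rule agree_insert[OF _ IH iR bits[OF iR]])
      fix y assume y: "y \<in> root_nbrs r" "y \<bullet> a1 = v i \<bullet> a1" "y \<bullet> a2 = v i \<bullet> a2" "y \<bullet> a3 = v i \<bullet> a3"
        "\<forall>j\<in>S \<union> {l, k}. v j \<bullet> y = v j \<bullet> v i" "y \<bullet> v i = 0"
      \<comment> \<open>As \<open>k\<close> and \<open>l\<close> occupy different pillars, at least
        one of them lies outside the pillar of \<open>i\<close>.\<close>
      have "u k \<bullet> a2 \<noteq> u i \<bullet> a2 \<or> u k \<bullet> a3 \<noteq> u i \<bullet> a3 \<or> u l \<bullet> a2 \<noteq> u i \<bullet> a2 \<or> u l \<bullet> a3 \<noteq> u i \<bullet> a3"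
        using kl by auto
      then show "conj_fixing ({r, a1, a2, a3} \<union> v ` (S \<union> {l, k})) y (v i)"
        using no_antipode[OF iR k, of y] no_antipode[OF iR l, of y] y by auto
    qed (use insert k l in auto)
    then show ?case by (simp add: insert_commute)
  qed
  from this[of R] show ?thesis using k l by (simp add: insert_absorb)
qed


text \<open>An obstruction to moving \<open>u i\<close> to \<open>v i\<close> in a single pillar is removed by the product
  of two reflections that exchanges \<open>v i\<close> with its antipode, at the price of exchanging \<open>a1\<close> and \<open>a2\<close>.\<close>

lemma agree_one_pillar:
  assumes pattern: "\<And>i. i \<in> R \<Longrightarrow> v i \<bullet> a1 = v i \<bullet> a2 \<and> (v i \<bullet> a1 = 1 \<and> v i \<bullet> a3 \<in> {0, 1} \<or> v i \<bullet> a1 = 0 \<and> v i \<bullet> a3 = 0)"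
  shows "\<exists>w\<in>E8_Weyl. w r = r \<and> (w a1 = a1 \<and> w a2 = a2 \<or> w a1 = a2 \<and> w a2 = a1) \<and> w a3 = a3 \<and>
    (\<forall>j\<in>R. w (u j) = v j)"
proof -
  have "\<exists>w\<in>E8_Weyl. w r = r \<and> (w a1 = a1 \<and> w a2 = a2 \<or> w a1 = a2 \<and> w a2 = a1) \<and> w a3 = a3 \<and>
    (\<forall>j\<in>J. w (u j) = v j)" if "J \<subseteq> R" for J
    using finite_subset[OF that fin] that
  proof (induction J rule: finite_induct)
    case empty
    show ?case using carriers by (intro bexI[OF _ E8_Weyl_id]) auto
  next
    case (insert i J)
    then have i: "i \<in> R" and J: "J \<subseteq> R" by auto
    from insert obtain w where w: "w \<in> E8_Weyl" and fw: "w r = r" "w a3 = a3"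
      "w a1 = a1 \<and> w a2 = a2 \<or> w a1 = a2 \<and> w a2 = a1" and wJ: "\<forall>j\<in>J. w (u j) = v j" by auto
    let ?y = "w (u i)"
    note cui = root_nbrsD(4)[OF uv(1)[OF i]] and vi = uv(2)[OF i] and cvi = root_nbrsD(4)[OF uv(2)[OF i]]
    have prod: "?y \<bullet> w x = u i \<bullet> x" if "x \<in> carrier_vec 8" for x
      using E8_Weyl_scalar_prod[OF w cui that] .
    have y: "?y \<in> root_nbrs r"
      using E8_Weyl_roots[OF w root_nbrsD(1)[OF uv(1)[OF i]]] prod[OF carriers(4)] fw(1) root_nbrsD(2)[OF uv(1)[OF i]]
      by (simp add: root_nbrs_def)
    note cy = root_nbrsD(4)[OF y]
    have ya: "?y \<bullet> a1 = v i \<bullet> a1" "?y \<bullet> a2 = v i \<bullet> a2" "?y \<bullet> a3 = v i \<bullet> a3"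
      using prod[OF carriers(1)] prod[OF carriers(2)] prod[OF carriers(3)] fw grama[OF i] pattern[OF i] by auto
    have yJ: "v j \<bullet> ?y = v j \<bullet> v i" if j: "j \<in> J" for j
    proof -
      have jR: "j \<in> R" using J j by auto
      have "?y \<bullet> v j = v i \<bullet> v j" using prod[OF root_nbrsD(4)[OF uv(1)[OF jR]]] wJ j gram[OF i jR] by auto
      then show ?thesis
        using cvi cy root_nbrsD(4)[OF uv(2)[OF jR]] comm_scalar_prod by metis
    qed
    have "\<exists>s\<in>E8_Weyl. s r = r \<and> (s a1 = a1 \<and> s a2 = a2 \<or> s a1 = a2 \<and> s a2 = a1) \<and> s a3 = a3 \<and>
      (\<forall>j\<in>J. s (v j) = v j) \<and> s ?y = v i"
    proof -
      let ?T = "{r, a1, a2, a3} \<union> v ` J"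
      have T: "?T \<subseteq> carrier_vec 8" using carriers J root_nbrsD(4)[OF uv(2)] by auto
      have Teq: "\<forall>t\<in>?T. t \<bullet> ?y = t \<bullet> v i"
        using yJ ya products_of_nbr[OF y] products_of_nbr[OF vi] by auto
      have from_conj: ?thesis if "conj_fixing ?T ?y (v i)"
      proof -
        from that obtain s where "s \<in> E8_Weyl" "\<forall>t\<in>?T. s t = t" "s ?y = v i" unfolding conj_fixing_def by blast
        then show ?thesis by (intro bexI[of _ s]) auto
      qed
      \<comment> \<open>Three equal products determine the root (\<open>nbr_determined\<close>);
        otherwise it lies in the pillar named by \<open>a2\<close>.\<close>
      consider "v i \<bullet> a1 = 1 \<and> v i \<bullet> a2 = 1 \<and> v i \<bullet> a3 = 1 \<or> v i \<bullet> a1 = 0 \<and> v i \<bullet> a2 = 0 \<and> v i \<bullet> a3 = 0" |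
        (p) "v i \<bullet> a1 = 1" "v i \<bullet> a2 = 1" "v i \<bullet> a3 = 0" using pattern[OF i] by auto
      then show ?thesis
      proof cases
        case 1
        then have "?y = v i" using ya nbr_determined[OF y vi] by auto
        then show ?thesis using conj_fixing_refl[OF T cvi] from_conj by simp
      next
        case p
        have "?y \<noteq> r - v i" using ya(1) p(1) carriers cvi by (auto simp: ip8_simps triple_products)
        then consider "?y \<bullet> v i = 0" | "?y \<bullet> v i = 1" | "?y = v i"
          using root_nbrs_cases[OF r y vi] by blast
        then show ?thesis
        proof cases
          case 1
          have sum: "?y + v i = a1 + a2"
            using antipodal_sum2[OF y _ _ _ vi] ya p 1 by auto
          have n: "a1 \<bullet> ?y = 1" "a1 \<bullet> v i = 1" "a2 \<bullet> ?y = 1" "a2 \<bullet> v i = 1" "v i \<bullet> ?y = 0"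
            using ya p products_of_nbr[OF y] products_of_nbr[OF vi] 1 comm_scalar_prod[OF cy cvi] by auto
          \<comment> \<open>By \<open>sum\<close>, \<open>?s1\<close> exchanges \<open>a1\<close>
            with \<open>v i\<close> and \<open>?y\<close> with \<open>a2\<close>, while
            \<open>?s2\<close> exchanges \<open>a1\<close> with \<open>?y\<close> and
            \<open>v i\<close> with \<open>a2\<close>. Applying \<open>?s1\<close> and then
            \<open>?s2\<close> exchanges \<open>a1\<close> with \<open>a2\<close> and
            \<open>?y\<close> with \<open>v i\<close>.\<close>
          let ?s1 = "root_reflection (a1 - v i)" and ?s2 = "root_reflection (a1 - ?y)"
          note ra1 = root_nbrsD(1)[OF a(1)]
          note s1 = reflection_swap[OF ra1 root_nbrsD(1)[OF vi] n(2)]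
          note s2 = reflection_swap[OF ra1 root_nbrsD(1)[OF y] n(1)]
          have W: "?s1 \<in> E8_Weyl" "?s2 \<in> E8_Weyl"
            using n root_nbrsD(1)[OF y] root_nbrsD(1)[OF vi] ra1 by (auto intro!: root_reflection_Weyl E8_root_diff)
          have s1y: "?s1 ?y = a2"
          proof -
            have "?s1 ?y = ?y - (?y \<bullet> (a1 - v i)) \<cdot>\<^sub>v (a1 - v i)"
              using cy by (rule root_reflection_apply)
            also have "?y \<bullet> (a1 - v i) = 1" using cy cvi carriers ya p 1 by (simp add: ip8_simps)
            also have "?y - 1 \<cdot>\<^sub>v (a1 - v i) = (?y + v i) - a1" using cy cvi carriers by auto
            also have "\<dots> = a2" unfolding sum using carriers by auto
            finally show ?thesis .
          qed
          have s2v: "?s2 (v i) = a2"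
          proof -
            have "?s2 (v i) = v i - (v i \<bullet> (a1 - ?y)) \<cdot>\<^sub>v (a1 - ?y)"
              using cvi by (rule root_reflection_apply)
            also have "v i \<bullet> (a1 - ?y) = 1" using cy cvi carriers ya p n by (simp add: ip8_simps)
            also have "v i - 1 \<cdot>\<^sub>v (a1 - ?y) = (?y + v i) - a1" using cy cvi carriers by auto
            also have "\<dots> = a2" unfolding sum using carriers by auto
            finally show ?thesis .
          qed
          have s1a: "?s1 a2 = ?y" "?s2 a2 = v i"
            using s1y s2v root_reflection_involution[of "a1 - v i" ?y] root_reflection_involution[of "a1 - ?y" "v i"]
              n root_nbrsD(1)[OF y] root_nbrsD(1)[OF vi] ra1 cy cvi by (metis E8_root_diff)+
          \<comment> \<open>Together with \<open>sum\<close> the two equalities make the products of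
            \<open>t\<close> with \<open>?y\<close>, \<open>v i\<close>, \<open>a1\<close> and
            \<open>a2\<close> all equal, so \<open>t\<close> is orthogonal to both reflecting
            roots.\<close>
          have fixed: "?s1 t = t" "?s2 t = t"
            if t: "t \<in> carrier_vec 8" "t \<bullet> ?y = t \<bullet> v i" "t \<bullet> a1 = t \<bullet> a2" for t
          proof -
            have "t \<bullet> ?y + t \<bullet> v i = t \<bullet> a1 + t \<bullet> a2"
              using arg_cong[OF sum, of "\<lambda>x. t \<bullet> x"] cy cvi carriers t(1) by (simp add: ip8_add_simps)
            then have "t \<bullet> a1 = t \<bullet> v i" "t \<bullet> a1 = t \<bullet> ?y" using t by simp_all
            then show "?s1 t = t" "?s2 t = t" using s1(3) s2(3) t(1) by auto
          qed
          let ?s = "compose (carrier_vec 8) ?s2 ?s1"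
          have fr: "?s1 r = r" "?s2 r = r"
            by (rule fixed; use carriers products_of_nbr[OF y] products_of_nbr[OF vi] in \<open>simp add: triple_products\<close>)+
          have fa3: "?s1 a3 = a3" "?s2 a3 = a3"
            by (rule fixed; use carriers products_of_nbr[OF y] products_of_nbr[OF vi] ya in \<open>simp add: triple_products\<close>)+
          have fJ: "?s1 (v j) = v j" "?s2 (v j) = v j" if "j \<in> J" for j
            using fixed[of "v j"] yJ[OF that] pattern[of j] root_nbrsD(4)[OF uv(2)[of j]] J that by auto
          have "?s r = r" "?s a3 = a3" "?s a1 = a2" "?s a2 = a1" "?s ?y = v i"
            using carriers cy by (simp_all add: compose_def fr fa3 s1 s2 s1a s1y s2v)
          moreover have "\<forall>j\<in>J. ?s (v j) = v j"
            using fJ T by (auto simp: compose_def)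
          ultimately show ?thesis using E8_Weyl_compose[OF W(2) W(1)] by blast
        next
          case 2
          then show ?thesis
            using conj_fixing_adjacent[OF T _ _ _ Teq] root_nbrsD(1)[OF y] root_nbrsD(1)[OF vi] from_conj by blast
        next
          case 3
          then show ?thesis using conj_fixing_refl[OF T cvi] from_conj by simp
        qed
      qed
    qed
    then obtain s where s: "s \<in> E8_Weyl" and fs: "s r = r" "s a3 = a3"
      "s a1 = a1 \<and> s a2 = a2 \<or> s a1 = a2 \<and> s a2 = a1" and sJ: "\<forall>j\<in>J. s (v j) = v j" "s ?y = v i" by auto
    obtain c where c: "c \<in> E8_Weyl" "\<forall>x\<in>carrier_vec 8. c x = s (w x)" "\<forall>j\<in>insert i J. c (u j) = v j"
      using compose_step[OF w s, of J u v i] wJ sJ J root_nbrsD(4)[OF uv(1)] i by blast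
    have "c r = r" "c a3 = a3" "c a1 = a1 \<and> c a2 = a2 \<or> c a1 = a2 \<and> c a2 = a1"
      using c(2) carriers fw fs by auto
    then show ?case using c by blast
  qed
  then show ?thesis by blast
qed

end
end

section \<open>Choice of representatives; equivalence of subsets with a triple\<close>

definition flip :: "real vec \<Rightarrow> bool \<Rightarrow> real vec \<Rightarrow> real vec" where
  "flip r b x = (if b then r - x else x)"

context
  fixes r :: "real vec"
  assumes r: "r \<in> E8_roots"
begin

lemma root_class_eq: "u \<in> root_nbrs r \<Longrightarrow> root_class r u = {u, r - u}"
  using root_nbrs_compl[OF r, of u] root_nbrs_compl_compl[OF r] by (auto simp: root_rel_def)

lemma flip_nbr: "u \<in> root_nbrs r \<Longrightarrow> flip r b u \<in> root_nbrs r"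
  by (simp add: flip_def root_nbrs_compl[OF r])

lemma root_class_flip: "u \<in> root_nbrs r \<Longrightarrow> root_class r (flip r b u) = root_class r u"
  using root_nbrs_compl[OF r, of u] by (auto simp: flip_def root_class_eq root_nbrs_compl_compl[OF r])

lemma root_class_eq_iff:
  assumes "u \<in> root_nbrs r" "v \<in> root_nbrs r"
  shows "root_class r u = root_class r v \<longleftrightarrow> u = v \<or> u = r - v"
  using assms by (auto simp: root_class_eq root_nbrs_compl_compl[OF r] doubleton_eq_iff)

lemma flip_product:
  assumes "u \<in> root_nbrs r" "u' \<in> root_nbrs r"
  shows "flip r b u \<bullet> flip r b' u' = (if b = b' then u \<bullet> u' else 1 - u \<bullet> u')"
  using root_nbrsD[OF assms(1)] root_nbrsD[OF assms(2)] root_nbrs_sym[OF r assms(1)] root_nbrs_sym[OF r assms(2)]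
    r_facts[OF r]
  by (auto simp: flip_def ip8_simps)

lemma flip_product1:
  assumes "u \<in> root_nbrs r" "a \<in> root_nbrs r"
  shows "flip r b u \<bullet> a = (if b then 1 - u \<bullet> a else u \<bullet> a)"
  using flip_product[OF assms, of b False] by (simp add: flip_def)

lemma stab_flip: "w \<in> E8_Weyl \<Longrightarrow> w r = r \<Longrightarrow> u \<in> root_nbrs r \<Longrightarrow> w (flip r b u) = flip r b (w u)"
  using r_facts[OF r] root_nbrsD(4) by (simp add: flip_def E8_Weyl_diff)

lemma stab_nbr:
  assumes w: "w \<in> E8_Weyl" "w r = r" and u: "u \<in> root_nbrs r"
  shows "w u \<in> root_nbrs r"
proof -
  have "w u \<bullet> r = u \<bullet> r"
    using E8_Weyl_scalar_prod[OF w(1) root_nbrsD(4)[OF u] r_facts(1)[OF r]] unfolding w(2) .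
  then show ?thesis
    using E8_Weyl_roots[OF w(1) root_nbrsD(1)[OF u]] root_nbrsD(2)[OF u] by (simp add: root_nbrs_def)
qed

lemma same_triple_equivalent:
  assumes I: "finite I" and i: "i1 \<in> I" "i2 \<in> I" "i3 \<in> I"
    and uv: "\<And>i. i \<in> I \<Longrightarrow> u i \<in> root_nbrs r" "\<And>i. i \<in> I \<Longrightarrow> v i \<in> root_nbrs r"
    and gram: "\<And>i j. i \<in> I \<Longrightarrow> j \<in> I \<Longrightarrow> u i \<bullet> u j = v i \<bullet> v j"
    and distinct: "\<And>i j. i \<in> I \<Longrightarrow> j \<in> I \<Longrightarrow> i \<noteq> j \<Longrightarrow> u i \<bullet> u j \<in> {0, 1}"
    and orth: "v i1 \<bullet> v i2 = 0" "v i1 \<bullet> v i3 = 0" "v i2 \<bullet> v i3 = 0"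
    and same: "u i1 = v i1" "u i2 = v i2" "u i3 = v i3"
  shows "\<exists>w\<in>E8_Weyl. w r = r \<and> (\<lambda>i. root_class r (w (u i))) ` I = (\<lambda>i. root_class r (v i)) ` I"
proof -
  define a1 a2 a3 where a_def: "a1 = v i1" "a2 = v i2" "a3 = v i3"
  have a: "a1 \<in> root_nbrs r" "a2 \<in> root_nbrs r" "a3 \<in> root_nbrs r" using uv(2) i a_def by auto
  have orth': "a1 \<bullet> a2 = 0" "a1 \<bullet> a3 = 0" "a2 \<bullet> a3 = 0" using orth a_def by auto
  note sym = orth_sym[OF r a orth']
  define R where "R = I - {i1, i2, i3}"
  have fin: "finite R" using I by (simp add: R_def)
  have RI: "i \<in> I" "i \<noteq> i1" "i \<noteq> i2" "i \<noteq> i3" if "i \<in> R" for i using that by (auto simp: R_def)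
  \<comment> \<open>The flips normalize all representatives to product 1 with
    \<open>a1\<close>.\<close>
  define b where "b i = (u i \<bullet> a1 \<noteq> 1)" for i
  define u' v' where uv'_def: "u' i = flip r (b i) (u i)" "v' i = flip r (b i) (v i)" for i
  have uv': "u' i \<in> root_nbrs r" "v' i \<in> root_nbrs r" if "i \<in> R" for i
    using uv RI(1)[OF that] by (auto simp: uv'_def flip_nbr)
  have gram': "u' i \<bullet> u' j = v' i \<bullet> v' j" if "i \<in> R" "j \<in> R" for i j
    using gram uv RI(1)[OF that(1)] RI(1)[OF that(2)] by (simp add: uv'_def flip_product)
  have ga: "u i \<bullet> a1 = v i \<bullet> a1" "u i \<bullet> a2 = v i \<bullet> a2" "u i \<bullet> a3 = v i \<bullet> a3" if "i \<in> R" for i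
    using gram[OF RI(1)[OF that] i(1)] gram[OF RI(1)[OF that] i(2)] gram[OF RI(1)[OF that] i(3)]
    by (auto simp: a_def same)
  have grama: "u' i \<bullet> a1 = v' i \<bullet> a1" "u' i \<bullet> a2 = v' i \<bullet> a2" "u' i \<bullet> a3 = v' i \<bullet> a3" if "i \<in> R" for i
    using ga[OF that] uv RI(1)[OF that] a by (simp_all add: uv'_def flip_product1)
  have ua: "u i \<bullet> a1 \<in> {0, 1}" "u i \<bullet> a2 \<in> {0, 1}" "u i \<bullet> a3 \<in> {0, 1}" if "i \<in> R" for i
    using distinct[OF RI(1)[OF that] i(1) RI(2)[OF that]] distinct[OF RI(1)[OF that] i(2) RI(3)[OF that]]
      distinct[OF RI(1)[OF that] i(3) RI(4)[OF that]] by (auto simp: a_def same)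
  have u'a: "u' i \<bullet> a1 = 1" "u' i \<bullet> a2 \<in> {0, 1}" "u' i \<bullet> a3 \<in> {0, 1}" if "i \<in> R" for i
    using ua[OF that] uv RI(1)[OF that] a by (auto simp: uv'_def flip_product1 b_def)
  \<comment> \<open>Only sets of classes are compared, so the triple may be permuted and a common
    further flip \<open>c\<close> does no harm.\<close>
  have finish: ?thesis
    if w: "w \<in> E8_Weyl" "w r = r" "{w a1, w a2, w a3} = {a1, a2, a3}"
      and wR: "\<And>i. i \<in> R \<Longrightarrow> w (flip r c (u' i)) = flip r c (v' i)" for w c
  proof -
    have "root_class r (w (u i)) = root_class r (v i)" if iR: "i \<in> R" for i
    proof -
      have "root_class r (w (u i)) = root_class r (flip r c (flip r (b i) (w (u i))))"
        using stab_nbr[OF w(1,2) uv(1)[OF RI(1)[OF iR]]] by (simp add: root_class_flip flip_nbr)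
      also have "\<dots> = root_class r (w (flip r c (u' i)))"
        using uv(1)[OF RI(1)[OF iR]] w by (simp add: uv'_def stab_flip flip_nbr)
      also have "\<dots> = root_class r (v i)"
        using wR[OF iR] uv(2)[OF RI(1)[OF iR]] by (simp add: uv'_def root_class_flip flip_nbr)
      finally show ?thesis .
    qed
    moreover have "I = R \<union> {i1, i2, i3}" using i by (auto simp: R_def)
    moreover have "(\<lambda>i. root_class r (w (u i))) ` {i1, i2, i3} = root_class r ` {w a1, w a2, w a3}"
      "(\<lambda>i. root_class r (v i)) ` {i1, i2, i3} = root_class r ` {a1, a2, a3}"
      by (auto simp: a_def same)
    ultimately show ?thesis using w by (intro bexI[of _ w]) (simp_all only: image_Un, simp)
  qed
  show ?thesis
  proof (cases "\<exists>k\<in>R. \<exists>l\<in>R. \<not> (u' k \<bullet> a2 = 1 \<and> u' k \<bullet> a3 = 1) \<and> \<not> (u' l \<bullet> a2 = 1 \<and> u' l \<bullet> a3 = 1)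
      \<and> (u' k \<bullet> a2 \<noteq> u' l \<bullet> a2 \<or> u' k \<bullet> a3 \<noteq> u' l \<bullet> a3)")
    case True
    then obtain k l where kl: "k \<in> R" "\<not> (u' k \<bullet> a2 = 1 \<and> u' k \<bullet> a3 = 1)" "l \<in> R" "\<not> (u' l \<bullet> a2 = 1 \<and> u' l \<bullet> a3 = 1)"
      "u' k \<bullet> a2 \<noteq> u' l \<bullet> a2 \<or> u' k \<bullet> a3 \<noteq> u' l \<bullet> a3" by blast
    have "agree r a1 a2 a3 u' v' R"
      by (rule agree_two_pillars[OF r a orth' fin uv' gram' grama _ kl])
        (use u'a in \<open>auto simp: pillar_bits_def\<close>)
    then obtain w where "w \<in> E8_Weyl" "w r = r" "w a1 = a1" "w a2 = a2" "w a3 = a3" "\<forall>j\<in>R. w (u' j) = v' j"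
      unfolding agree_def by blast
    then show ?thesis using finish[of w False] by (auto simp: flip_def)
  next
    case False
    then obtain c2 c3 where c: "(c2, c3) \<in> {(1, 0), (0, 1), (0, 0)}"
      "\<And>i. i \<in> R \<Longrightarrow> u' i \<bullet> a2 = 1 \<and> u' i \<bullet> a3 = 1 \<or> u' i \<bullet> a2 = c2 \<and> u' i \<bullet> a3 = c3"
    proof (cases "\<exists>k\<in>R. \<not> (u' k \<bullet> a2 = 1 \<and> u' k \<bullet> a3 = 1)")
      case True
      then obtain k where k: "k \<in> R" "\<not> (u' k \<bullet> a2 = 1 \<and> u' k \<bullet> a3 = 1)" by blast
      show ?thesis
        by (rule that[of "u' k \<bullet> a2" "u' k \<bullet> a3"]) (use u'a[OF k(1)] k False in auto)
    next
      case False
      \<comment> \<open>No pillar is occupied, so any of the three names will do.\<close>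
      show ?thesis by (rule that[of 1 0]) (use False in auto)
    qed
    from c(1) consider "c2 = 1" "c3 = 0" | "c2 = 0" "c3 = 1" | "c2 = 0" "c3 = 0" by auto
    then show ?thesis
    proof cases
      case 1
      have "\<exists>w\<in>E8_Weyl. w r = r \<and> (w a1 = a1 \<and> w a2 = a2 \<or> w a1 = a2 \<and> w a2 = a1) \<and> w a3 = a3 \<and> (\<forall>j\<in>R. w (u' j) = v' j)"
        by (rule agree_one_pillar[OF r a orth' fin uv' gram' grama]) (use c(2) 1 u'a grama in force)+
      then obtain w where w: "w \<in> E8_Weyl" "w r = r" "w a1 = a1 \<and> w a2 = a2 \<or> w a1 = a2 \<and> w a2 = a1" "w a3 = a3"
        "\<forall>j\<in>R. w (u' j) = v' j" by blast
      moreover have "{w a1, w a2, w a3} = {a1, a2, a3}" using w(3,4) by auto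
      ultimately show ?thesis using finish[of w False] by (simp add: flip_def)
    next
      case 2
      have "\<exists>w\<in>E8_Weyl. w r = r \<and> (w a1 = a1 \<and> w a3 = a3 \<or> w a1 = a3 \<and> w a3 = a1) \<and> w a2 = a2 \<and> (\<forall>j\<in>R. w (u' j) = v' j)"
        by (rule agree_one_pillar[OF r a(1,3,2) orth'(2,1) sym(3) fin uv' gram' grama(1,3,2)]) (use c(2) 2 u'a grama in force)+
      then obtain w where w: "w \<in> E8_Weyl" "w r = r" "w a1 = a1 \<and> w a3 = a3 \<or> w a1 = a3 \<and> w a3 = a1" "w a2 = a2"
        "\<forall>j\<in>R. w (u' j) = v' j" by blast
      moreover have "{w a1, w a2, w a3} = {a1, a2, a3}" using w(3,4) by auto
      ultimately show ?thesis using finish[of w False] by (simp add: flip_def)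
    next
      case 3
      \<comment> \<open>Complements turn the products (1, 0, 0) into (0, 1, 1), so the fourth pillar
        becomes the one named by the pair \<open>a2\<close>, \<open>a3\<close>. Products (1, 1, 1)
        become (0, 0, 0), which is the last alternative in the pattern of
        \<open>agree_one_pillar\<close>.\<close>
      let ?u = "\<lambda>i. flip r True (u' i)" and ?v = "\<lambda>i. flip r True (v' i)"
      have gr: "?u i \<bullet> a1 = ?v i \<bullet> a1" "?u i \<bullet> a2 = ?v i \<bullet> a2" "?u i \<bullet> a3 = ?v i \<bullet> a3" if "i \<in> R" for i
        using uv'[OF that] grama[OF that] a by (simp_all add: flip_product1)
      have "\<exists>w\<in>E8_Weyl. w r = r \<and> (w a2 = a2 \<and> w a3 = a3 \<or> w a2 = a3 \<and> w a3 = a2) \<and> w a1 = a1 \<and> (\<forall>j\<in>R. w (?u j) = ?v j)"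
      proof (rule agree_one_pillar[OF r a(2,3,1) orth'(3) sym(1,2) fin _ _ _ gr(2,3,1)])
        fix i assume iR: "i \<in> R"
        show "?v i \<bullet> a2 = ?v i \<bullet> a3 \<and> (?v i \<bullet> a2 = 1 \<and> ?v i \<bullet> a1 \<in> {0, 1} \<or> ?v i \<bullet> a2 = 0 \<and> ?v i \<bullet> a1 = 0)"
          using c(2)[OF iR] 3 u'a[OF iR] grama[OF iR] uv'[OF iR] a by (auto simp: flip_product1)
      qed (use uv' gram' in \<open>auto simp: flip_nbr flip_product\<close>)
      then obtain w where w: "w \<in> E8_Weyl" "w r = r" "w a2 = a2 \<and> w a3 = a3 \<or> w a2 = a3 \<and> w a3 = a2" "w a1 = a1"
        "\<forall>j\<in>R. w (?u j) = ?v j" by blast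
      moreover have "{w a1, w a2, w a3} = {a1, a2, a3}" using w(3,4) by auto
      ultimately show ?thesis using finish[of w True] by simp
    qed
  qed
qed

text \<open>Both triples can be brought to the same standard position, which reduces the claim to a
  common triple.\<close>

lemma triple_equivalent:
  assumes I: "finite I" and i: "i1 \<in> I" "i2 \<in> I" "i3 \<in> I"
    and uv: "\<And>i. i \<in> I \<Longrightarrow> u i \<in> root_nbrs r" "\<And>i. i \<in> I \<Longrightarrow> v i \<in> root_nbrs r"
    and gram: "\<And>i j. i \<in> I \<Longrightarrow> j \<in> I \<Longrightarrow> u i \<bullet> u j = v i \<bullet> v j"
    and distinct: "\<And>i j. i \<in> I \<Longrightarrow> j \<in> I \<Longrightarrow> i \<noteq> j \<Longrightarrow> u i \<bullet> u j \<in> {0, 1}"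
    and orth: "u i1 \<bullet> u i2 = 0" "u i1 \<bullet> u i3 = 0" "u i2 \<bullet> u i3 = 0"
  shows "\<exists>w\<in>E8_Weyl. w r = r \<and> (\<lambda>i. root_class r (w (u i))) ` I = (\<lambda>i. root_class r (v i)) ` I"
proof -
  have orth': "v i1 \<bullet> v i2 = 0" "v i1 \<bullet> v i3 = 0" "v i2 \<bullet> v i3 = 0" using orth gram i by auto
  obtain g where g: "g \<in> E8_Weyl" "g r = half_vec r0l" "g (u i1) = half_vec a1l" "g (u i2) = half_vec a2l" "g (u i3) = half_vec a3l"
    using move_triple[OF r uv(1)[OF i(1)] uv(1)[OF i(2)] uv(1)[OF i(3)] orth] by blast
  obtain h where h: "h \<in> E8_Weyl" "h r = half_vec r0l" "h (v i1) = half_vec a1l" "h (v i2) = half_vec a2l" "h (v i3) = half_vec a3l"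
    using move_triple[OF r uv(2)[OF i(1)] uv(2)[OF i(2)] uv(2)[OF i(3)] orth'] by blast
  obtain k where k: "k \<in> E8_Weyl" "\<And>x. x \<in> carrier_vec 8 \<Longrightarrow> k (h x) = x" using E8_Weyl_inverse[OF h(1)] by blast
  define w0 where "w0 = compose (carrier_vec 8) k g"
  have w0: "w0 \<in> E8_Weyl" unfolding w0_def by (rule E8_Weyl_compose[OF k(1) g(1)])
  have cu: "u i \<in> carrier_vec 8" "v i \<in> carrier_vec 8" if "i \<in> I" for i using uv that root_nbrsD(4) by auto
  have w0r: "w0 r = r" and w0u: "w0 (u i1) = v i1" "w0 (u i2) = v i2" "w0 (u i3) = v i3"
    using g h k(2) cu i r_facts[OF r] by (auto simp: w0_def compose_def) (metis)+
  have gram0: "w0 (u i) \<bullet> w0 (u j) = u i \<bullet> u j" if "i \<in> I" "j \<in> I" for i j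
    using E8_Weyl_scalar_prod[OF w0 cu(1)[OF that(1)] cu(1)[OF that(2)]] .
  have "\<exists>w\<in>E8_Weyl. w r = r \<and> (\<lambda>i. root_class r (w (w0 (u i)))) ` I = (\<lambda>i. root_class r (v i)) ` I"
    by (rule same_triple_equivalent[OF I i _ uv(2) _ _ orth' w0u])
      (use stab_nbr[OF w0 w0r] uv(1) gram0 gram distinct in auto)
  then obtain w where w: "w \<in> E8_Weyl" "w r = r" "(\<lambda>i. root_class r (w (w0 (u i)))) ` I = (\<lambda>i. root_class r (v i)) ` I" by blast
  have "(\<lambda>i. root_class r (compose (carrier_vec 8) w w0 (u i))) ` I = (\<lambda>i. root_class r (w (w0 (u i)))) ` I"
    using cu by (intro image_cong) (auto simp: compose_def)
  then show ?thesis
    using w w0r r_facts[OF r] by (intro bexI[OF _ E8_Weyl_compose[OF w(1) w0]]) (auto simp: compose_def)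
qed

end

section \<open>Subsets without an orthogonal triple\<close>

definition clique_lists :: "int list list" where
  "clique_lists = [a1l, b2l, b3l, b4l, b5l]"

text \<open>Arranges the separate certificates along one list, so that \<open>move_clique\<close>
  becomes an induction on the length of a prefix.\<close>

lemma clique_hub:
  assumes "k < 6"
  shows "(r0l # clique_lists) ! k \<in> set (roots_with_products (zip (take k (r0l # clique_lists)) (replicate k 4)))"
    "\<exists>hs. hub_chain (roots_with_products (zip (take k (r0l # clique_lists)) (replicate k 4))) [(r0l # clique_lists) ! k] hs"
proof -
  consider "k = 0" | "k = 1" | "k = 2" | "k = 3" | "k = 4" | "k = 5" using assms by linarith
  then have "(r0l # clique_lists) ! k \<in> set (roots_with_products (zip (take k (r0l # clique_lists)) (replicate k 4))) \<and>
    (\<exists>hs. hub_chain (roots_with_products (zip (take k (r0l # clique_lists)) (replicate k 4))) [(r0l # clique_lists) ! k] hs)"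
  proof cases
    case 1
    then have "take k (r0l # clique_lists) = []" "replicate k (4::int) = []" "(r0l # clique_lists) ! k = r0l"
      by (simp_all add: clique_lists_def eval_nat_numeral)
    then show ?thesis using hub_r0 by (simp only:) blast
  next
    case 2
    then have "take k (r0l # clique_lists) = [r0l]" "replicate k (4::int) = [4]" "(r0l # clique_lists) ! k = a1l"
      by (simp_all add: clique_lists_def eval_nat_numeral)
    then show ?thesis using hub_a1 by (simp only:) blast
  next
    case 3
    then have "take k (r0l # clique_lists) = [r0l, a1l]" "replicate k (4::int) = [4, 4]" "(r0l # clique_lists) ! k = b2l"
      by (simp_all add: clique_lists_def eval_nat_numeral)
    then show ?thesis using hub_b2 by (simp only:) blast
  next
    case 4
    then have "take k (r0l # clique_lists) = [r0l, a1l, b2l]" "replicate k (4::int) = [4, 4, 4]" "(r0l # clique_lists) ! k = b3l"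
      by (simp_all add: clique_lists_def eval_nat_numeral)
    then show ?thesis using hub_b3 by (simp only:) blast
  next
    case 5
    then have "take k (r0l # clique_lists) = [r0l, a1l, b2l, b3l]" "replicate k (4::int) = [4, 4, 4, 4]" "(r0l # clique_lists) ! k = b4l"
      by (simp_all add: clique_lists_def eval_nat_numeral)
    then show ?thesis using hub_b4 by (simp only:) blast
  next
    case 6
    then have "take k (r0l # clique_lists) = [r0l, a1l, b2l, b3l, b4l]" "replicate k (4::int) = [4, 4, 4, 4, 4]" "(r0l # clique_lists) ! k = b5l"
      by (simp_all add: clique_lists_def eval_nat_numeral)
    then show ?thesis using hub_b5 by (simp only:) blast
  qed
  then show "(r0l # clique_lists) ! k \<in> set (roots_with_products (zip (take k (r0l # clique_lists)) (replicate k 4)))"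
    "\<exists>hs. hub_chain (roots_with_products (zip (take k (r0l # clique_lists)) (replicate k 4))) [(r0l # clique_lists) ! k] hs"
    by blast+
qed

lemma clique_lists_length: "length (r0l # clique_lists) = 6" "\<forall>t\<in>set (r0l # clique_lists). length t = 8"
  by (simp_all add: clique_lists_def list_defs)

text \<open>The bound 6 counts \<open>r\<close> and five clique roots; for a sixth clique root
  connectedness fails by \<open>products_b6\<close>.\<close>

lemma move_clique:
  assumes r: "r \<in> E8_roots" and xs: "set xs \<subseteq> root_nbrs r" "distinct xs"
    and pair: "\<And>x y. x \<in> set xs \<Longrightarrow> y \<in> set xs \<Longrightarrow> x \<noteq> y \<Longrightarrow> x \<bullet> y = 1"
    and k: "k \<le> 6" "k \<le> Suc (length xs)"
  shows "\<exists>w\<in>E8_Weyl. map w (take k (r # xs)) = map half_vec (take k (r0l # clique_lists))"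
  using k
proof (induction k)
  case 0
  then show ?case using E8_Weyl_id by auto
next
  case (Suc k)
  then obtain w where w: "w \<in> E8_Weyl" "map w (take k (r # xs)) = map half_vec (take k (r0l # clique_lists))" by auto
  have k: "k < 6" "k < length (r # xs)" using Suc.prems by auto
  obtain hs where hs: "hub_chain (roots_with_products (zip (take k (r0l # clique_lists)) (replicate k 4))) [(r0l # clique_lists) ! k] hs"
    using clique_hub(2)[OF k(1)] by blast
  have roots: "set (r # xs) \<subseteq> E8_roots" using xs(1) r root_nbrsD(1) by auto
  have rn: "x \<bullet> r = 1" if "x \<in> set xs" for x using xs(1) that root_nbrsD(2) by auto
  have prod: "(r # xs) ! k \<bullet> (r # xs) ! i = 1" if i: "i < k" for i
  proof (cases i)
    case 0
    then obtain k' where "k = Suc k'" using i by (cases k) auto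
    then show ?thesis using 0 rn k by simp
  next
    case (Suc i')
    then obtain k' where k': "k = Suc k'" using i by (cases k) auto
    have "xs ! k' \<noteq> xs ! i'" using xs(2) k i Suc k' by (simp add: nth_eq_iff_index_eq)
    then show ?thesis using pair[of "xs ! k'" "xs ! i'"] Suc k' k i by simp
  qed
  have "\<exists>w\<in>E8_Weyl. map w (take k (r # xs) @ [(r # xs) ! k]) = map half_vec (take k (r0l # clique_lists) @ [(r0l # clique_lists) ! k])"
  proof (rule move_next[OF clique_hub(1)[OF k(1)] hs w])
    show "set (take k (r # xs)) \<subseteq> carrier_vec 8" using roots E8_root_carrier by (meson set_take_subset subset_iff)
    show "\<forall>t\<in>set (take k (r0l # clique_lists)). length t = 8"
      using clique_lists_length(2) by (meson in_set_takeD)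
    show "(r # xs) ! k \<in> E8_roots" using roots k by (meson nth_mem subsetD)
    show "list_all2 (\<lambda>t c. (r # xs) ! k \<bullet> t = real_of_int c / 4) (take k (r # xs)) (replicate k 4)"
      using k prod by (simp add: list_all2_conv_all_nth)
  qed
  then show ?case
    using k clique_lists_length(1) by (simp only: take_Suc_conv_app_nth)
qed

definition clique_std :: "nat \<Rightarrow> real vec set" where
  "clique_std n = half_vec ` set (take n [a1l, b2l, b3l, b4l, b5l, b6l, b7l])"

definition clique_twisted :: "real vec set" where
  "clique_twisted = half_vec ` {a1l, b2l, b3l, b4l, b5l, c6l}"

lemma std_in_root_lists: "{r0l, a1l, a2l, a3l, b2l, b3l, b4l, b5l, b6l, b7l, c6l} \<subseteq> set root_lists"
proof -
  have "list_all (\<lambda>x. x \<in> set root_lists) [r0l, a1l, a2l, a3l, b2l, b3l, b4l, b5l, b6l, b7l, c6l]"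
    unfolding list_defs by code_simp
  then show ?thesis by (simp add: list_all_iff)
qed

lemma std_roots: "half_vec ` {r0l, a1l, a2l, a3l, b2l, b3l, b4l, b5l, b6l, b7l, c6l} \<subseteq> E8_roots"
  using std_in_root_lists E8_roots_eq by blast

lemma list_lengths: "length r0l = 8" "length a1l = 8" "length a2l = 8" "length a3l = 8" "length b2l = 8"
  "length b3l = 8" "length b4l = 8" "length b5l = 8" "length b6l = 8" "length b7l = 8" "length c6l = 8"
  by (simp_all add: list_defs)

lemma clique_tail:
  assumes Z: "Z \<subseteq> half_vec ` {b6l, c6l, b7l}" and pair: "\<And>x y. x \<in> Z \<Longrightarrow> y \<in> Z \<Longrightarrow> x \<noteq> y \<Longrightarrow> x \<bullet> y = 1"
  shows "Z \<in> {{}, {half_vec b6l}, {half_vec b7l}, {half_vec c6l}, {half_vec b6l, half_vec b7l}}"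
proof -
  have d: "half_vec b6l \<bullet> half_vec c6l = 0" "half_vec b7l \<bullet> half_vec c6l = 0" "half_vec c6l \<bullet> half_vec c6l = 2"
    by (simp_all add: half_vec_scalar_prod list_lengths) (simp_all add: list_defs)
  then have ne: "half_vec b6l \<noteq> half_vec c6l" "half_vec b7l \<noteq> half_vec c6l" by auto
  have "\<not> (half_vec b6l \<in> Z \<and> half_vec c6l \<in> Z)" "\<not> (half_vec b7l \<in> Z \<and> half_vec c6l \<in> Z)"
    using pair[OF _ _ ne(1)] pair[OF _ _ ne(2)] d by auto
  moreover have "Z \<in> Pow {half_vec b6l, half_vec c6l, half_vec b7l}" using Z by auto
  ultimately show ?thesis unfolding Pow_insert by auto
qed

lemma clique_standard_form:
  assumes r: "r \<in> E8_roots" and X: "X \<subseteq> root_nbrs r" "finite X"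
    and pair: "\<And>x y. x \<in> X \<Longrightarrow> y \<in> X \<Longrightarrow> x \<noteq> y \<Longrightarrow> x \<bullet> y = 1"
  shows "\<exists>w\<in>E8_Weyl. w r = half_vec r0l \<and> (w ` X = clique_std (card X) \<or> card X = 6 \<and> w ` X = clique_twisted)"
proof -
  obtain xs where xs: "set xs = X" "distinct xs" using finite_distinct_list[OF X(2)] by blast
  have len: "length xs = card X" using xs distinct_card by metis
  show ?thesis
  proof (cases "card X \<le> 5")
    case True
    obtain w where w: "w \<in> E8_Weyl" "map w (take (Suc (card X)) (r # xs)) = map half_vec (take (Suc (card X)) (r0l # clique_lists))"
      using move_clique[OF r _ xs(2), of "Suc (card X)"] X xs pair True len by auto
    then have wr: "w r = half_vec r0l" and wx: "map w xs = map half_vec (take (card X) clique_lists)" using len by auto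
    have "w ` X = set (map w xs)" using xs by simp
    also have "\<dots> = clique_std (card X)"
      unfolding wx clique_std_def using True
      by (simp add: clique_lists_def take_Cons' image_iff)
    finally show ?thesis using w wr by blast
  next
    case False
    then have l6: "6 \<le> Suc (length xs)" using len by simp
    obtain w where w: "w \<in> E8_Weyl" "map w (take 6 (r # xs)) = map half_vec (take 6 (r0l # clique_lists))"
      using move_clique[OF r _ xs(2) _ _ l6] X xs pair by auto
    have "take 6 (r0l # clique_lists) = r0l # clique_lists" by (simp add: clique_lists_def)
    moreover have "take 6 (r # xs) = r # take 5 xs" by simp
    ultimately have wr: "w r = half_vec r0l" and wx: "map w (take 5 xs) = map half_vec clique_lists" using w(2) by auto
    have cX: "x \<in> carrier_vec 8" if "x \<in> X" for x using that X root_nbrsD(4) by auto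
    have inj: "inj_on w X"
    proof (rule inj_onI)
      fix x y assume "x \<in> X" "y \<in> X" "w x = w y"
      then show "x = y" using E8_Weyl_inverse[OF w(1)] cX by metis
    qed
    have wp: "w x \<bullet> w y = x \<bullet> y" if "x \<in> X \<or> x = r" "y \<in> X \<or> y = r" for x y
      using that cX r_facts[OF r] by (intro E8_Weyl_scalar_prod[OF w(1)]) auto
    let ?B = "half_vec ` set clique_lists"
    have B: "w ` set (take 5 xs) = ?B" using arg_cong[OF wx, of set] by simp
    \<comment> \<open>The roots beyond the first five have product 1 with \<open>r\<close> and those
      five, so their images are among the three roots of \<open>products_b6\<close>.\<close>
    define Z where "Z = w ` set (drop 5 xs)"
    have tdX: "set (take 5 xs) \<subseteq> X" "set (drop 5 xs) \<subseteq> X" using xs by (auto dest: in_set_takeD in_set_dropD)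
    have disj: "set (take 5 xs) \<inter> set (drop 5 xs) = {}" using xs(2) by (metis append_take_drop_id distinct_append)
    have WX: "w ` X = ?B \<union> Z" unfolding Z_def B[symmetric] xs(1)[symmetric]
      by (metis append_take_drop_id image_Un set_append)
    have cardZ: "card Z = card X - 5"
      using card_image[OF inj_on_subset[OF inj tdX(2)]] distinct_card[OF distinct_drop[OF xs(2)]] len by (simp add: Z_def)
    have Zsub: "Z \<subseteq> half_vec ` {b6l, c6l, b7l}"
    proof
      fix z assume "z \<in> Z"
      then obtain x where x: "x \<in> set (drop 5 xs)" "z = w x" by (auto simp: Z_def)
      then have xX: "x \<in> X" using tdX by auto
      have xr: "x \<bullet> r = 1" using xX X root_nbrsD(2) by blast
      have "w x \<bullet> w r = x \<bullet> r" by (rule wp) (use xX in auto)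
      then have "z \<bullet> half_vec r0l = 1" unfolding wr xr x(2) .
      moreover have "z \<bullet> y = 1" if "y \<in> ?B" for y
      proof -
        from that have "y \<in> w ` set (take 5 xs)" unfolding B .
        then obtain t where t: "t \<in> set (take 5 xs)" "y = w t" by (rule imageE)
        then have tX: "t \<in> X" "x \<noteq> t" using tdX disj x by auto
        have "w x \<bullet> w t = x \<bullet> t" by (rule wp) (use xX tX in auto)
        also have "\<dots> = 1" using pair[OF xX tX] .
        finally show ?thesis using t x by simp
      qed
      ultimately have "list_all2 (\<lambda>t c. z \<bullet> half_vec t = of_int c / 4) [r0l, a1l, b2l, b3l, b4l, b5l] [4, 4, 4, 4, 4, 4]"
        by (simp add: clique_lists_def)
      moreover have "z \<in> E8_roots" using E8_Weyl_roots[OF w(1)] x xX X root_nbrsD(1) by auto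
      ultimately show "z \<in> half_vec ` {b6l, c6l, b7l}"
        using roots_with_products_iff[of z "[r0l, a1l, b2l, b3l, b4l, b5l]" "[4, 4, 4, 4, 4, 4]"]
        by (simp only: products_b6) (simp add: list_lengths)
    qed
    have Zpair: "x \<bullet> y = 1" if xy: "x \<in> Z" "y \<in> Z" "x \<noteq> y" for x y
    proof -
      obtain x' y' where xy': "x' \<in> X" "x = w x'" "y' \<in> X" "y = w y'" using xy tdX by (auto simp: Z_def)
      have "w x' \<bullet> w y' = x' \<bullet> y'" by (rule wp) (use xy' in auto)
      also have "\<dots> = 1" using xy' xy by (intro pair) auto
      finally show ?thesis using xy' by simp
    qed
    have b67: "half_vec b6l \<noteq> half_vec b7l"
    proof -
      have "half_vec b6l \<bullet> half_vec b7l = 1" "half_vec b6l \<bullet> half_vec b6l = 2"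
        by (simp_all add: half_vec_scalar_prod list_lengths) (simp_all add: list_defs)
      then show ?thesis by auto
    qed
    from clique_tail[OF Zsub Zpair] False cardZ consider "Z = {half_vec b6l}" | "Z = {half_vec b7l}"
      | "Z = {half_vec c6l}" | "Z = {half_vec b6l, half_vec b7l}" by auto
    then show ?thesis
    proof cases
      case 1
      then have "card X = 6" using cardZ False by simp
      then have "w ` X = clique_std (card X)" using WX 1 by (auto simp: clique_std_def clique_lists_def)
      then show ?thesis using w wr by blast
    next
      case 2
      \<comment> \<open>\<open>b6l\<close> and \<open>b7l\<close> have product 1 and equal products
        with \<open>r0l\<close> and the first five, so this reflection exchanges them and fixes the
        rest.\<close>
      let ?s = "root_reflection (half_vec b6l - half_vec b7l)"
      have p: "half_vec b6l \<bullet> half_vec b7l = 1" by (simp add: half_vec_scalar_prod list_lengths) (simp add: list_defs)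
      have rt: "half_vec b6l \<in> E8_roots" "half_vec b7l \<in> E8_roots" using std_roots by auto
      note sw = reflection_swap[OF rt p]
      have fx: "?s (half_vec t) = half_vec t" if "t \<in> set (r0l # clique_lists)" for t
        using that half_vec_carrier list_lengths
        by (intro sw(3)) (auto simp: clique_lists_def half_vec_scalar_prod, simp_all add: list_defs)
      have "card X = 6" using cardZ False 2 by simp
      have "compose (carrier_vec 8) ?s w ` X = ?s ` w ` X" using cX by (auto simp: compose_def image_iff)
      also have "\<dots> = ?s ` ?B \<union> {half_vec b6l}" using WX 2 sw(2) by auto
      also have "?s ` ?B = ?B" using fx by (auto simp: image_iff)
      also have "?B \<union> {half_vec b6l} = clique_std (card X)"
        using \<open>card X = 6\<close> by (auto simp: clique_std_def clique_lists_def)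
      finally have "compose (carrier_vec 8) ?s w ` X = clique_std (card X)" .
      moreover have "compose (carrier_vec 8) ?s w r = half_vec r0l"
        using r_facts[OF r] wr fx by (simp add: compose_def)
      moreover have "?s \<in> E8_Weyl" using rt p by (intro root_reflection_Weyl E8_root_diff)
      ultimately show ?thesis using E8_Weyl_compose[OF _ w(1)] by blast
    next
      case 3
      then have "card X = 6" using cardZ False by simp
      moreover have "w ` X = clique_twisted" using WX 3 by (auto simp: clique_twisted_def clique_lists_def)
      ultimately show ?thesis using w wr by blast
    next
      case 4
      then have "card X = 7" using cardZ False b67 by simp
      then have "w ` X = clique_std (card X)" using WX 4 by (auto simp: clique_std_def clique_lists_def)
      then show ?thesis using w wr by blast
    qed
  qed
qed

section \<open>Seidel matrices as Gram matrices\<close>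

text \<open>Any bound uniform in \<open>x\<close> serves here: it supplies a first shift that makes
  the form nonnegative, and later controls the inverse matrix.\<close>

lemma quadratic_form_bound:
  fixes A :: "real mat"
  assumes A: "A \<in> carrier_mat n n" and x: "x \<in> carrier_vec n"
  shows "\<bar>x \<bullet> (A *\<^sub>v x)\<bar> \<le> (\<Sum>i<n. \<Sum>j<n. \<bar>A $$ (i, j)\<bar>) * (x \<bullet> x)"
proof -
  have sq: "x $ i * x $ i \<le> x \<bullet> x" if "i < n" for i
  proof -
    have "x \<bullet> x = (\<Sum>k<n. x $ k * x $ k)" using x by (auto simp: scalar_prod_def lessThan_atLeast0)
    moreover have "x $ i * x $ i \<le> (\<Sum>k<n. x $ k * x $ k)"
      using that by (intro member_le_sum) auto
    ultimately show ?thesis by simp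
  qed
  have prod: "\<bar>x $ i * x $ j\<bar> \<le> x \<bullet> x" if "i < n" "j < n" for i j
  proof -
    have "0 \<le> (\<bar>x $ i\<bar> - \<bar>x $ j\<bar>)\<^sup>2" by simp
    then have "2 * \<bar>x $ i * x $ j\<bar> \<le> x $ i * x $ i + x $ j * x $ j"
      by (simp add: power2_eq_square algebra_simps abs_mult)
    then show ?thesis using sq[OF that(1)] sq[OF that(2)] by linarith
  qed
  have "x \<bullet> (A *\<^sub>v x) = (\<Sum>i<n. x $ i * (\<Sum>j<n. A $$ (i, j) * x $ j))"
    using A x by (auto simp: scalar_prod_def lessThan_atLeast0 intro!: sum.cong)
  also have "\<dots> = (\<Sum>i<n. \<Sum>j<n. A $$ (i, j) * (x $ i * x $ j))"
    by (simp add: sum_distrib_left algebra_simps)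
  also have "\<bar>\<dots>\<bar> \<le> (\<Sum>i<n. \<Sum>j<n. \<bar>A $$ (i, j) * (x $ i * x $ j)\<bar>)"
    by (rule order_trans[OF sum_abs]) (intro sum_mono sum_abs)
  also have "\<dots> \<le> (\<Sum>i<n. \<Sum>j<n. \<bar>A $$ (i, j)\<bar> * (x \<bullet> x))"
    unfolding abs_mult[of "A $$ _"] using prod by (intro sum_mono mult_left_mono) auto
  also have "\<dots> = (\<Sum>i<n. \<Sum>j<n. \<bar>A $$ (i, j)\<bar>) * (x \<bullet> x)"
    by (simp add: sum_distrib_right)
  finally show ?thesis .
qed

lemma symmetric_scalar_prod:
  fixes A :: "real mat"
  assumes A: "A \<in> carrier_mat n n" "A\<^sup>T = A" and x: "x \<in> carrier_vec n" "y \<in> carrier_vec n"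
  shows "x \<bullet> (A *\<^sub>v y) = y \<bullet> (A *\<^sub>v x)"
proof -
  have "(A\<^sup>T *\<^sub>v x) \<bullet> y = x \<bullet> (A *\<^sub>v y)" using transpose_vec_mult_scalar[OF A(1) x(2) x(1)] .
  moreover have "(A *\<^sub>v x) \<bullet> y = y \<bullet> (A *\<^sub>v x)" using A x by (intro comm_scalar_prod) auto
  ultimately show ?thesis using A(2) by simp
qed

text \<open>The infimum \<open>t\<close> of the shifts that make \<open>A + t I\<close> positive semidefinite is attained, and
  \<open>A + t I\<close> is singular if \<open>t > 0\<close>: the inverse of a nonsingular semidefinite matrix
  yields a uniform lower bound for its quadratic form, hence room for a smaller shift.\<close>

lemma nonneg_eigenvalues_psd:
  fixes A :: "real mat"
  assumes A: "A \<in> carrier_mat n n" "A\<^sup>T = A" and ev: "\<And>e. eigenvalue A e \<Longrightarrow> 0 \<le> e"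
    and x: "x \<in> carrier_vec n"
  shows "0 \<le> x \<bullet> (A *\<^sub>v x)"
proof -
  have pos: "0 \<le> y \<bullet> y" for y :: "real vec" by (simp add: scalar_prod_def sum_nonneg)
  define T where "T = {t. 0 \<le> t \<and> (\<forall>y\<in>carrier_vec n. 0 \<le> y \<bullet> (A *\<^sub>v y) + t * (y \<bullet> y))}"
  have "(\<Sum>i<n. \<Sum>j<n. \<bar>A $$ (i, j)\<bar>) \<in> T"
    using quadratic_form_bound[OF A(1)] by (fastforce simp: T_def abs_le_iff intro!: sum_nonneg)
  then have ne: "T \<noteq> {}" by blast
  have bdd: "bdd_below T" by (auto simp: T_def intro!: bdd_belowI[of _ 0])
  define t where "t = Inf T"
  have t0: "0 \<le> t" unfolding t_def using ne by (intro cInf_greatest) (auto simp: T_def)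
  have tT: "0 \<le> y \<bullet> (A *\<^sub>v y) + t * (y \<bullet> y)" if y: "y \<in> carrier_vec n" for y
  proof (rule ccontr)
    assume neg: "\<not> ?thesis"
    define d where "d = - (y \<bullet> (A *\<^sub>v y) + t * (y \<bullet> y)) / (y \<bullet> y + 1)"
    have "0 < d" using neg pos[of y] unfolding d_def by (intro divide_pos_pos) auto
    have dy: "d * (y \<bullet> y + 1) = - (y \<bullet> (A *\<^sub>v y) + t * (y \<bullet> y))"
      unfolding d_def using pos[of y] by simp
    have "Inf T < t + d" using \<open>0 < d\<close> unfolding t_def by linarith
    then obtain s where s: "s \<in> T" "s < t + d" using cInf_lessD[OF ne] by blast
    have "(s - t) * (y \<bullet> y) \<le> d * (y \<bullet> y)" using s pos[of y] by (intro mult_right_mono) auto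
    also have "\<dots> < d * (y \<bullet> y + 1)" using \<open>0 < d\<close> by simp
    also have "\<dots> = - (y \<bullet> (A *\<^sub>v y) + t * (y \<bullet> y))" by (rule dy)
    finally have "y \<bullet> (A *\<^sub>v y) + s * (y \<bullet> y) < 0" by (simp add: algebra_simps)
    then show False using s(1) y by (force simp: T_def)
  qed
  have "t = 0"
  proof (rule ccontr)
    assume "t \<noteq> 0"
    then have tpos: "0 < t" using t0 by simp
    \<comment> \<open>\<open>char_matrix A (- t)\<close> is \<open>A + t I\<close>.\<close>
    let ?B = "char_matrix A (- t)"
    have Bc: "?B \<in> carrier_mat n n" using A by simp
    have one: "(t \<cdot>\<^sub>m 1\<^sub>m n) *\<^sub>v y = t \<cdot>\<^sub>v y" if "y \<in> carrier_vec n" for y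
      using that by (intro eq_vecI) (auto simp: smult_scalar_prod_distrib[of _ n])
    have Bv: "?B *\<^sub>v y = A *\<^sub>v y + t \<cdot>\<^sub>v y" if "y \<in> carrier_vec n" for y
      using A that by (simp add: char_matrix_def add_mult_distrib_mat_vec[of _ n n] one)
    have Bq: "y \<bullet> (?B *\<^sub>v z) = y \<bullet> (A *\<^sub>v z) + t * (y \<bullet> z)" if "y \<in> carrier_vec n" "z \<in> carrier_vec n" for y z
      using A that by (simp add: Bv scalar_prod_add_distrib[of _ n])
    have Bsym: "y \<bullet> (?B *\<^sub>v z) = z \<bullet> (?B *\<^sub>v y)" if "y \<in> carrier_vec n" "z \<in> carrier_vec n" for y z
      using that symmetric_scalar_prod[OF A that] comm_scalar_prod[OF that] by (simp add: Bq)
    have "\<not> eigenvalue A (- t)" using ev tpos by force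
    then have "det ?B \<noteq> 0" using eigenvalue_det[OF A(1)] by simp
    from det_non_zero_imp_unit[OF Bc this, of "()"]
    obtain G where G: "G \<in> carrier_mat n n" "?B * G = 1\<^sub>m n"
      unfolding Units_def ring_mat_def by auto
    \<comment> \<open>The term \<open>1 / t\<close> keeps the smaller shift \<open>t - 1 / K\<close>
      nonnegative, as membership in \<open>T\<close> requires.\<close>
    define K where "K = max (\<Sum>i<n. \<Sum>j<n. \<bar>G $$ (i, j)\<bar>) (1 / t)"
    have Kpos: "0 < K" using tpos by (simp add: K_def less_max_iff_disj)
    have lower: "(y \<bullet> y) / K \<le> y \<bullet> (?B *\<^sub>v y)" if y: "y \<in> carrier_vec n" for y
    proof -
      define z where "z = G *\<^sub>v y"
      have z: "z \<in> carrier_vec n" using G y by (simp add: z_def)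
      have Bz: "?B *\<^sub>v z = y"
        unfolding z_def using assoc_mult_mat_vec[OF Bc G(1) y] G(2) y by simp
      have "y \<bullet> z \<le> K * (y \<bullet> y)"
      proof -
        have "y \<bullet> z \<le> (\<Sum>i<n. \<Sum>j<n. \<bar>G $$ (i, j)\<bar>) * (y \<bullet> y)"
          using quadratic_form_bound[OF G(1) y] by (simp add: z_def)
        also have "\<dots> \<le> K * (y \<bullet> y)" using pos by (intro mult_right_mono) (auto simp: K_def)
        finally show ?thesis .
      qed
      define s where "s = 1 / K"
      have sK: "s * K = 1" "0 < s" using Kpos by (auto simp: s_def)
      \<comment> \<open>At \<open>y - s z\<close> the form takes the value
        \<open>(y, By) - 2 s (y, y) + s^2 (y, z)\<close>, since \<open>Bz = y\<close>. With
        \<open>(y, z)\<close> at most \<open>K (y, y)\<close> and \<open>s K = 1\<close>,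
        nonnegativity gives that \<open>(y, By)\<close> is at least \<open>s (y, y)\<close>.\<close>
      let ?v = "y - s \<cdot>\<^sub>v z"
      have v: "?v \<in> carrier_vec n" using y z by simp
      have Bvv: "?B *\<^sub>v ?v = ?B *\<^sub>v y - s \<cdot>\<^sub>v y"
        using mult_minus_distrib_mat_vec[OF Bc y, of "s \<cdot>\<^sub>v z"] mult_mat_vec[OF Bc z, of s] z Bz by simp
      have "0 \<le> ?v \<bullet> (?B *\<^sub>v ?v)" using tT[OF v] Bq[OF v v] by simp
      also have "?v \<bullet> (?B *\<^sub>v ?v) = y \<bullet> (?B *\<^sub>v y) - s * (y \<bullet> y) - s * (z \<bullet> (?B *\<^sub>v y)) + s * (s * (z \<bullet> y))"
        unfolding Bvv using y z Bc
        by (simp add: minus_scalar_prod_distrib[of _ n] scalar_prod_minus_distrib[of _ n] algebra_simps)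
      finally have "0 \<le> y \<bullet> (?B *\<^sub>v y) - s * (y \<bullet> y) - s * (y \<bullet> y) + s * (s * (y \<bullet> z))"
        using Bsym[OF z y] Bz comm_scalar_prod[OF z y] by simp
      moreover have "s * (s * (y \<bullet> z)) \<le> s * (s * (K * (y \<bullet> y)))"
        using \<open>y \<bullet> z \<le> K * (y \<bullet> y)\<close> sK by (intro mult_left_mono) auto
      moreover have "s * (s * (K * (y \<bullet> y))) = (s * K) * (s * (y \<bullet> y))" by (simp only: mult_ac)
      moreover have "(s * K) * (s * (y \<bullet> y)) = s * (y \<bullet> y)" unfolding sK by simp
      ultimately have "s * (y \<bullet> y) \<le> y \<bullet> (?B *\<^sub>v y)" by linarith
      then show ?thesis by (simp add: s_def)
    qed
    have "t - 1 / K \<in> T"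
    proof -
      have "1 / t \<le> K" by (simp add: K_def)
      then have "1 / K \<le> t" using tpos Kpos by (simp add: field_simps)
      moreover have "0 \<le> y \<bullet> (A *\<^sub>v y) + (t - 1 / K) * (y \<bullet> y)" if "y \<in> carrier_vec n" for y
        using lower[OF that] Bq[OF that that] by (simp add: algebra_simps)
      ultimately show ?thesis by (simp add: T_def)
    qed
    then have "t \<le> t - 1 / K" unfolding t_def by (rule cInf_lower[OF _ bdd])
    then show False using Kpos by simp
  qed
  then show ?thesis using tT[OF x] by simp
qed

section \<open>Positivity and rank of \<open>3I - S\<close>\<close>

definition gram_of_seidel :: "real mat \<Rightarrow> nat \<Rightarrow> nat \<Rightarrow> real" where
  "gram_of_seidel S i j = (if i = j then 3 else - S $$ (i, j))"

lemma Omega_shift: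
  assumes "S \<in> seidel_mats n"
  shows "3 \<cdot>\<^sub>m 1\<^sub>m n - S \<in> carrier_mat n n" "(3 \<cdot>\<^sub>m 1\<^sub>m n - S)\<^sup>T = 3 \<cdot>\<^sub>m 1\<^sub>m n - S"
    and "\<And>i j. i < n \<Longrightarrow> j < n \<Longrightarrow> (3 \<cdot>\<^sub>m 1\<^sub>m n - S) $$ (i, j) = gram_of_seidel S i j"
proof -
  have S: "S \<in> carrier_mat n n" "S\<^sup>T = S" "\<And>i. i < n \<Longrightarrow> S $$ (i, i) = 0" using assms by (auto simp: seidel_mats_def)
  show "3 \<cdot>\<^sub>m 1\<^sub>m n - S \<in> carrier_mat n n" using S(1) by (intro carrier_matI) auto
  show "(3 \<cdot>\<^sub>m 1\<^sub>m n - S)\<^sup>T = 3 \<cdot>\<^sub>m 1\<^sub>m n - S"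
  proof (rule eq_matI)
    fix i j assume ij: "i < dim_row (3 \<cdot>\<^sub>m 1\<^sub>m n - S)" "j < dim_col (3 \<cdot>\<^sub>m 1\<^sub>m n - S)"
    then have "i < n" "j < n" using S by auto
    moreover from this have "S\<^sup>T $$ (i, j) = S $$ (j, i)" using S(1) by simp
    ultimately show "(3 \<cdot>\<^sub>m 1\<^sub>m n - S)\<^sup>T $$ (i, j) = (3 \<cdot>\<^sub>m 1\<^sub>m n - S) $$ (i, j)"
      using S by auto
  qed (use S in auto)
  show "(3 \<cdot>\<^sub>m 1\<^sub>m n - S) $$ (i, j) = gram_of_seidel S i j" if "i < n" "j < n" for i j
    using S that by (auto simp: gram_of_seidel_def)
qed

text \<open>An eigenvalue \<open>e\<close> of \<open>3I - S\<close> corresponds to the eigenvalue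
  \<open>3 - e\<close> of \<open>S\<close>, so it is nonnegative.\<close>

lemma Omega_psd:
  assumes "S \<in> Omega n"
  shows "0 \<le> (\<Sum>i<n. \<Sum>j<n. f i * f j * gram_of_seidel S i j)"
proof -
  have S: "S \<in> seidel_mats n" "\<And>e. eigenvalue S e \<Longrightarrow> e \<le> 3" using assms by (auto simp: Omega_def)
  let ?A = "3 \<cdot>\<^sub>m 1\<^sub>m n - S"
  note A = Omega_shift[OF S(1)]
  have Sc: "S \<in> carrier_mat n n" using S by (auto simp: seidel_mats_def)
  have ev: "0 \<le> e" if e: "eigenvalue ?A e" for e
  proof -
    have "char_matrix ?A e = - char_matrix S (3 - e)"
      using Sc by (intro eq_matI) (auto simp: char_matrix_def)
    then have "char_matrix ?A e = (- 1) \<cdot>\<^sub>m char_matrix S (3 - e)" using Sc by (auto intro!: eq_matI)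
    moreover have "det (char_matrix ?A e) = 0" using eigenvalue_det[OF A(1)] e by simp
    ultimately have "det (char_matrix S (3 - e)) = 0" by simp
    then have "eigenvalue S (3 - e)" using eigenvalue_det[OF Sc] by simp
    then show ?thesis using S(2) by force
  qed
  let ?x = "vec n f"
  have "0 \<le> ?x \<bullet> (?A *\<^sub>v ?x)" by (rule nonneg_eigenvalues_psd[OF A(1,2) ev]) auto
  also have "?x \<bullet> (?A *\<^sub>v ?x) = (\<Sum>i<n. f i * (\<Sum>j<n. ?A $$ (i, j) * f j))"
    using A(1) Sc by (auto simp: scalar_prod_def lessThan_atLeast0 intro!: sum.cong)
  also have "\<dots> = (\<Sum>i<n. f i * (\<Sum>j<n. gram_of_seidel S i j * f j))"
    using A(3) by (intro sum.cong arg_cong[where f = "\<lambda>s. f _ * s"]) auto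
  also have "\<dots> = (\<Sum>i<n. \<Sum>j<n. f i * f j * gram_of_seidel S i j)"
    by (simp add: sum_distrib_left algebra_simps)
  finally show ?thesis .
qed

lemma Omega_dependent:
  assumes "S \<in> Omega n" and J: "J \<subseteq> {..<n}" "card J = 8"
  shows "\<exists>c. (\<exists>j\<in>J. c j \<noteq> 0) \<and> (\<forall>i<n. (\<Sum>j\<in>J. c j * gram_of_seidel S i j) = 0)"
proof -
  have S: "S \<in> seidel_mats n" "vec_space.rank n (3 \<cdot>\<^sub>m 1\<^sub>m n - S) \<le> 7" using assms by (auto simp: Omega_def)
  let ?A = "3 \<cdot>\<^sub>m 1\<^sub>m n - S"
  note A = Omega_shift[OF S(1)]
  have fin: "finite J" using J finite_subset by blast
  have col: "col ?A j $ i = gram_of_seidel S i j" if "i < n" "j \<in> J" for i j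
    using A(3)[of i j] A(1) that J by (auto simp del: index_minus_mat)
  show ?thesis
  proof (cases "inj_on (col ?A) J")
    \<comment> \<open>Linear independence is a property of the set of columns, so coinciding columns
      get a dependence of their own.\<close>
    case False
    then obtain j k where jk: "j \<in> J" "k \<in> J" "j \<noteq> k" "col ?A j = col ?A k" by (auto simp: inj_on_def)
    let ?c = "\<lambda>i. if i = j then 1 else if i = k then -1 else 0 :: real"
    have "(\<Sum>l\<in>J. ?c l * gram_of_seidel S i l) = 0" if "i < n" for i
    proof -
      have "(\<Sum>l\<in>J. ?c l * gram_of_seidel S i l) = (\<Sum>l\<in>{j, k}. ?c l * gram_of_seidel S i l)"
        using jk fin by (intro sum.mono_neutral_right) auto
      also have "\<dots> = 0" using jk col[OF that jk(1)] col[OF that jk(2)] by simp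
      finally show ?thesis .
    qed
    then show ?thesis using jk by (intro exI[of _ ?c]) auto
  next
    case True
    interpret V: vec_space "TYPE(real)" n .
    let ?U = "col ?A ` J"
    have U: "card ?U = 8" "finite ?U" using card_image[OF True] J fin by auto
    have "dim_col ?A = n" using A(1) by blast
    then have Ucols: "?U \<subseteq> set (cols ?A)" using J by (auto simp: cols_def simp del: index_minus_mat)
    have "\<not> V.lin_indpt ?U" using V.rank_ge_card_indpt[OF A(1) Ucols] U S(2) by auto
    then obtain B a v where B: "finite B" "B \<subseteq> ?U" "V.lincomb a B = 0\<^sub>v n" "v \<in> B" "a v \<noteq> 0"
      unfolding V.lin_dep_def by auto
    have "col ?A j \<in> carrier_vec n" for j using A(1) by (metis carrier_matD(1) col_dim)
    then have Bc: "B \<subseteq> carrier_vec n" using B(2) by blast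
    let ?c = "\<lambda>j. if col ?A j \<in> B then a (col ?A j) else 0"
    have "(\<Sum>j\<in>J. ?c j * gram_of_seidel S i j) = 0" if i: "i < n" for i
    proof -
      have "(\<Sum>j\<in>J. ?c j * gram_of_seidel S i j) = (\<Sum>j\<in>J. ?c j * col ?A j $ i)"
        using col[OF i] by (intro sum.cong) auto
      also have "\<dots> = (\<Sum>u\<in>?U. (if u \<in> B then a u else 0) * u $ i)"
        using sum.reindex[OF True, of "\<lambda>u. (if u \<in> B then a u else 0) * u $ i"] by simp
      also have "\<dots> = (\<Sum>u\<in>B. a u * u $ i)"
        using B U by (intro sum.mono_neutral_cong_right) auto
      also have "\<dots> = V.lincomb a B $ i" using V.lincomb_index[OF i Bc] by simp
      finally show ?thesis using B(3) i by simp
    qed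
    moreover have "\<exists>j\<in>J. ?c j \<noteq> 0" using B(2,4,5) by auto
    ultimately show ?thesis by (intro exI[of _ ?c] conjI allI impI)
  qed
qed

section \<open>Embedding abstract configurations into E8\<close>

text \<open>A relation instead of an additive map: the generators may be dependent modulo the
  radical, and preservation of products (\<open>lattice_graph_product\<close>) takes the place of
  well-definedness.\<close>

inductive lattice_graph :: "('v::minus \<times> real vec) set \<Rightarrow> 'v \<Rightarrow> real vec \<Rightarrow> bool" for P where
  base: "(v, z) \<in> P \<Longrightarrow> lattice_graph P v z"
| diff: "lattice_graph P v z \<Longrightarrow> lattice_graph P v' z' \<Longrightarrow> lattice_graph P (v - v') (z - z')"

context semidefinite_form
begin

lemma lattice_graph_E8:
  assumes "lattice_graph P v z" "\<And>v z. (v, z) \<in> P \<Longrightarrow> z \<in> E8"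
  shows "z \<in> E8"
  using assms by (induction rule: lattice_graph.induct) (auto intro: E8_diff)

lemma lattice_graph_product:
  assumes E8: "\<And>v z. (v, z) \<in> P \<Longrightarrow> z \<in> E8"
    and gram: "\<And>v z v' z'. (v, z) \<in> P \<Longrightarrow> (v', z') \<in> P \<Longrightarrow> z \<bullet> z' = of_int (B v v')"
    and "lattice_graph P v z" "lattice_graph P v' z'"
  shows "z \<bullet> z' = of_int (B v v')"
proof -
  have c: "z \<in> carrier_vec 8" if "lattice_graph P v z" for v z
    by (rule E8_carrier, rule lattice_graph_E8[OF that]) (rule E8)
  have base: "z \<bullet> z' = of_int (B v v')" if "lattice_graph P v' z'" "(v, z) \<in> P" for v z v' z'
    using that
  proof (induction rule: lattice_graph.induct)
    case (diff v1 z1 v2 z2)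
    then show ?case using c[OF lattice_graph.base[OF diff(5)]] c[OF diff(1)] c[OF diff(2)]
      by (simp add: ip8_simps B_simps)
  qed (use gram in auto)
  show ?thesis
    using assms(3,4)
  proof (induction rule: lattice_graph.induct)
    case (diff v1 z1 v2 z2)
    then show ?case using c[OF diff(1)] c[OF diff(2)] c[OF diff(5)]
      by (simp add: ip8_simps B_simps)
  qed (use base in auto)
qed

text \<open>Equality of two Gram matrices, with a factor 4 for doubled coordinates; by symmetry each
  pair is compared once.\<close>

fun matched :: "'v list \<Rightarrow> int list list \<Rightarrow> bool" where
  "matched [] [] \<longleftrightarrow> True"
| "matched (b # bs) (p # ps) \<longleftrightarrow> 4 * B b b = dotl p p \<and> list_all2 (\<lambda>b' p'. 4 * B b b' = dotl p p') bs ps \<and> matched bs ps"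
| "matched _ _ \<longleftrightarrow> False"

lemma matched_products:
  assumes "matched bs ps" "\<forall>p\<in>set ps. length p = 8" "(v, p) \<in> set (zip bs ps)" "(v', p') \<in> set (zip bs ps)"
  shows "half_vec p \<bullet> half_vec p' = of_int (B v v')"
  using assms
proof (induction bs ps rule: matched.induct)
  case (2 b bs p0 ps)
  have len: "length p = 8" "length p' = 8" using 2(3-5) by (auto dest: set_zip_rightD)
  have fact: "half_vec p0 \<bullet> half_vec q = of_int (B b w)" if "(w, q) \<in> set (zip bs ps)" "length q = 8" for w q
  proof -
    have "4 * B b w = dotl p0 q" using 2(2) that by (auto simp: list_all2_iff)
    then have "(4::real) * of_int (B b w) = of_int (dotl p0 q)" by (metis of_int_mult of_int_numeral)
    then show ?thesis using 2(3) that by (simp add: half_vec_scalar_prod)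
  qed
  have fact0: "half_vec p0 \<bullet> half_vec p0 = of_int (B b b)"
  proof -
    have "(4::real) * of_int (B b b) = of_int (dotl p0 p0)" using 2(2) by (metis matched.simps(2) of_int_mult of_int_numeral)
    then show ?thesis using 2(3) by (simp add: half_vec_scalar_prod)
  qed
  consider "v = b" "p = p0" "v' = b" "p' = p0" | "v = b" "p = p0" "(v', p') \<in> set (zip bs ps)" |
    "(v, p) \<in> set (zip bs ps)" "v' = b" "p' = p0" | "(v, p) \<in> set (zip bs ps)" "(v', p') \<in> set (zip bs ps)"
    using 2(4,5) by auto
  then show ?case
  proof cases
    case 3
    have "half_vec p \<bullet> half_vec p0 = half_vec p0 \<bullet> half_vec p"
      using len half_vec_carrier 3 by (intro comm_scalar_prod) auto
    then show ?thesis using fact[OF 3(1) len(1)] 3 B_sym by metis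
  qed (use 2 fact fact0 len in auto)
qed auto

definition covered :: "('v \<times> real vec) set \<Rightarrow> 'v \<Rightarrow> bool" where
  "covered P u \<longleftrightarrow> (\<exists>v z. lattice_graph P v z \<and> eqv u v)"

lemma eqv_refl: "eqv x x"
  by (simp add: eqv_iff)

lemma covered_subgroup: "eqv_subgroup (covered P)"
  unfolding eqv_subgroup_def covered_def eqv_iff
proof (intro conjI allI impI; elim exE conjE)
  fix x y v z v' z' assume "lattice_graph P v z" "\<forall>w. B x w = B v w" "lattice_graph P v' z'" "\<forall>w. B y w = B v' w"
  then show "\<exists>v z. lattice_graph P v z \<and> (\<forall>w. B (x - y) w = B v w)"
    by (intro exI[of _ "v - v'"] exI[of _ "z - z'"]) (simp add: lattice_graph.diff B_simps)
next
  fix x y v z assume "\<forall>z. B x z = B y z" "lattice_graph P v z" "\<forall>z. B y z = B v z"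
  then show "\<exists>v z. lattice_graph P v z \<and> (\<forall>z. B x z = B v z)" by auto
qed

lemma covered_base: "(v, z) \<in> P \<Longrightarrow> covered P v"
  unfolding covered_def using lattice_graph.base eqv_refl by blast

text \<open>The hypothesis \<open>cover\<close>, applied to the predicate \<open>covered\<close>,
  yields for each \<open>e i\<close> a partner that is an integral combination of model roots. It
  stays in \<open>E8\<close> and has the same products.\<close>

lemma realize_cover:
  fixes e :: "nat \<Rightarrow> 'v" and r :: 'v
  assumes e: "\<And>i. i < n \<Longrightarrow> nbr r (e i)"
    and m: "matched (r # bs) (r0l # ps)" and roots: "set ps \<subseteq> set root_lists"
    and cover: "\<And>C i. eqv_subgroup C \<Longrightarrow> \<forall>b\<in>set (r # bs). C b \<Longrightarrow> i < n \<Longrightarrow> C (e i)"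
  shows "\<exists>g :: nat \<Rightarrow> real vec. (\<forall>i<n. g i \<in> root_nbrs (half_vec r0l)) \<and>
    (\<forall>i<n. \<forall>j<n. g i \<bullet> g j = of_int (B (e i) (e j)))"
proof -
  let ?P = "set (zip (r # bs) (map half_vec (r0l # ps)))"
  have roots': "set (r0l # ps) \<subseteq> set root_lists" using roots std_in_root_lists by auto
  then have len8: "\<forall>p\<in>set (r0l # ps). length p = 8" using length_root_lists by auto
  have mem: "\<exists>p. z = half_vec p \<and> (v, p) \<in> set (zip (r # bs) (r0l # ps))" if "(v, z) \<in> ?P" for v z
    using that unfolding zip_map2 by auto
  have PE: "z \<in> E8" if "(v, z) \<in> ?P" for v z
    using mem[OF that] roots' E8_roots_eq by (auto dest!: set_zip_rightD simp: E8_roots_def)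
  have Pg: "z \<bullet> z' = of_int (B v v')" if vz: "(v, z) \<in> ?P" and vz': "(v', z') \<in> ?P" for v z v' z'
  proof -
    obtain p where p: "z = half_vec p" "(v, p) \<in> set (zip (r # bs) (r0l # ps))" using mem[OF vz] by blast
    obtain p' where p': "z' = half_vec p'" "(v', p') \<in> set (zip (r # bs) (r0l # ps))" using mem[OF vz'] by blast
    show ?thesis unfolding p(1) p'(1) by (rule matched_products[OF m len8 p(2) p'(2)])
  qed
  have rP: "(r, half_vec r0l) \<in> ?P" by simp
  have matched_length: "length xs = length ys" if "matched xs ys" for xs ys
    using that by (induction xs ys rule: matched.induct) auto
  have base: "\<forall>b\<in>set (r # bs). covered ?P b"
  proof
    fix b assume "b \<in> set (r # bs)"
    then obtain z where "(b, z) \<in> ?P"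
      using matched_length[OF m] by (metis in_set_impl_in_set_zip1 length_map)
    then show "covered ?P b" by (rule covered_base)
  qed
  have "\<exists>v z. lattice_graph ?P v z \<and> eqv (e i) v" if "i < n" for i
    using cover[OF covered_subgroup base that] by (simp only: covered_def)
  then obtain v g where vg: "\<And>i. i < n \<Longrightarrow> lattice_graph ?P (v i) (g i)" "\<And>i. i < n \<Longrightarrow> eqv (e i) (v i)" by metis
  have gram: "g i \<bullet> g j = of_int (B (e i) (e j))" if "i < n" "j < n" for i j
  proof -
    have "g i \<bullet> g j = of_int (B (v i) (v j))"
      by (rule lattice_graph_product[OF PE Pg vg(1)[OF that(1)] vg(1)[OF that(2)]])
    also have "B (v i) (v j) = B (e i) (e j)"
      using eqv_cong[OF vg(2)[OF that(1)]] eqv_cong[OF vg(2)[OF that(2)]] B_sym by metis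
    finally show ?thesis .
  qed
  have "g i \<in> root_nbrs (half_vec r0l)" if i: "i < n" for i
  proof -
    have "g i \<bullet> half_vec r0l = of_int (B (v i) r)"
      by (rule lattice_graph_product[OF PE Pg vg(1)[OF i] lattice_graph.base[OF rP]])
    also have "B (v i) r = 1" using eqv_cong[OF vg(2)[OF i]] nbrD(2)[OF e[OF i]] by metis
    finally have "g i \<bullet> half_vec r0l = 1" by simp
    moreover have "g i \<bullet> g i = 2" using gram[OF i i] nbrD(1)[OF e[OF i]] by simp
    moreover have "g i \<in> E8" using lattice_graph_E8[OF vg(1)[OF i] PE] .
    ultimately show ?thesis by (simp add: root_nbrs_def E8_roots_def)
  qed
  then show ?thesis using gram by blast
qed

end

text \<open>\<open>2 B - 1\<close> is twice the product of the projections orthogonal to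
  \<open>r\<close>, so \<open>dependent\<close> provides a linear relation among the projections of
  any eight of the given roots.\<close>

locale root_configuration = semidefinite_form B
  for B :: "'v::ab_group_add \<Rightarrow> 'v \<Rightarrow> int" +
  fixes r :: 'v and e :: "nat \<Rightarrow> 'v" and n :: nat
  assumes r: "B r r = 2"
    and e: "\<And>i. i < n \<Longrightarrow> nbr r (e i)"
    and distinct: "\<And>i j. i < n \<Longrightarrow> j < n \<Longrightarrow> i \<noteq> j \<Longrightarrow> B (e i) (e j) \<in> {0, 1}"
    and dependent: "\<And>J. J \<subseteq> {..<n} \<Longrightarrow> card J = 8 \<Longrightarrow>
      \<exists>c :: nat \<Rightarrow> real. (\<exists>j\<in>J. c j \<noteq> 0) \<and> (\<forall>i<n. (\<Sum>j\<in>J. c j * (2 * of_int (B (e i) (e j)) - 1)) = 0)"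
begin

text \<open>The rank bound concerns the given classes; these are the vectors for which it is
  available, in contrast to an arbitrary \<open>nbr\<close>.\<close>

definition indexed :: "'v \<Rightarrow> bool" where
  "indexed v \<longleftrightarrow> (\<exists>i<n. v = e i \<or> v = r - e i)"

lemma indexed_nbr: "indexed v \<Longrightarrow> nbr r v"
  using e nbr_compl[OF r] by (auto simp: indexed_def)

lemma B_r_nbr: "nbr r v \<Longrightarrow> B r v = 1"
  using nbrD(2) B_sym by metis

text \<open>Passing from \<open>e i\<close> to \<open>r - e i\<close> changes the sign of its row
  and column in \<open>2 B - 1\<close>, so a dependence is carried over with signs. Products 0 or 1
  ensure that eight different indices are involved.\<close>

lemma indexed_dependent:
  assumes len: "length bs = 8" and ix: "\<And>k. k < 8 \<Longrightarrow> indexed (bs ! k)"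
    and prod: "\<And>k l. k < 8 \<Longrightarrow> l < 8 \<Longrightarrow> k \<noteq> l \<Longrightarrow> B (bs ! k) (bs ! l) \<in> {0, 1}"
  shows "\<exists>d :: nat \<Rightarrow> real. (\<exists>k<8. d k \<noteq> 0) \<and> (\<forall>l<8. (\<Sum>k<8. d k * (2 * of_int (B (bs ! l) (bs ! k)) - 1)) = 0)"
proof -
  define i where "i k = (SOME i. i < n \<and> (bs ! k = e i \<or> bs ! k = r - e i))" for k
  define s where "s k = (if bs ! k = e (i k) then 1 else -1 :: real)" for k
  have i: "i k < n \<and> (bs ! k = e (i k) \<or> bs ! k = r - e (i k))" if "k < 8" for k
    using someI_ex[OF ix[OF that, unfolded indexed_def]] unfolding i_def .
  have s: "s k = 1 \<and> bs ! k = e (i k) \<or> s k = -1 \<and> bs ! k = r - e (i k)" if "k < 8" for k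
    using i[OF that] by (auto simp: s_def)
  from i have i: "i k < n" if "k < 8" for k using that by blast
  have inj: "inj_on i {..<8}"
  proof (rule inj_onI)
    fix k l assume kl: "k \<in> {..<8}" "l \<in> {..<8}" "i k = i l"
    then have n: "nbr r (e (i k))" using i e by auto
    show "k = l"
    proof (rule ccontr)
      assume "k \<noteq> l"
      then have "B (bs ! k) (bs ! l) \<in> {0, 1}" using prod kl by auto
      then show False
        using s[of k] s[of l] kl nbrD[OF n] B_r_nbr[OF n] r by (auto simp: B_simps)
    qed
  qed
  let ?J = "i ` {..<8}"
  have J: "?J \<subseteq> {..<n}" "card ?J = 8" using i card_image[OF inj] by auto
  obtain c :: "nat \<Rightarrow> real" where c: "\<exists>j\<in>?J. c j \<noteq> 0" "\<forall>l<n. (\<Sum>j\<in>?J. c j * (2 * of_int (B (e l) (e j)) - 1)) = 0"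
    using dependent[OF J] by blast
  let ?d = "\<lambda>k. s k * c (i k)"
  have sq: "s k * s k = 1" if "k < 8" for k using s[OF that] by auto
  have sgn: "2 * of_int (B (bs ! l) (bs ! k)) - 1 = s l * s k * (2 * of_int (B (e (i l)) (e (i k))) - 1)"
    if "k < 8" "l < 8" for k l
    using s[OF that(1)] s[OF that(2)] nbrD(2)[OF e[OF i[OF that(1)]]] nbrD(2)[OF e[OF i[OF that(2)]]] r
      B_r_nbr[OF e[OF i[OF that(1)]]]
    by (auto simp: B_simps)
  have "(\<Sum>k<8. ?d k * (2 * of_int (B (bs ! l) (bs ! k)) - 1)) = 0" if l: "l < 8" for l
  proof -
    have "(\<Sum>k<8. ?d k * (2 * of_int (B (bs ! l) (bs ! k)) - 1)) =
      (\<Sum>k<8. s l * (c (i k) * (2 * of_int (B (e (i l)) (e (i k))) - 1)))"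
    proof (rule sum.cong)
      fix k assume "k \<in> {..<8::nat}"
      then have k: "k < 8" by simp
      have "?d k * (2 * of_int (B (bs ! l) (bs ! k)) - 1) =
        (s k * s k) * (s l * (c (i k) * (2 * of_int (B (e (i l)) (e (i k))) - 1)))"
        unfolding sgn[OF k l] by (simp only: mult_ac)
      then show "?d k * (2 * of_int (B (bs ! l) (bs ! k)) - 1) = s l * (c (i k) * (2 * of_int (B (e (i l)) (e (i k))) - 1))"
        unfolding sq[OF k] by simp
    qed simp
    also have "\<dots> = s l * (\<Sum>j\<in>?J. c j * (2 * of_int (B (e (i l)) (e j)) - 1))"
      by (simp add: sum_distrib_left sum.reindex[OF inj])
    also have "\<dots> = 0" using c(2) i[OF l] by simp
    finally show ?thesis .
  qed
  moreover have "\<exists>k<8. ?d k \<noteq> 0"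
  proof -
    obtain k where "k < 8" "c (i k) \<noteq> 0" using c(1) by auto
    then show ?thesis using sq[of k] by (intro exI[of _ k]) auto
  qed
  ultimately show ?thesis by (intro exI[of _ ?d] conjI allI impI) auto
qed

lemma sum_lessThan8: "(\<Sum>k<8::nat. f k) = f 0 + f 1 + f 2 + f 3 + f 4 + f 5 + f 6 + (f 7 :: real)"
  by (simp add: eval_nat_numeral)

lemma less8_cases: "(k::nat) < 8 \<longleftrightarrow> k \<in> {0, 1, 2, 3, 4, 5, 6, 7}"
  by auto

text \<open>For a clique the matrix \<open>2 B - 1\<close> is \<open>J + 2I\<close>, which is
  nonsingular.\<close>

lemma no_clique_of_8:
  assumes len: "length bs = 8" and ix: "\<And>k. k < 8 \<Longrightarrow> indexed (bs ! k)"
    and prod: "\<And>k l. k < 8 \<Longrightarrow> l < 8 \<Longrightarrow> k \<noteq> l \<Longrightarrow> B (bs ! k) (bs ! l) = 1"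
  shows False
proof -
  obtain d :: "nat \<Rightarrow> real" where d: "\<exists>k<8. d k \<noteq> 0"
    "\<And>l. l < 8 \<Longrightarrow> (\<Sum>k<8. d k * (2 * of_int (B (bs ! l) (bs ! k)) - 1)) = 0"
    using indexed_dependent[OF len ix] prod by auto
  have "(\<Sum>k<8. d k) + 2 * d l = 0" if l: "l < 8" for l
  proof -
    have "(\<Sum>k<8. d k * (2 * of_int (B (bs ! l) (bs ! k)) - 1)) = (\<Sum>k<8. d k + (if k = l then 2 * d k else 0))"
    proof (rule sum.cong)
      fix k assume "k \<in> {..<8::nat}"
      then show "d k * (2 * of_int (B (bs ! l) (bs ! k)) - 1) = d k + (if k = l then 2 * d k else 0)"
        using prod[OF l, of k] nbrD(1)[OF indexed_nbr[OF ix[OF l]]] by auto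
    qed simp
    also have "\<dots> = (\<Sum>k<8. d k) + 2 * d l" using l by (simp add: sum.distrib)
    finally show ?thesis using d(2)[OF l] by simp
  qed
  from this[of 0] this[of 1] this[of 2] this[of 3] this[of 4] this[of 5] this[of 6] this[of 7]
  have "d 0 = 0 \<and> d 1 = 0 \<and> d 2 = 0 \<and> d 3 = 0 \<and> d 4 = 0 \<and> d 5 = 0 \<and> d 6 = 0 \<and> d 7 = 0"
    unfolding sum_lessThan8 by simp
  then show False using d(1) by (auto simp: less8_cases)
qed

text \<open>The five differences \<open>2x - t1 - t2\<close> have norm 4, are pairwise orthogonal
  and orthogonal to \<open>r\<close> and the triple; with the three independent projections of the
  triple this makes rank 8. The proof solves the eight linear equations directly.\<close>

lemma no_pillar_of_5:
  assumes t: "indexed t1" "indexed t2" "indexed t3" "B t1 t2 = 0" "B t1 t3 = 0" "B t2 t3 = 0"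
    and x: "\<And>x. x \<in> {x1, x2, x3, x4, x5} \<Longrightarrow> indexed x \<and> B x t1 = 1 \<and> B x t2 = 1 \<and> B x t3 = 0"
    and pair: "sorted_wrt (\<lambda>x y. B x y = 1) [x1, x2, x3, x4, x5]"
  shows False
proof -
  let ?bs = "[t1, t2, t3, x1, x2, x3, x4, x5]"
  note n = t(1-3)[THEN indexed_nbr]
  have x': "indexed x1" "indexed x2" "indexed x3" "indexed x4" "indexed x5" using x by auto
  have px: "B x1 t1 = 1" "B x1 t2 = 1" "B x1 t3 = 0" "B x2 t1 = 1" "B x2 t2 = 1" "B x2 t3 = 0"
    "B x3 t1 = 1" "B x3 t2 = 1" "B x3 t3 = 0" "B x4 t1 = 1" "B x4 t2 = 1" "B x4 t3 = 0"
    "B x5 t1 = 1" "B x5 t2 = 1" "B x5 t3 = 0" using x by auto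
  have pp: "B x1 x2 = 1" "B x1 x3 = 1" "B x1 x4 = 1" "B x1 x5 = 1" "B x2 x3 = 1" "B x2 x4 = 1" "B x2 x5 = 1"
    "B x3 x4 = 1" "B x3 x5 = 1" "B x4 x5 = 1" using pair by auto
  note diag = n[THEN nbrD(1)] x'[THEN indexed_nbr, THEN nbrD(1)]
  note g = t(4-6) px pp
  note g' = g g[THEN trans[OF B_sym]] diag
  have ix: "indexed (?bs ! k)" if "k < 8" for k using that t x' unfolding less8_cases by auto
  have "B (?bs ! k) (?bs ! l) \<in> {0, 1}" if "k < 8" "l < 8" "k \<noteq> l" for k l
    using that unfolding less8_cases by (auto simp: g')
  then obtain d :: "nat \<Rightarrow> real" where d: "\<exists>k<8. d k \<noteq> 0"
    "\<And>l. l < 8 \<Longrightarrow> (\<Sum>k<8. d k * (2 * of_int (B (?bs ! l) (?bs ! k)) - 1)) = 0"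
    using indexed_dependent[of ?bs] ix by auto
  from d(2)[of 0] d(2)[of 1] d(2)[of 2] d(2)[of 3] d(2)[of 4] d(2)[of 5] d(2)[of 6] d(2)[of 7]
  have "d 0 = 0 \<and> d 1 = 0 \<and> d 2 = 0 \<and> d 3 = 0 \<and> d 4 = 0 \<and> d 5 = 0 \<and> d 6 = 0 \<and> d 7 = 0"
    unfolding sum_lessThan8 by (simp add: g')
  then show False using d(1) by (auto simp: less8_cases)
qed

definition embeddable :: bool where
  "embeddable \<longleftrightarrow> (\<exists>g :: nat \<Rightarrow> real vec. (\<forall>i<n. g i \<in> root_nbrs (half_vec r0l)) \<and>
    (\<forall>i<n. \<forall>j<n. g i \<bullet> g j = of_int (B (e i) (e j))))"

lemma embeddableI:
  assumes "matched (r # bs) (r0l # ps)" "set ps \<subseteq> set root_lists"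
    and "\<And>C i. eqv_subgroup C \<Longrightarrow> \<forall>b\<in>set (r # bs). C b \<Longrightarrow> i < n \<Longrightarrow> C (e i)"
  shows embeddable
  unfolding embeddable_def
proof (rule realize_cover[where e = e and n = n and r = r and bs = bs and ps = ps, OF e assms(1,2)])
  fix C i assume "eqv_subgroup C" "\<forall>b\<in>set (r # bs). C b" "i < n"
  then show "C (e i)" using assms(3)[of C i] by blast
qed

lemma embeddable_two_pillars:
  assumes u: "nbr r u1" "nbr r u2" "nbr r u3" "B u1 u2 = 0" "B u1 u3 = 0" "B u2 u3 = 0"
    and x: "nbr r x" "B x u1 = 1" "B x u2 = 1" "B x u3 = 0"
    and y: "nbr r y" "B y u1 = 1" "B y u2 = 0" "B y u3 = 1"
  shows embeddable
proof -
  note gram' = u(4-6) x(2-4) y(2-4) r nbrD(1)[OF u(1)] nbrD(1)[OF u(2)] nbrD(1)[OF u(3)] nbrD(1)[OF x(1)]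
    nbrD(1)[OF y(1)] nbrD(2)[OF u(1)] nbrD(2)[OF u(2)] nbrD(2)[OF u(3)] nbrD(2)[OF x(1)] nbrD(2)[OF y(1)]
  note gram = gram' gram'[THEN trans[OF B_sym]]
  have main: embeddable if y: "nbr r y" "B y u1 = 1" "B y u2 = 0" "B y u3 = 1" "B x y = 1" for y
  proof -
    obtain fs where fs: "length fs \<le> 3" "sorted_wrt (\<lambda>e f. B e f = 1) fs"
      and F: "\<forall>f\<in>set fs. nbr r f \<and> B f u1 = 1 \<and> B f u2 = 1 \<and> B f u3 = 0 \<and> B f x = 1 \<and> B f y = 1"
      and cover: "\<And>C u. eqv_subgroup C \<Longrightarrow> \<forall>b\<in>set ([r, u1, u2, u3, x, y] @ fs). C b \<Longrightarrow> nbr r u \<Longrightarrow> C u"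
      using cover_two_pillars[OF r u x y] by blast
    note gy' = y(2-5) nbrD(1)[OF y(1)] nbrD(2)[OF y(1)]
    note gy = gy' gy'[THEN trans[OF B_sym]]
    have F': "4 * B f f = 8 \<and> 4 * B r f = 4 \<and> 4 * B u1 f = 4 \<and> 4 * B u2 f = 4 \<and> 4 * B u3 f = 0 \<and> 4 * B x f = 4 \<and> 4 * B y f = 4"
      if "f \<in> set fs" for f
      using F that nbrD[of r f] B_sym[of r f] B_sym[of u1 f] B_sym[of u2 f] B_sym[of u3 f] B_sym[of x f] B_sym[of y f]
      by auto
    \<comment> \<open>\<open>b3l\<close> and \<open>b7l\<close> are the models of \<open>x\<close>
      and \<open>y\<close>; \<open>b4l\<close>, \<open>b5l\<close>, \<open>b6l\<close> have the
      products required of up to three members of \<open>fs\<close>.\<close>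
    let ?ps = "[a1l, a2l, a3l, b3l, b7l] @ take (length fs) [b4l, b5l, b6l]"
    have "matched (r # ([u1, u2, u3, x, y] @ fs)) (r0l # ?ps)"
    proof -
      consider "fs = []" | f1 where "fs = [f1]" | f1 f2 where "fs = [f1, f2]" | f1 f2 f3 where "fs = [f1, f2, f3]"
        using fs(1) by (cases fs; cases "tl fs"; cases "tl (tl fs)"; cases "tl (tl (tl fs))") auto
      then show ?thesis
        by cases (use fs(2) F' in \<open>simp_all add: gram gy, simp_all add: list_defs\<close>)
    qed
    moreover have "set ?ps \<subseteq> set root_lists"
      using std_in_root_lists set_take_subset[of "length fs" "[b4l, b5l, b6l]"] by auto
    ultimately show ?thesis
      by (rule embeddableI) (use cover e in auto)
  qed
  have "\<not> eqv x y"
  proof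
    assume "eqv x y" from eqv_cong[OF this, of u2] show False using x y by simp
  qed
  moreover have "\<not> eqv x (r - y)"
  proof
    assume "eqv x (r - y)" from eqv_cong[OF this, of u1] show False by (simp add: gram B_simps)
  qed
  ultimately consider "B x y = 1" | "B x y = 0" using nbr_cases[OF r x(1) y(1)] by blast
  then show ?thesis
  proof cases
    case 1
    then show ?thesis using main y by blast
  next
    case 2
    \<comment> \<open>The antipode \<open>u1 + u3 - y\<close> lies in the same pillar as
      \<open>y\<close> and has product 1 with \<open>x\<close>.\<close>
    show ?thesis
      by (rule main[of "u1 + u3 - y"]) (use 2 in \<open>simp_all add: nbr_def B_simps gram\<close>)
  qed
qed

lemma embeddable_one_pillar:
  assumes t: "indexed t1" "indexed t2" "indexed t3" "B t1 t2 = 0" "B t1 t3 = 0" "B t2 t3 = 0"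
    and pattern: "\<And>i. i < n \<Longrightarrow> \<exists>v\<in>{e i, r - e i}. v \<in> {t1, t2, t3} \<or> B v t1 = 1 \<and> B v t2 = 1 \<and> (B v t3 = 0 \<or> B v t3 = 1)"
  shows embeddable
proof -
  note nt = t(1-3)[THEN indexed_nbr]
  note gram' = t(4-6) r nt[THEN nbrD(1)] nt[THEN nbrD(2)]
  note gram = gram' gram'[THEN trans[OF B_sym]]
  let ?F = "{x. indexed x \<and> B x t1 = 1 \<and> B x t2 = 1 \<and> B x t3 = 0}"
  have bound: "length fs \<le> 4" if fs: "set fs \<subseteq> ?F" "sorted_wrt (\<lambda>x y. B x y = 1) fs" for fs
  proof (rule ccontr)
    assume "\<not> length fs \<le> 4"
    then obtain x1 x2 x3 x4 x5 gs where g: "fs = x1 # x2 # x3 # x4 # x5 # gs"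
      by (cases fs; cases "tl fs"; cases "tl (tl fs)"; cases "tl (tl (tl fs))"; cases "tl (tl (tl (tl fs)))") auto
    show False
      by (rule no_pillar_of_5[OF t, of x1 x2 x3 x4 x5]) (use fs g in auto)
  qed
  obtain fs where fs: "set fs \<subseteq> ?F" "sorted_wrt (\<lambda>x y. B x y = 1) fs" "length fs \<le> 4"
    and max: "\<And>x. x \<in> ?F \<Longrightarrow> \<exists>f\<in>set fs. B x f \<noteq> 1"
    using exists_maximal_list[OF r, of ?F "\<lambda>x y. B x y = 1" 4] bound by blast
  have F': "4 * B f f = 8 \<and> 4 * B r f = 4 \<and> 4 * B t1 f = 4 \<and> 4 * B t2 f = 4 \<and> 4 * B t3 f = 0" if "f \<in> set fs" for f
  proof -
    have "f \<in> ?F" using fs that by auto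
    then show ?thesis
      using nbrD[OF indexed_nbr, of f] B_r_nbr[OF indexed_nbr, of f] B_sym[of t1 f] B_sym[of t2 f] B_sym[of t3 f]
      by auto
  qed
  \<comment> \<open>\<open>b3l\<close> to \<open>b6l\<close> represent the four orthogonal pairs of
    the pillar named by \<open>a2l\<close>.\<close>
  let ?ps = "[a1l, a2l, a3l] @ take (length fs) [b3l, b4l, b5l, b6l]"
  have "matched (r # ([t1, t2, t3] @ fs)) (r0l # ?ps)"
  proof -
    consider "fs = []" | f1 where "fs = [f1]" | f1 f2 where "fs = [f1, f2]" | f1 f2 f3 where "fs = [f1, f2, f3]"
      | f1 f2 f3 f4 where "fs = [f1, f2, f3, f4]"
      using fs(3) by (cases fs; cases "tl fs"; cases "tl (tl fs)"; cases "tl (tl (tl fs))"; cases "tl (tl (tl (tl fs)))") auto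
    then show ?thesis
      by cases (use fs(2) F' in \<open>simp_all add: gram, simp_all add: list_defs\<close>)
  qed
  moreover have "set ?ps \<subseteq> set root_lists"
    using std_in_root_lists set_take_subset[of "length fs" "[b3l, b4l, b5l, b6l]"] by auto
  ultimately show ?thesis
  proof (rule embeddableI)
    fix C i assume C: "eqv_subgroup C" and base: "\<forall>b\<in>set (r # ([t1, t2, t3] @ fs)). C b" and i: "i < n"
    note Cd = eqv_subgroup_diff[OF C] and Ca = eqv_subgroup_add[OF C] and Ce = eqv_subgroup_eqv[OF C]
    have Cr: "C r" and Ct: "C t1" "C t2" "C t3" using base by auto
    obtain v where v: "v = e i \<or> v = r - e i"
      and pv: "v \<in> {t1, t2, t3} \<or> B v t1 = 1 \<and> B v t2 = 1 \<and> (B v t3 = 0 \<or> B v t3 = 1)"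
      using pattern[OF i] by blast
    have iv: "indexed v" using v i by (auto simp: indexed_def)
    note nv = indexed_nbr[OF iv]
    note gv' = nbrD[OF nv]
    have "C v"
    proof -
      consider "v \<in> {t1, t2, t3}" | (p1) "B v t1 = 1" "B v t2 = 1" "B v t3 = 0" | (p2) "B v t1 = 1" "B v t2 = 1" "B v t3 = 1"
        using pv by blast
      then show ?thesis
      proof cases
        case 1
        then show ?thesis using Ct by auto
      next
        case p2
        note gv = gv' p2 gv'[THEN trans[OF B_sym]] p2[THEN trans[OF B_sym]]
        have "eqv v (t1 + t2 + t3 - r)" by (simp add: eqv_def B_simps gram gv)
        then show ?thesis using Ce Cd[OF Ca[OF Ca[OF Ct(1,2)] Ct(3)] Cr] by blast
      next
        case p1
        note gv = gv' p1 gv'[THEN trans[OF B_sym]] p1[THEN trans[OF B_sym]]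
        obtain f where f: "f \<in> set fs" "B v f \<noteq> 1" using max[of v] iv p1 by blast
        then have fF: "f \<in> ?F" using fs by auto
        then have nf: "nbr r f" using indexed_nbr by auto
        have Cf: "C f" using base f by simp
        have pf: "B f t1 = 1" "B f t2 = 1" "B f t3 = 0" using fF by auto
        note gf = nbrD[OF nf] pf nbrD[OF nf, THEN trans[OF B_sym]] pf[THEN trans[OF B_sym]]
        have "\<not> eqv v (r - f)"
        proof
          assume "eqv v (r - f)" from eqv_cong[OF this, of t1] show False by (simp add: gv gf gram B_simps)
        qed
        then consider "eqv v f" | "B v f = 0" using nbr_cases[OF r nv nf] f(2) by blast
        then show ?thesis
        proof cases
          case 1
          then show ?thesis using Ce Cf by blast
        next
          case 2
          \<comment> \<open>Two orthogonal members of a pillar are antipodes modulo the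
            radical.\<close>
          have "eqv v (t1 + t2 - f)" using 2 B_sym[of f v] by (simp add: eqv_def B_simps gram gv gf)
          then show ?thesis using Ce Cd[OF Ca[OF Ct(1,2)] Cf] by blast
        qed
      qed
    qed
    then show "C (e i)" using v Cd[OF Cr, of v] by auto
  qed
qed

end

context root_configuration
begin

lemma indexed_products:
  assumes "indexed v" "indexed u"
  shows "v = u \<or> v = r - u \<or> B v u \<in> {0, 1}"
proof -
  obtain i j where i: "i < n" "v = e i \<or> v = r - e i" and j: "j < n" "u = e j \<or> u = r - e j"
    using assms unfolding indexed_def by blast
  show ?thesis
  proof (cases "i = j")
    case True
    then show ?thesis using i j by auto
  next
    case False
    then show ?thesis
      using distinct[OF i(1) j(1)] i(2) j(2) nbrD[OF e[OF i(1)]] nbrD[OF e[OF j(1)]]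
        B_r_nbr[OF e[OF i(1)]] B_r_nbr[OF e[OF j(1)]] r
      by (auto simp: B_simps)
  qed
qed

lemma indexed_compl: "indexed v \<Longrightarrow> indexed (r - v)"
  by (auto simp: indexed_def)

text \<open>The case distinction ranges over all triples in the form, because the fourth root
  \<open>?u4\<close> may lie outside the given classes. Exchanging it into the triple brings every
  pair of occupied pillars into the one pattern of \<open>embeddable_two_pillars\<close>.\<close>

lemma embeddable_triple:
  assumes u: "indexed u1" "indexed u2" "indexed u3" "B u1 u2 = 0" "B u1 u3 = 0" "B u2 u3 = 0"
  shows embeddable
proof (cases "\<exists>w1 w2 w3 x y. nbr r w1 \<and> nbr r w2 \<and> nbr r w3 \<and> B w1 w2 = 0 \<and> B w1 w3 = 0 \<and> B w2 w3 = 0 \<and>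
    nbr r x \<and> B x w1 = 1 \<and> B x w2 = 1 \<and> B x w3 = 0 \<and> nbr r y \<and> B y w1 = 1 \<and> B y w2 = 0 \<and> B y w3 = 1")
  case True
  then show ?thesis using embeddable_two_pillars by blast
next
  case False
  note nu = u(1-3)[THEN indexed_nbr]
  note gram' = u(4-6) r nu[THEN nbrD(1)] nu[THEN nbrD(2)]
  note gram = gram' gram'[THEN trans[OF B_sym]]
  let ?u4 = "r + r - u1 - u2 - u3"
  have u4: "nbr r ?u4" "B u1 ?u4 = 0" "B u2 ?u4 = 0" "B u3 ?u4 = 0" by (simp_all add: nbr_def B_simps gram)
  define pat where "pat c d v \<longleftrightarrow> nbr r v \<and> B v u1 = 1 \<and> B v u2 = c \<and> B v u3 = d" for c d v
  have no: "\<not> (pat 1 0 v \<and> pat 0 1 w)" "\<not> (pat 1 0 v \<and> pat 0 0 w)" "\<not> (pat 0 1 v \<and> pat 0 0 w)" for v w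
  proof -
    show "\<not> (pat 1 0 v \<and> pat 0 1 w)"
      using False nu u(4-6) unfolding pat_def by blast
    have p4: "B v ?u4 = 2 - B v u1 - B v u2 - B v u3" if "nbr r v" for v
      using nbrD[OF that] by (simp add: B_simps)
    show "\<not> (pat 1 0 v \<and> pat 0 0 w)"
    proof
      assume a: "pat 1 0 v \<and> pat 0 0 w"
      then have "B v ?u4 = 0" "B w ?u4 = 1" using p4 by (auto simp: pat_def)
      then show False using False nu u(4) u4 a unfolding pat_def by blast
    qed
    show "\<not> (pat 0 1 v \<and> pat 0 0 w)"
    proof
      assume a: "pat 0 1 v \<and> pat 0 0 w"
      then have "B v ?u4 = 0" "B w ?u4 = 1" using p4 by (auto simp: pat_def)
      then show False using False nu u(5) u4 a unfolding pat_def by blast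
    qed
  qed
  have cases: "\<exists>v\<in>{e i, r - e i}. v \<in> {u1, u2, u3} \<or> pat 1 1 v \<or> pat 1 0 v \<or> pat 0 1 v \<or> pat 0 0 v" if i: "i < n" for i
  proof -
    have ie: "indexed (e i)" using i by (auto simp: indexed_def)
    have bits: "e i \<in> {u1, u2, u3} \<or> r - e i \<in> {u1, u2, u3} \<or>
      B (e i) u1 \<in> {0, 1} \<and> B (e i) u2 \<in> {0, 1} \<and> B (e i) u3 \<in> {0, 1}"
      using indexed_products[OF ie u(1)] indexed_products[OF ie u(2)] indexed_products[OF ie u(3)] by auto
    have ru: "B r u1 = 1" "B r u2 = 1" "B r u3 = 1" by (simp_all add: gram)
    show ?thesis
    proof (cases "B (e i) u1 = 1")
      case True
      then show ?thesis using bits e[OF i] unfolding pat_def by auto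
    next
      case False
      have "nbr r (r - e i)" using nbr_compl[OF r e[OF i]] .
      then show ?thesis using bits False ru unfolding pat_def by (auto simp: B_diff)
    qed
  qed
  consider (a) v where "pat 1 0 v" | (b) v where "\<And>v. \<not> pat 1 0 v" "pat 0 1 v" | (c) "\<And>v. \<not> pat 1 0 v" "\<And>v. \<not> pat 0 1 v"
    by blast
  then show ?thesis
  proof cases
    case a
    have n: "\<not> pat 0 1 w" "\<not> pat 0 0 w" for w using no a by blast+
    have "\<exists>v\<in>{e i, r - e i}. v \<in> {u1, u2, u3} \<or> B v u1 = 1 \<and> B v u2 = 1 \<and> (B v u3 = 0 \<or> B v u3 = 1)" if i: "i < n" for i
      using cases[OF i] n unfolding pat_def by blast
    then show ?thesis by (rule embeddable_one_pillar[OF u])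
  next
    case b
    have n: "\<not> pat 1 0 w" "\<not> pat 0 0 w" for w using no b by blast+
    have p: "\<exists>v\<in>{e i, r - e i}. v \<in> {u1, u3, u2} \<or> B v u1 = 1 \<and> B v u3 = 1 \<and> (B v u2 = 0 \<or> B v u2 = 1)" if i: "i < n" for i
      using cases[OF i] n unfolding pat_def by blast
    have "B u3 u2 = 0" by (simp add: gram)
    then show ?thesis by (rule embeddable_one_pillar[OF u(1,3,2,5,4)]) (rule p)
  next
    case c
    have "\<exists>v\<in>{e i, r - e i}. v \<in> {u2, u3, u1} \<or> B v u2 = 1 \<and> B v u3 = 1 \<and> (B v u1 = 0 \<or> B v u1 = 1)" if i: "i < n" for i
    proof -
      obtain v where v: "v \<in> {e i, r - e i}" "v \<in> {u1, u2, u3} \<or> pat 1 1 v \<or> pat 0 0 v"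
        using cases[OF i] c by blast
      show ?thesis
      proof (cases "pat 0 0 v")
        case True
        \<comment> \<open>The complement of a root in the fourth pillar lies in the pillar that
          \<open>u2\<close> and \<open>u3\<close> determine.\<close>
        have "r - v \<in> {e i, r - e i}" using v(1) by auto
        moreover have "B (r - v) u2 = 1" "B (r - v) u3 = 1" "B (r - v) u1 = 0"
          using True gram by (auto simp: pat_def B_diff)
        ultimately show ?thesis by blast
      next
        case False
        then show ?thesis using v unfolding pat_def by blast
      qed
    qed
    note p = this
    have "B u2 u1 = 0" "B u3 u1 = 0" by (simp_all add: gram)
    then show ?thesis by (rule embeddable_one_pillar[OF u(2,3,1,6)]) (rule p)
  qed
qed

lemma matched_clique:
  assumes "length us = length ps" "sorted_wrt (\<lambda>x y. B x y = 1) us" "\<forall>u\<in>set us. B u u = 2"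
    "sorted_wrt (\<lambda>p q. dotl p q = 4) ps" "\<forall>p\<in>set ps. dotl p p = 8"
  shows "matched us ps"
  using assms by (induction us ps rule: list_induct2) (auto simp: list_all2_conv_all_nth)

text \<open>Flipping to product 1 with \<open>e 0\<close> yields a clique. The rank admits at most
  seven roots in it, and the standard clique has seven.\<close>

lemma embeddable_clique:
  assumes no: "\<And>u1 u2 u3. \<lbrakk>indexed u1; indexed u2; indexed u3; B u1 u2 = 0; B u1 u3 = 0\<rbrakk> \<Longrightarrow> B u2 u3 \<noteq> 0"
  shows embeddable
proof -
  define f where "f i = (if i = 0 \<or> B (e i) (e 0) = 1 then e i else r - e i)" for i
  have fi: "indexed (f i)" if "i < n" for i using that by (auto simp: f_def indexed_def)
  have f0: "B (f i) (f 0) = 1" if i: "i < n" "i \<noteq> 0" for i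
  proof -
    have "0 < n" using i by simp
    then show ?thesis
      using distinct[OF i(1) _ i(2)] nbrD[OF e[of 0]] B_r_nbr[OF e[of 0]] i by (auto simp: f_def B_simps)
  qed
  have fp: "B (f i) (f j) = 1" if ij: "i < n" "j < n" "i \<noteq> j" for i j
  proof -
    have n0: "0 < n" using ij by simp
    have "B (e i) (e j) \<in> {0, 1}" using distinct ij by blast
    then have "B (f i) (f j) \<in> {0, 1}"
      using nbrD[OF e[OF ij(1)]] nbrD[OF e[OF ij(2)]] B_r_nbr[OF e[OF ij(1)]] B_r_nbr[OF e[OF ij(2)]] r
      by (auto simp: f_def B_simps)
    moreover have "B (f i) (f j) \<noteq> 0"
    proof (cases "i = 0 \<or> j = 0")
      case True
      then show ?thesis using f0 ij B_sym[of "f 0"] by force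
    next
      case False
      \<comment> \<open>If \<open>f i\<close> and \<open>f j\<close> were orthogonal, they would
        form a triple with \<open>r - f 0\<close>.\<close>
      have "B (r - f 0) (f i) = 0" "B (r - f 0) (f j) = 0"
        using f0[OF ij(1)] f0[OF ij(2)] False B_sym[of "f 0" "f i"] B_sym[of "f 0" "f j"]
          B_r_nbr[OF indexed_nbr[OF fi[OF ij(1)]]] B_r_nbr[OF indexed_nbr[OF fi[OF ij(2)]]] by (auto simp: B_diff)
      then show ?thesis using no[OF indexed_compl[OF fi[OF n0]] fi[OF ij(1)] fi[OF ij(2)]] by blast
    qed
    ultimately show ?thesis by auto
  qed
  have n7: "n \<le> 7"
  proof (rule ccontr)
    assume "\<not> n \<le> 7"
    then show False
      using fi fp by (intro no_clique_of_8[of "map f [0..<8]"]) auto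
  qed
  let ?us = "map f [0..<n]" and ?cl = "[a1l, b2l, b3l, b4l, b5l, b6l, b7l]"
  have "matched ?us (take n ?cl)"
  proof (rule matched_clique)
    show "sorted_wrt (\<lambda>x y. B x y = 1) ?us"
      using fp by (auto simp: sorted_wrt_iff_nth_less)
    show "sorted_wrt (\<lambda>p q. dotl p q = 4) (take n ?cl)"
      by (rule sorted_wrt_take) (simp add: list_defs)
    show "\<forall>p\<in>set (take n ?cl). dotl p p = 8"
      by (rule ballI, drule in_set_takeD) (auto simp: list_defs)
  qed (use n7 fi nbrD(1)[OF indexed_nbr] in auto)
  moreover have "list_all2 (\<lambda>b p. 4 * B r b = dotl r0l p) ?us (take n ?cl)"
  proof -
    have "dotl r0l p = 4" if "p \<in> set (take n ?cl)" for p
      using in_set_takeD[OF that] by (auto simp: list_defs)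
    moreover have "take n ?cl ! i \<in> set (take n ?cl)" if "i < n" for i
      using n7 that by (intro nth_mem) simp
    ultimately have "dotl r0l (take n ?cl ! i) = 4" if "i < n" for i using that by blast
    then show ?thesis
      using n7 B_r_nbr[OF indexed_nbr[OF fi]] by (auto simp: list_all2_conv_all_nth simp del: nth_take)
  qed
  ultimately have "matched (r # ?us) (r0l # take n ?cl)"
    using r by (simp add: list_defs)
  moreover have "set (take n ?cl) \<subseteq> set root_lists"
    using std_in_root_lists set_take_subset[of n ?cl] by auto
  ultimately show ?thesis
  proof (rule embeddableI)
    fix C i assume C: "eqv_subgroup C" and base: "\<forall>b\<in>set (r # ?us). C b" and i: "i < n"
    have "C r" "C (f i)" using base i by auto
    then show "C (e i)" using eqv_subgroup_diff[OF C, of r "f i"] by (auto simp: f_def split: if_splits)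
  qed
qed

theorem configuration_embeddable: embeddable
  using embeddable_triple embeddable_clique by blast

end

section \<open>From a Seidel matrix to a configuration of roots\<close>

definition seidel_form :: "real mat \<Rightarrow> nat \<Rightarrow> nat \<Rightarrow> nat \<Rightarrow> int" where
  "seidel_form S n i j = (if i < n \<and> j < n then (if i = j then 2 else if S $$ (i, j) = -1 then 1 else 0)
     else if i < n \<or> j < n then 1 else 2)"

text \<open>The formal integral lattice spanned by \<open>n\<close> roots and \<open>r\<close> is modelled by \<^typ>\<open>int poly\<close>, used
  only as the free abelian group on the monomials; the monomial of degree \<open>n\<close> stands for \<open>r\<close>.\<close>

definition poly_form :: "real mat \<Rightarrow> nat \<Rightarrow> int poly \<Rightarrow> int poly \<Rightarrow> int" where
  "poly_form S n p q = (\<Sum>i<Suc n. \<Sum>j<Suc n. coeff p i * coeff q j * seidel_form S n i j)"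

lemma poly_form_monom:
  assumes "i \<le> n" "j \<le> n"
  shows "poly_form S n (monom 1 i) (monom 1 j) = seidel_form S n i j"
proof -
  have "poly_form S n (monom 1 i) (monom 1 j) = (\<Sum>k<Suc n. \<Sum>l<Suc n. if k = i then (if l = j then seidel_form S n k l else 0) else 0)"
    unfolding poly_form_def by (intro sum.cong refl) auto
  also have "\<dots> = (\<Sum>k<Suc n. if k = i then (\<Sum>l<Suc n. if l = j then seidel_form S n k l else 0) else 0)"
    by (intro sum.cong refl) auto
  also have "\<dots> = seidel_form S n i j"
    using assms by (simp del: sum.lessThan_Suc add: sum.delta less_Suc_eq_le)
  finally show ?thesis .
qed

text \<open>Splitting off the component along \<open>r\<close> gives positivity: twice the norm of
  \<open>x\<close> is the quadratic form of \<open>3I - S\<close> at the first \<open>n\<close>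
  coefficients plus the square of the product of \<open>x\<close> with \<open>r\<close>.\<close>

lemma Omega_configuration:
  assumes S: "S \<in> Omega n"
  shows "root_configuration (poly_form S n) (monom 1 n) (\<lambda>i. monom 1 i) n"
proof -
  have Sm: "S \<in> seidel_mats n" using S by (simp add: Omega_def)
  then have Sc: "S \<in> carrier_mat n n" and ST: "S\<^sup>T = S"
    and entries: "\<And>i j. i < n \<Longrightarrow> j < n \<Longrightarrow> i \<noteq> j \<Longrightarrow> S $$ (i, j) = 1 \<or> S $$ (i, j) = -1"
    by (auto simp: seidel_mats_def)
  have sym: "S $$ (i, j) = S $$ (j, i)" if "i < n" "j < n" for i j
    using that Sc ST by (metis carrier_matD index_transpose_mat(1))
  have fsym: "seidel_form S n i j = seidel_form S n j i" for i j
    using sym by (auto simp: seidel_form_def)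
  have gram: "2 * of_int (seidel_form S n i j) = gram_of_seidel S i j + 1" if "i < n" "j < n" for i j
    using that entries[OF that] by (auto simp: seidel_form_def gram_of_seidel_def)
  interpret semidefinite_form "poly_form S n"
  proof
    fix x y z :: "int poly"
    show "poly_form S n x y = poly_form S n y x"
      unfolding poly_form_def by (subst sum.swap) (simp only: mult.commute fsym mult.left_commute)
    show "poly_form S n (x + y) z = poly_form S n x z + poly_form S n y z"
      unfolding poly_form_def by (simp only: coeff_add distrib_right sum.distrib)
    let ?x = "\<lambda>i. of_int (coeff x i) :: real"
    have edge: "seidel_form S n i n = 1" "seidel_form S n n i = 1" if "i < n" for i
      using that by (auto simp: seidel_form_def)
    have corner: "seidel_form S n n n = 2" by (simp add: seidel_form_def)
    have "2 * of_int (poly_form S n x x) = (\<Sum>i<n. \<Sum>j<n. ?x i * ?x j * (2 * of_int (seidel_form S n i j)))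
      + 4 * ?x n * (\<Sum>i<n. ?x i) + 4 * ?x n * ?x n"
      unfolding poly_form_def
      by (simp add: edge corner sum.distrib sum_distrib_left algebra_simps)
    also have "(\<Sum>i<n. \<Sum>j<n. ?x i * ?x j * (2 * of_int (seidel_form S n i j)))
      = (\<Sum>i<n. \<Sum>j<n. ?x i * ?x j * gram_of_seidel S i j) + (\<Sum>i<n. ?x i) * (\<Sum>i<n. ?x i)"
      unfolding sum_product sum.distrib[symmetric] by (intro sum.cong refl) (simp add: gram algebra_simps)
    finally have eq: "2 * of_int (poly_form S n x x) = (\<Sum>i<n. \<Sum>j<n. ?x i * ?x j * gram_of_seidel S i j)
      + ((\<Sum>i<n. ?x i) + 2 * ?x n)\<^sup>2"
      by (simp add: power2_eq_square algebra_simps)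
    have "(0::real) \<le> 2 * of_int (poly_form S n x x)"
      unfolding eq by (intro add_nonneg_nonneg Omega_psd[OF S]) simp
    then show "0 \<le> poly_form S n x x" by simp
  qed
  show ?thesis
  proof
    show "poly_form S n (monom 1 n) (monom 1 n) = 2"
      by (simp add: poly_form_monom) (simp add: seidel_form_def)
    show "nbr (monom 1 n) (monom 1 i)" if "i < n" for i
      unfolding nbr_def using that by (simp add: poly_form_monom) (simp add: seidel_form_def)
    show "poly_form S n (monom 1 i) (monom 1 j) \<in> {0, 1}" if "i < n" "j < n" "i \<noteq> j" for i j
      using that by (simp add: poly_form_monom) (simp add: seidel_form_def)
    fix J assume J: "J \<subseteq> {..<n}" "card J = 8"
    obtain c :: "nat \<Rightarrow> real" where c: "\<exists>j\<in>J. c j \<noteq> 0" "\<forall>i<n. (\<Sum>j\<in>J. c j * gram_of_seidel S i j) = 0"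
      using Omega_dependent[OF S J] by blast
    have "(\<Sum>j\<in>J. c j * (2 * of_int (poly_form S n (monom 1 i) (monom 1 j)) - 1)) = 0" if "i < n" for i
    proof -
      have "(\<Sum>j\<in>J. c j * (2 * of_int (poly_form S n (monom 1 i) (monom 1 j)) - 1)) = (\<Sum>j\<in>J. c j * gram_of_seidel S i j)"
      proof (rule sum.cong)
        fix j assume "j \<in> J"
        then have "j < n" using J by auto
        then show "c j * (2 * of_int (poly_form S n (monom 1 i) (monom 1 j)) - 1) = c j * gram_of_seidel S i j"
          using that gram[OF that] by (simp add: poly_form_monom)
      qed simp
      then show ?thesis using c(2) that by simp
    qed
    then show "\<exists>c :: nat \<Rightarrow> real. (\<exists>j\<in>J. c j \<noteq> 0) \<and> (\<forall>i<n. (\<Sum>j\<in>J. c j * (2 * of_int (poly_form S n (monom 1 i) (monom 1 j)) - 1)) = 0)"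
      using c(1) by (intro exI[of _ c]) auto
  qed
qed

lemma Omega_realized:
  assumes S: "S \<in> Omega n"
  shows "\<exists>g :: nat \<Rightarrow> real vec. (\<forall>i<n. g i \<in> root_nbrs (half_vec r0l)) \<and>
    (\<forall>i<n. \<forall>j<n. i \<noteq> j \<longrightarrow> S $$ (i, j) = 1 - 2 * (g i \<bullet> g j))"
proof -
  interpret root_configuration "poly_form S n" "monom 1 n" "\<lambda>i. monom 1 i" n by (rule Omega_configuration[OF S])
  from configuration_embeddable obtain g :: "nat \<Rightarrow> real vec" where g: "\<forall>i<n. g i \<in> root_nbrs (half_vec r0l)"
    "\<forall>i<n. \<forall>j<n. g i \<bullet> g j = of_int (poly_form S n (monom 1 i) (monom 1 j))"
    unfolding embeddable_def by blast
  have "S $$ (i, j) = 1 - 2 * (g i \<bullet> g j)" if ij: "i < n" "j < n" "i \<noteq> j" for i j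
  proof -
    have "S $$ (i, j) \<in> {1, -1}" using S ij by (auto simp: Omega_def seidel_mats_def)
    then show ?thesis using g(2) ij by (auto simp: poly_form_monom seidel_form_def)
  qed
  then show ?thesis using g by blast
qed

section \<open>Switching classes\<close>

text \<open>A signed permutation matrix given by its permutation and signs: column \<open>i\<close>
  has the entry \<open>d i\<close> in row \<open>p i\<close>.\<close>

definition switching :: "nat \<Rightarrow> (nat \<Rightarrow> nat) \<Rightarrow> (nat \<Rightarrow> real) \<Rightarrow> real mat \<Rightarrow> real mat \<Rightarrow> bool" where
  "switching n p d S S' \<longleftrightarrow> bij_betw p {..<n} {..<n} \<and> (\<forall>i<n. d i \<in> {1, -1}) \<and>
    (\<forall>i<n. \<forall>j<n. S' $$ (i, j) = d i * d j * S $$ (p i, p j))"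

lemma signed_perm_conj:
  assumes P: "P \<in> carrier_mat n n" and S: "S \<in> carrier_mat n n" and p: "\<And>j. j < n \<Longrightarrow> p j < n"
    and entries: "\<And>i j. i < n \<Longrightarrow> j < n \<Longrightarrow> P $$ (i, j) = (if i = p j then d j else (0::real))" and ij: "i < n" "j < n"
  shows "(P\<^sup>T * S * P) $$ (i, j) = d i * d j * S $$ (p i, p j)"
proof -
  have PS: "(P\<^sup>T * S) $$ (i, k) = d i * S $$ (p i, k)" if k: "k < n" for k
  proof -
    have "(P\<^sup>T * S) $$ (i, k) = (\<Sum>l<n. P $$ (l, i) * S $$ (l, k))"
      using P S ij k by (auto simp: scalar_prod_def lessThan_atLeast0 intro!: sum.cong)
    also have "\<dots> = (\<Sum>l<n. if l = p i then d i * S $$ (l, k) else 0)"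
      using entries ij by (intro sum.cong) auto
    also have "\<dots> = d i * S $$ (p i, k)" using p[OF ij(1)] by simp
    finally show ?thesis .
  qed
  have "(P\<^sup>T * S * P) $$ (i, j) = (\<Sum>k<n. (P\<^sup>T * S) $$ (i, k) * P $$ (k, j))"
    using P S ij by (auto simp: scalar_prod_def lessThan_atLeast0 simp del: assoc_mult_mat intro!: sum.cong)
  also have "\<dots> = (\<Sum>k<n. if k = p j then d i * S $$ (p i, k) * d j else 0)"
    using entries ij PS by (intro sum.cong) auto
  also have "\<dots> = d i * S $$ (p i, p j) * d j" using p[OF ij(2)] by simp
  finally show ?thesis by simp
qed

lemma sw_rel_iff: "(S, S') \<in> sw_rel n \<longleftrightarrow> S \<in> seidel_mats n \<and> S' \<in> seidel_mats n \<and> (\<exists>p d. switching n p d S S')"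
proof (intro iffI conjI)
  assume rel: "(S, S') \<in> sw_rel n"
  then show S: "S \<in> seidel_mats n" "S' \<in> seidel_mats n" by (auto simp: sw_rel_def)
  from rel obtain P where P: "P \<in> signed_perm_mats n" "P\<^sup>T * S * P = S'" by (auto simp: sw_rel_def)
  have Sc: "S \<in> carrier_mat n n" using S by (auto simp: seidel_mats_def)
  have Pc: "P \<in> carrier_mat n n" and Pe: "\<And>i j. i < n \<Longrightarrow> j < n \<Longrightarrow> P $$ (i, j) \<in> {0, 1, -1}"
    and rows: "\<And>i. i < n \<Longrightarrow> \<exists>!j. j < n \<and> P $$ (i, j) \<noteq> 0" and cols: "\<And>j. j < n \<Longrightarrow> \<exists>!i. i < n \<and> P $$ (i, j) \<noteq> 0"
    using P(1) by (auto simp: signed_perm_mats_def)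
  define p where "p j = (THE i. i < n \<and> P $$ (i, j) \<noteq> 0)" for j
  have p: "p j < n" "P $$ (p j, j) \<noteq> 0" if "j < n" for j
    using theI'[OF cols[OF that]] by (auto simp: p_def)
  have entries: "P $$ (i, j) = (if i = p j then P $$ (p j, j) else 0)" if "i < n" "j < n" for i j
    using cols[OF that(2)] p[OF that(2)] that by auto
  have inj: "inj_on p {..<n}"
  proof (rule inj_onI)
    fix i j assume ij: "i \<in> {..<n}" "j \<in> {..<n}" "p i = p j"
    then show "i = j" using rows[of "p i"] p[of i] p[of j] by auto
  qed
  moreover have "p ` {..<n} \<subseteq> {..<n}" using p by auto
  ultimately have "bij_betw p {..<n} {..<n}"
    by (simp add: bij_betw_def endo_inj_surj)
  moreover have "\<forall>i<n. P $$ (p i, i) \<in> {1, -1}"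
    using Pe p by blast
  ultimately show "\<exists>p d. switching n p d S S'"
    unfolding switching_def P(2)[symmetric] using signed_perm_conj[OF Pc Sc p(1) entries]
    by (intro exI[of _ p] exI[of _ "\<lambda>i. P $$ (p i, i)"]) simp
next
  assume a: "S \<in> seidel_mats n \<and> S' \<in> seidel_mats n \<and> (\<exists>p d. switching n p d S S')"
  then obtain p d where "switching n p d S S'" by blast
  then have sw: "bij_betw p {..<n} {..<n}" "\<And>i. i < n \<Longrightarrow> d i \<in> {1, -1}"
    "\<And>i j. i < n \<Longrightarrow> j < n \<Longrightarrow> S' $$ (i, j) = d i * d j * S $$ (p i, p j)" by (auto simp: switching_def)
  have p: "p j < n" if "j < n" for j using bij_betw_apply[OF sw(1)] that by auto
  define P where "P = mat n n (\<lambda>(i, j). if i = p j then d j else 0)"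
  have c: "S \<in> carrier_mat n n" "S' \<in> carrier_mat n n" "P \<in> carrier_mat n n" using a by (auto simp: seidel_mats_def P_def)
  have entries: "P $$ (i, j) = (if i = p j then d j else 0)" if "i < n" "j < n" for i j
    using that by (simp add: P_def)
  have d0: "d j \<noteq> 0" if "j < n" for j using sw(2)[OF that] by auto
  have "P \<in> signed_perm_mats n"
  proof -
    have "\<exists>!j. j < n \<and> P $$ (i, j) \<noteq> 0" if i: "i < n" for i
    proof -
      have "i \<in> p ` {..<n}" using i sw(1) by (simp add: bij_betw_def)
      then obtain j where j: "j < n" "p j = i" by auto
      show ?thesis
      proof (rule ex1I[of _ j])
        show "j < n \<and> P $$ (i, j) \<noteq> 0" using j i d0 entries by simp
        fix k assume k: "k < n \<and> P $$ (i, k) \<noteq> 0"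
        then have "p k = p j" using i j entries[OF i, of k] by (metis)
        then show "k = j" using k j sw(1) inj_onD[of p "{..<n}" k j] by (simp add: bij_betw_def)
      qed
    qed
    moreover have "\<exists>!i. i < n \<and> P $$ (i, j) \<noteq> 0" if j: "j < n" for j
      using j d0 entries p by (intro ex1I[of _ "p j"]) (auto split: if_splits)
    ultimately show ?thesis
      using c(3) entries sw(2) by (auto simp: signed_perm_mats_def)
  qed
  moreover have "P\<^sup>T * S * P = S'"
  proof (rule eq_matI)
    fix i j assume "i < dim_row S'" "j < dim_col S'"
    then have ij: "i < n" "j < n" using c by auto
    show "(P\<^sup>T * S * P) $$ (i, j) = S' $$ (i, j)"
      unfolding sw(3)[OF ij] by (rule signed_perm_conj[OF c(3,1) p entries ij])
  qed (use c in auto)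
  ultimately show "(S, S') \<in> sw_rel n" using a by (auto simp: sw_rel_def)
qed

lemma sw_rel_equiv: "equiv (seidel_mats n) (sw_rel n)"
proof (rule equivI)
  show "sw_rel n \<subseteq> seidel_mats n \<times> seidel_mats n" by (auto simp: sw_rel_def)
  show "refl_on (seidel_mats n) (sw_rel n)"
  proof (rule refl_onI)
    fix S assume "S \<in> seidel_mats n"
    moreover have "switching n id (\<lambda>_. 1) S S" by (simp add: switching_def)
    ultimately show "(S, S) \<in> sw_rel n" unfolding sw_rel_iff by blast
  qed
  show "sym (sw_rel n)"
  proof (rule symI)
    fix S S' assume rel: "(S, S') \<in> sw_rel n"
    then obtain p d where sw: "switching n p d S S'" unfolding sw_rel_iff by blast
    then have b: "bij_betw p {..<n} {..<n}" by (simp add: switching_def)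
    let ?q = "inv_into {..<n} p"
    have q: "?q i < n" "p (?q i) = i" if "i < n" for i
      using that b bij_betw_inv_into_right[OF b, of i] bij_betw_apply[OF bij_betw_inv_into[OF b], of i] by auto
    have sq: "d (?q i) * d (?q i) = 1" if "i < n" for i using sw q[OF that] by (auto simp: switching_def)
    have "S $$ (i, j) = d (?q i) * d (?q j) * S' $$ (?q i, ?q j)" if ij: "i < n" "j < n" for i j
    proof -
      have "S' $$ (?q i, ?q j) = d (?q i) * d (?q j) * S $$ (i, j)"
        using sw q ij by (simp add: switching_def)
      then have "d (?q i) * d (?q j) * S' $$ (?q i, ?q j) = (d (?q i) * d (?q i)) * (d (?q j) * d (?q j)) * S $$ (i, j)"
        by (simp only: mult_ac)
      then show ?thesis using sq ij by simp
    qed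
    then have "switching n ?q (\<lambda>i. d (?q i)) S' S"
      using bij_betw_inv_into[OF b] sw q by (simp add: switching_def)
    then show "(S', S) \<in> sw_rel n" using rel unfolding sw_rel_iff by blast
  qed
  show "trans (sw_rel n)"
  proof (rule transI)
    fix S S' S'' assume rel: "(S, S') \<in> sw_rel n" "(S', S'') \<in> sw_rel n"
    then obtain p d p' d' where sw: "switching n p d S S'" "switching n p' d' S' S''" unfolding sw_rel_iff by blast
    have p': "p' i < n" if "i < n" for i using sw(2) bij_betw_apply that by (fastforce simp: switching_def)
    have "switching n (p \<circ> p') (\<lambda>i. d (p' i) * d' i) S S''"
      unfolding switching_def
    proof (intro conjI allI impI)
      show "bij_betw (p \<circ> p') {..<n} {..<n}" using sw by (auto simp: switching_def intro: bij_betw_trans)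
      fix i assume i: "i < n"
      have "d (p' i) \<in> {1, -1}" "d' i \<in> {1, -1}" using sw p'[OF i] i by (auto simp: switching_def)
      then show "d (p' i) * d' i \<in> {1, -1}" by auto
      fix j assume j: "j < n"
      show "S'' $$ (i, j) = d (p' i) * d' i * (d (p' j) * d' j) * S $$ ((p \<circ> p') i, (p \<circ> p') j)"
        using sw i j p' by (simp add: switching_def)
    qed
    then show "(S, S'') \<in> sw_rel n" using rel unfolding sw_rel_iff by blast
  qed
qed

definition seidel_of_roots :: "real vec list \<Rightarrow> real mat" where
  "seidel_of_roots us = mat (length us) (length us) (\<lambda>(i, j). if i = j then 0 else 1 - 2 * (us ! i \<bullet> us ! j))"

text \<open>Each \<open>k\<close> contributes a matrix of rank at most 1.\<close>

lemma rank_sum_le: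
  fixes f g :: "nat \<Rightarrow> nat \<Rightarrow> real"
  shows "vec_space.rank n (mat n n (\<lambda>(i, j). \<Sum>k<m. f k i * g k j)) \<le> m"
proof (induction m)
  case 0
  have zero: "mat n n (\<lambda>(i, j). \<Sum>k<0::nat. f k i * g k j) = 0\<^sub>m n n" by auto
  show ?case unfolding zero vec_space.rank_0I by simp
next
  case (Suc m)
  let ?M = "\<lambda>m. mat n n (\<lambda>(i, j). \<Sum>k<m. f k i * g k j)" and ?R = "mat n n (\<lambda>(i, j). f m i * g m j)"
  have "?M (Suc m) = ?M m + ?R" by (intro eq_matI) auto
  moreover have "vec_space.rank n (?M m + ?R) \<le> vec_space.rank n (?M m) + vec_space.rank n ?R"
    by (rule vec_space.rank_subadditive) auto
  moreover have "vec_space.rank n ?R \<le> 1"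
    by (rule vec_space.rank_le_1_product_entries[where f = "f m" and g = "g m" and nc = n]) auto
  ultimately show ?case using Suc by simp
qed

text \<open>Twice the Gram matrix of the projections to the orthogonal complement of \<open>r\<close> is a sum of
  seven squares, because the first two coordinates of a projection are opposite to each other.\<close>

lemma std_nbrs_product:
  assumes "u \<in> root_nbrs (half_vec r0l)" "v \<in> root_nbrs (half_vec r0l)"
  defines "D \<equiv> (\<lambda>(k::nat) (x :: real vec). if k = 0 then x $ 0 - x $ 1 else sqrt 2 * x $ (k + 1))"
  shows "2 * (u \<bullet> v) - 1 = (\<Sum>k<7. D k u * D k v)"
proof -
  have c: "u \<in> carrier_vec 8" "v \<in> carrier_vec 8" using assms root_nbrsD(4) by auto
  have r0: "half_vec r0l \<in> carrier_vec 8" by (simp add: half_vec_carrier list_lengths)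
  have "x \<bullet> half_vec r0l = x $ 0 + x $ 1" if "x \<in> carrier_vec 8" for x
    using that r0 by (simp add: scalar_prod_sum8 eval_nat_numeral) (simp add: half_vec_def r0l_def vec_of_list_index)
  then have one: "u $ 0 + u $ 1 = 1" "v $ 0 + v $ 1 = 1" using c assms(1,2) root_nbrsD(2) by metis+
  have "u \<bullet> v = (\<Sum>i<8. u $ i * v $ i)" using c by (rule scalar_prod_sum8)
  also have "\<dots> = u $ 0 * v $ 0 + u $ 1 * v $ 1 + (\<Sum>k<6. u $ (k + 2) * v $ (k + 2))"
    by (simp add: eval_nat_numeral)
  finally have uv: "u \<bullet> v = u $ 0 * v $ 0 + u $ 1 * v $ 1 + (\<Sum>k<6. u $ (k + 2) * v $ (k + 2))" .
  have "(\<Sum>k<7. D k u * D k v) = (u $ 0 - u $ 1) * (v $ 0 - v $ 1) + (\<Sum>k<6. D (Suc k) u * D (Suc k) v)"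
    using sum.lessThan_Suc_shift[of "\<lambda>k. D k u * D k v" 6] by (simp add: D_def)
  also have "(\<Sum>k<6. D (Suc k) u * D (Suc k) v) = (\<Sum>k<6. 2 * (u $ (k + 2) * v $ (k + 2)))"
    by (intro sum.cong) (auto simp: D_def)
  finally have "(\<Sum>k<7. D k u * D k v) = (u $ 0 - u $ 1) * (v $ 0 - v $ 1) + 2 * (\<Sum>k<6. u $ (k + 2) * v $ (k + 2))"
    by (simp add: sum_distrib_left)
  moreover have "2 * (u $ 0 * v $ 0 + u $ 1 * v $ 1) - (u $ 0 + u $ 1) * (v $ 0 + v $ 1) = (u $ 0 - u $ 1) * (v $ 0 - v $ 1)"
    by (simp add: algebra_simps)
  ultimately show ?thesis unfolding uv one by (simp add: algebra_simps)
qed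

text \<open>A factorization of \<open>3I - S\<close> through seven dimensions yields both
  conditions: its quadratic form is nonnegative, which bounds the eigenvalues of \<open>S\<close> by
  3, and its rank is at most 7.\<close>

lemma sum_squares_Omega:
  fixes D :: "nat \<Rightarrow> nat \<Rightarrow> real"
  assumes S: "S \<in> seidel_mats n"
    and gram: "\<And>i j. i < n \<Longrightarrow> j < n \<Longrightarrow> gram_of_seidel S i j = (\<Sum>k<7. D k i * D k j)"
  shows "S \<in> Omega n"
proof -
  have Sc: "S \<in> carrier_mat n n" using S by (auto simp: seidel_mats_def)
  let ?M = "3 \<cdot>\<^sub>m 1\<^sub>m n - S"
  have M: "?M = mat n n (\<lambda>(i, j). \<Sum>k<7. D k i * D k j)"
  proof (rule eq_matI)
    fix i j assume "i < dim_row (mat n n (\<lambda>(i, j). \<Sum>k<7. D k i * D k j))" "j < dim_col (mat n n (\<lambda>(i, j). \<Sum>k<7. D k i * D k j))"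
    then have ij: "i < n" "j < n" by auto
    show "?M $$ (i, j) = mat n n (\<lambda>(i, j). \<Sum>k<7. D k i * D k j) $$ (i, j)"
      unfolding Omega_shift(3)[OF S ij] gram[OF ij] using ij by simp
  qed (use Sc in auto)
  have "e \<le> 3" if ev: "eigenvalue S e" for e
  proof -
    obtain v where v: "v \<in> carrier_vec n" "v \<noteq> 0\<^sub>v n" "S *\<^sub>v v = e \<cdot>\<^sub>v v"
      using ev Sc by (auto simp: eigenvalue_def eigenvector_def)
    have Sv: "(\<Sum>j<n. S $$ (i, j) * v $ j) = e * v $ i" if "i < n" for i
    proof -
      have "(S *\<^sub>v v) $ i = (\<Sum>j<n. S $$ (i, j) * v $ j)"
        using Sc v(1) that by (auto simp: scalar_prod_def lessThan_atLeast0 intro!: sum.cong)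
      then show ?thesis using v that by simp
    qed
    have Mv: "(\<Sum>j<n. gram_of_seidel S i j * v $ j) = (3 - e) * v $ i" if i: "i < n" for i
    proof -
      have "(\<Sum>j<n. gram_of_seidel S i j * v $ j) = (\<Sum>j<n. (if i = j then 3 * v $ j else 0) - S $$ (i, j) * v $ j)"
        using S i by (intro sum.cong) (auto simp: gram_of_seidel_def seidel_mats_def)
      also have "\<dots> = 3 * v $ i - e * v $ i" using i Sv[OF i] by (simp add: sum_subtractf)
      finally show ?thesis by (simp add: algebra_simps)
    qed
    \<comment> \<open>The quadratic form of \<open>3I - S\<close> at an eigenvector is
      \<open>3 - e\<close> times its squared length.\<close>
    have "(3 - e) * (\<Sum>i<n. v $ i * v $ i) = (\<Sum>i<n. v $ i * ((3 - e) * v $ i))"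
      by (simp add: sum_distrib_left mult_ac)
    also have "\<dots> = (\<Sum>i<n. v $ i * (\<Sum>j<n. gram_of_seidel S i j * v $ j))"
      using Mv by (intro sum.cong) simp_all
    also have "\<dots> = (\<Sum>i<n. \<Sum>j<n. v $ i * (gram_of_seidel S i j * v $ j))"
      by (simp only: sum_distrib_left)
    also have "\<dots> = (\<Sum>i<n. \<Sum>j<n. \<Sum>k<7. (D k i * v $ i) * (D k j * v $ j))"
    proof (intro sum.cong refl)
      fix i j assume "i \<in> {..<n}" "j \<in> {..<n}"
      then have g: "gram_of_seidel S i j = (\<Sum>k<7. D k i * D k j)" by (intro gram) auto
      show "v $ i * (gram_of_seidel S i j * v $ j) = (\<Sum>k<7. (D k i * v $ i) * (D k j * v $ j))"
        unfolding g sum_distrib_left sum_distrib_right by (intro sum.cong) (simp_all only: mult_ac)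
    qed
    also have "\<dots> = (\<Sum>i<n. \<Sum>k<7. \<Sum>j<n. (D k i * v $ i) * (D k j * v $ j))"
      by (intro sum.cong refl sum.swap)
    also have "\<dots> = (\<Sum>k<7. \<Sum>i<n. \<Sum>j<n. (D k i * v $ i) * (D k j * v $ j))"
      by (rule sum.swap)
    also have "\<dots> = (\<Sum>k<7. (\<Sum>i<n. D k i * v $ i) * (\<Sum>j<n. D k j * v $ j))"
      by (simp only: sum_product)
    also have "\<dots> \<ge> 0" by (intro sum_nonneg) simp
    finally have "0 \<le> (3 - e) * (\<Sum>i<n. v $ i * v $ i)" .
    moreover have "0 < (\<Sum>i<n. v $ i * v $ i)"
    proof -
      obtain i where "i < n" "v $ i \<noteq> 0" using v(1,2) by (metis carrier_vecD eq_vecI index_zero_vec)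
      then have "0 < v $ i * v $ i" by (auto simp: zero_less_mult_iff)
      also have "\<dots> \<le> (\<Sum>i<n. v $ i * v $ i)" using \<open>i < n\<close> by (intro member_le_sum) auto
      finally show ?thesis .
    qed
    ultimately show ?thesis by (simp add: zero_le_mult_iff)
  qed
  moreover have "vec_space.rank n ?M \<le> 7" unfolding M by (rule rank_sum_le)
  ultimately show ?thesis using S by (simp add: Omega_def)
qed

section \<open>The mapping from orbits to switching classes\<close>

definition representatives :: "real vec \<Rightarrow> nat \<Rightarrow> real vec list \<Rightarrow> bool" where
  "representatives r n us \<longleftrightarrow> length us = n \<and> set us \<subseteq> root_nbrs r \<and> root_class r ` set us \<in> nsets (root_classes r) n"

definition orbit_of :: "real vec \<Rightarrow> real vec list \<Rightarrow> real vec set set set" where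
  "orbit_of r us = class_orbit r (root_class r ` set us)"

context
  fixes r :: "real vec"
  assumes r: "r \<in> E8_roots"
begin

lemma root_class_in_classes: "u \<in> root_nbrs r \<Longrightarrow> root_class r u \<in> root_classes r"
  by (auto simp: root_classes_def quotient_def)

text \<open>By \<open>root_nbrs_cases\<close> two neighbours share a class exactly if their product
  is 2 or -1, so distinctness of classes can be read off the products.\<close>

lemma representatives_iff:
  "representatives r n us \<longleftrightarrow> length us = n \<and> set us \<subseteq> root_nbrs r \<and>
    (\<forall>i<n. \<forall>j<n. i \<noteq> j \<longrightarrow> us ! i \<bullet> us ! j \<in> {0, 1})"
proof (cases "length us = n \<and> set us \<subseteq> root_nbrs r")
  case True
  then have len: "length us = n" and sub: "set us \<subseteq> root_nbrs r" by auto
  have N: "us ! i \<in> root_nbrs r" if "i < n" for i using that len sub nth_mem by blast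
  have set: "set us = (!) us ` {..<n}" using len by (auto simp: set_conv_nth)
  have prod: "us ! i \<bullet> us ! j \<in> {0, 1} \<longleftrightarrow> root_class r (us ! i) \<noteq> root_class r (us ! j)" if "i < n" "j < n" for i j
  proof -
    have "us ! j \<bullet> us ! j = 2" "(r - us ! j) \<bullet> us ! j = -1"
      using N[OF that(2)] root_nbrsD[of "us ! j" r] root_nbrs_sym[OF r] r_facts[OF r] by (auto simp: ip8_simps)
    then show ?thesis
      using root_nbrs_cases[OF r N[OF that(1)] N[OF that(2)]] by (auto simp: root_class_eq_iff[OF r N[OF that(1)] N[OF that(2)]])
  qed
  have "root_class r ` set us \<subseteq> root_classes r" using sub root_class_in_classes by auto
  then have "root_class r ` set us \<in> nsets (root_classes r) n \<longleftrightarrow> card (root_class r ` set us) = n" by (auto simp: nsets_def)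
  also have "\<dots> \<longleftrightarrow> inj_on (\<lambda>i. root_class r (us ! i)) {..<n}"
    using inj_on_iff_eq_card[of "{..<n}" "\<lambda>i. root_class r (us ! i)"] unfolding set image_image by simp
  also have "\<dots> \<longleftrightarrow> (\<forall>i<n. \<forall>j<n. i \<noteq> j \<longrightarrow> us ! i \<bullet> us ! j \<in> {0, 1})"
    using prod by (auto simp: inj_on_def)
  finally show ?thesis using True by (simp add: representatives_def)
qed (auto simp: representatives_def)

lemma representativesD:
  assumes "representatives r n us"
  shows "length us = n" "\<And>i. i < n \<Longrightarrow> us ! i \<in> root_nbrs r"
    "\<And>i j. i < n \<Longrightarrow> j < n \<Longrightarrow> i \<noteq> j \<Longrightarrow> us ! i \<bullet> us ! j \<in> {0, 1}"
  using assms nth_mem unfolding representatives_iff by blast+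

lemma representatives_set: "representatives r n us \<Longrightarrow> set us = (!) us ` {..<n}"
  using representativesD(1) by (auto simp: set_conv_nth)

lemma image_root_class:
  assumes w: "w \<in> E8_Weyl" "w r = r" and u: "u \<in> root_nbrs r"
  shows "w ` root_class r u = root_class r (w u)"
  using stab_nbr[OF r w u] u w r_facts[OF r] root_nbrsD(4)[OF u]
  by (simp add: root_class_eq[OF r] E8_Weyl_diff)

text \<open>Orbits are sets of sets of classes; this reduces their equality to one group element,
  with its inverse supplying the second inclusion.\<close>

lemma orbit_eq_iff:
  assumes us: "set us \<subseteq> root_nbrs r" and vs: "set vs \<subseteq> root_nbrs r"
  shows "orbit_of r us = orbit_of r vs \<longleftrightarrow>
    (\<exists>w\<in>E8_Weyl. w r = r \<and> (\<lambda>u. root_class r (w u)) ` set us = root_class r ` set vs)"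
proof -
  have act: "(\<lambda>c. w ` c) ` root_class r ` set xs = (\<lambda>u. root_class r (w u)) ` set xs"
    if "w \<in> E8_Weyl" "w r = r" "set xs \<subseteq> root_nbrs r" for w xs
    unfolding image_image
  proof (rule image_cong[OF refl])
    fix u assume "u \<in> set xs"
    then show "w ` root_class r u = root_class r (w u)" using that by (intro image_root_class) auto
  qed
  let ?id = "\<lambda>x\<in>carrier_vec 8. x :: real vec"
  have id: "?id \<in> E8_Weyl_stab r" using E8_Weyl_id r_facts[OF r] by (simp add: E8_Weyl_stab_def)
  have act_id: "(\<lambda>c. ?id ` c) ` root_class r ` set xs = root_class r ` set xs" if xs: "set xs \<subseteq> root_nbrs r" for xs
  proof -
    have "(\<lambda>u. root_class r (?id u)) ` set xs = root_class r ` set xs"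
      using xs root_nbrsD(4) by (intro image_cong) auto
    then show ?thesis using act[OF E8_Weyl_id _ xs] r_facts[OF r] by simp
  qed
  show ?thesis
  proof
    assume "orbit_of r us = orbit_of r vs"
    moreover have "root_class r ` set vs \<in> orbit_of r vs"
      unfolding orbit_of_def class_orbit_def by (rule image_eqI[where x = ?id]) (use act_id[OF vs] id in \<open>simp_all only:\<close>)
    ultimately have "root_class r ` set vs \<in> orbit_of r us" by (simp only:)
    then obtain w where w: "w \<in> E8_Weyl_stab r" "root_class r ` set vs = (\<lambda>c. w ` c) ` root_class r ` set us"
      unfolding orbit_of_def class_orbit_def by (elim imageE)
    then have "w \<in> E8_Weyl" "w r = r" by (auto simp: E8_Weyl_stab_def)
    then show "\<exists>w\<in>E8_Weyl. w r = r \<and> (\<lambda>u. root_class r (w u)) ` set us = root_class r ` set vs"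
      using w(2) act us by (intro bexI[of _ w]) auto
  next
    assume "\<exists>w\<in>E8_Weyl. w r = r \<and> (\<lambda>u. root_class r (w u)) ` set us = root_class r ` set vs"
    then obtain w where w: "w \<in> E8_Weyl" "w r = r" "(\<lambda>u. root_class r (w u)) ` set us = root_class r ` set vs" by blast
    obtain k where k: "k \<in> E8_Weyl" "\<And>x. x \<in> carrier_vec 8 \<Longrightarrow> k (w x) = x" using E8_Weyl_inverse[OF w(1)] by blast
    have kr: "k r = r" using k(2)[of r] w(2) r_facts[OF r] by simp
    have wimg: "(\<lambda>c. w ` c) ` root_class r ` set us = root_class r ` set vs"
      using act[OF w(1,2) us] w(3) by simp
    have kimg: "(\<lambda>c. k ` c) ` root_class r ` set vs = root_class r ` set us"
    proof -
      have "(\<lambda>c. k ` c) ` root_class r ` set vs = (\<lambda>u. k ` w ` root_class r u) ` set us"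
        unfolding wimg[symmetric] by (simp only: image_image)
      also have "\<dots> = root_class r ` set us"
      proof (rule image_cong)
        fix u assume "u \<in> set us"
        then have u: "u \<in> root_nbrs r" using us by auto
        have "k ` w ` root_class r u = root_class r (k (w u))"
          using image_root_class[OF w(1,2) u] image_root_class[OF k(1) kr stab_nbr[OF r w(1,2) u]] by simp
        then show "k ` w ` root_class r u = root_class r u" using k(2)[OF root_nbrsD(4)[OF u]] by simp
      qed simp
      finally show ?thesis .
    qed
    have sub: "class_orbit r Y \<subseteq> class_orbit r X"
      if g: "g \<in> E8_Weyl" "g r = r" and XY: "(\<lambda>c. g ` c) ` X = Y" and X: "\<forall>c\<in>X. c \<subseteq> carrier_vec 8" for g X Y
    proof
      fix Z assume "Z \<in> class_orbit r Y"
      then obtain h where h: "h \<in> E8_Weyl" "h r = r" "Z = (\<lambda>c. h ` c) ` Y" by (auto simp: class_orbit_def E8_Weyl_stab_def)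
      have "compose (carrier_vec 8) h g \<in> E8_Weyl_stab r"
        using E8_Weyl_compose[OF h(1) g(1)] h(2) g(2) r_facts[OF r] by (simp add: E8_Weyl_stab_def compose_def)
      moreover have "(\<lambda>c. compose (carrier_vec 8) h g ` c) ` X = Z"
      proof -
        have "compose (carrier_vec 8) h g ` c = h ` g ` c" if "c \<in> X" for c
          unfolding image_image using X that by (intro image_cong) (auto simp: compose_def)
        then have "(\<lambda>c. compose (carrier_vec 8) h g ` c) ` X = (\<lambda>c. h ` g ` c) ` X" by (rule image_cong[OF refl])
        then show ?thesis unfolding h(3) XY[symmetric] by (simp only: image_image)
      qed
      ultimately show "Z \<in> class_orbit r X" unfolding class_orbit_def by blast
    qed
    have car: "\<forall>c\<in>root_class r ` set xs. c \<subseteq> carrier_vec 8" if "set xs \<subseteq> root_nbrs r" for xs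
      using that by (auto simp: root_rel_def dest: root_nbrsD(4))
    show "orbit_of r us = orbit_of r vs"
      unfolding orbit_of_def
      using sub[OF w(1,2) wimg car[OF us]] sub[OF k(1) kr kimg car[OF vs]] by blast
  qed
qed

lemma seidel_of_roots_entry:
  assumes "representatives r n us" "i < n" "j < n"
  shows "seidel_of_roots us $$ (i, j) = (if i = j then 0 else 1 - 2 * (us ! i \<bullet> us ! j))"
  using assms representativesD(1)[OF assms(1)] by (simp add: seidel_of_roots_def)

lemma representatives_product_sym:
  "representatives r n us \<Longrightarrow> i < n \<Longrightarrow> j < n \<Longrightarrow> us ! i \<bullet> us ! j = us ! j \<bullet> us ! i"
  using representativesD(2) root_nbrsD(4) comm_scalar_prod by metis

lemma seidel_of_roots_seidel:
  assumes us: "representatives r n us"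
  shows "seidel_of_roots us \<in> seidel_mats n"
proof -
  note e = seidel_of_roots_entry[OF us]
  have c: "seidel_of_roots us \<in> carrier_mat n n" using representativesD(1)[OF us] by (auto simp: seidel_of_roots_def)
  have "(seidel_of_roots us)\<^sup>T = seidel_of_roots us"
    using c e representatives_product_sym[OF us] by (intro eq_matI) auto
  moreover have "seidel_of_roots us $$ (i, j) \<in> {1, -1}" if "i < n" "j < n" "i \<noteq> j" for i j
    using representativesD(3)[OF us that] e[OF that(1,2)] that by auto
  ultimately show ?thesis using c e by (auto simp: seidel_mats_def)
qed

text \<open>Once \<open>r\<close> is in standard position, \<open>std_nbrs_product\<close> factors
  \<open>3I - S\<close> through seven dimensions.\<close>

lemma seidel_of_roots_Omega:
  assumes us: "representatives r n us"
  shows "seidel_of_roots us \<in> Omega n"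
proof -
  obtain g where g: "g \<in> E8_Weyl" "map g ([] @ [r]) = map half_vec ([] @ [r0l])"
    using move_next[OF hub_r0 E8_Weyl_id, of "[]" r] r by auto
  have gr: "g r = half_vec r0l" using g(2) by simp
  have N: "g (us ! i) \<in> root_nbrs (half_vec r0l)" if "i < n" for i
  proof -
    note ui = representativesD(2)[OF us that]
    have "g (us ! i) \<bullet> half_vec r0l = us ! i \<bullet> r"
      using E8_Weyl_scalar_prod[OF g(1) root_nbrsD(4)[OF ui] r_facts(1)[OF r]] unfolding gr .
    then show ?thesis
      using E8_Weyl_roots[OF g(1) root_nbrsD(1)[OF ui]] root_nbrsD(2)[OF ui] by (simp add: root_nbrs_def)
  qed
  let ?D = "\<lambda>(k::nat) i. if k = 0 then g (us ! i) $ 0 - g (us ! i) $ 1 else sqrt 2 * g (us ! i) $ (k + 1)"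
  show ?thesis
  proof (rule sum_squares_Omega[OF seidel_of_roots_seidel[OF us]])
    fix i j assume ij: "i < n" "j < n"
    have "g (us ! i) \<bullet> g (us ! j) = us ! i \<bullet> us ! j"
      using E8_Weyl_scalar_prod[OF g(1)] representativesD(2)[OF us] root_nbrsD(4) ij by blast
    moreover have "us ! i \<bullet> us ! i = 2" using root_nbrsD(3)[OF representativesD(2)[OF us ij(1)]] .
    ultimately have "gram_of_seidel (seidel_of_roots us) i j = 2 * (g (us ! i) \<bullet> g (us ! j)) - 1"
      using ij by (auto simp: gram_of_seidel_def seidel_of_roots_entry[OF us])
    also have "\<dots> = (\<Sum>k<7. ?D k i * ?D k j)"
      using std_nbrs_product[OF N[OF ij(1)] N[OF ij(2)]] by simp
    finally show "gram_of_seidel (seidel_of_roots us) i j = (\<Sum>k<7. ?D k i * ?D k j)" .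
  qed
qed

lemma graph_of_representatives:
  assumes us: "representatives r n us"
  shows "\<exists>E. simple_graph n E \<and> adj_mat n E + 2 \<cdot>\<^sub>m 1\<^sub>m n = (mat_of_cols 8 us)\<^sup>T * mat_of_cols 8 us"
    and "\<And>E. simple_graph n E \<Longrightarrow> adj_mat n E + 2 \<cdot>\<^sub>m 1\<^sub>m n = (mat_of_cols 8 us)\<^sup>T * mat_of_cols 8 us \<Longrightarrow>
      seidel_of_graph n E = seidel_of_roots us"
proof -
  note len = representativesD(1)[OF us]
  have gram: "((mat_of_cols 8 us)\<^sup>T * mat_of_cols 8 us) $$ (i, j) = us ! i \<bullet> us ! j" if "i < n" "j < n" for i j
    using that len col_mat_of_cols[of i us 8] col_mat_of_cols[of j us 8]
      root_nbrsD(4)[OF representativesD(2)[OF us that(1)]] root_nbrsD(4)[OF representativesD(2)[OF us that(2)]] by simp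
  have gram_dim: "(mat_of_cols 8 us)\<^sup>T * mat_of_cols 8 us \<in> carrier_mat n n" using len by auto
  have adj: "(adj_mat n E + 2 \<cdot>\<^sub>m 1\<^sub>m n) $$ (i, j) = (if {i, j} \<in> E then 1 else 0) + (if i = j then 2 else 0)"
    if "i < n" "j < n" for E i j using that by (simp add: adj_mat_def)
  have loop: "{i} \<notin> E" if "simple_graph n E" for E i
    using that by (auto simp: simple_graph_def nsets_def)
  have diag: "us ! i \<bullet> us ! i = 2" if "i < n" for i using root_nbrsD(3)[OF representativesD(2)[OF us that]] .
  let ?E = "{e. \<exists>i j. e = {i, j} \<and> i < n \<and> j < n \<and> i \<noteq> j \<and> us ! i \<bullet> us ! j = 1}"
  have E: "simple_graph n ?E" by (auto simp: simple_graph_def nsets_def card_insert_if)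
  have "adj_mat n ?E + 2 \<cdot>\<^sub>m 1\<^sub>m n = (mat_of_cols 8 us)\<^sup>T * mat_of_cols 8 us"
  proof (rule eq_matI)
    fix i j assume "i < dim_row ((mat_of_cols 8 us)\<^sup>T * mat_of_cols 8 us)" "j < dim_col ((mat_of_cols 8 us)\<^sup>T * mat_of_cols 8 us)"
    then have ij: "i < n" "j < n" using len by auto
    have "{i, j} \<in> ?E \<longleftrightarrow> i \<noteq> j \<and> us ! i \<bullet> us ! j = 1"
      using ij representatives_product_sym[OF us ij] by (auto simp: doubleton_eq_iff)
    then show "(adj_mat n ?E + 2 \<cdot>\<^sub>m 1\<^sub>m n) $$ (i, j) = ((mat_of_cols 8 us)\<^sup>T * mat_of_cols 8 us) $$ (i, j)"
      unfolding adj[OF ij] gram[OF ij] using diag[OF ij(1)] representativesD(3)[OF us ij] by auto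
  qed (use len in \<open>auto simp: adj_mat_def\<close>)
  with E show "\<exists>E. simple_graph n E \<and> adj_mat n E + 2 \<cdot>\<^sub>m 1\<^sub>m n = (mat_of_cols 8 us)\<^sup>T * mat_of_cols 8 us" by blast
  fix E assume sg: "simple_graph n E" and eq: "adj_mat n E + 2 \<cdot>\<^sub>m 1\<^sub>m n = (mat_of_cols 8 us)\<^sup>T * mat_of_cols 8 us"
  show "seidel_of_graph n E = seidel_of_roots us"
  proof (rule eq_matI)
    fix i j assume "i < dim_row (seidel_of_roots us)" "j < dim_col (seidel_of_roots us)"
    then have ij: "i < n" "j < n" using len by (auto simp: seidel_of_roots_def)
    have "(if {i, j} \<in> E then 1 else 0) + (if i = j then 2 else 0) = us ! i \<bullet> us ! j"
      using adj[OF ij, of E] gram[OF ij] eq by simp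
    then show "seidel_of_graph n E $$ (i, j) = seidel_of_roots us $$ (i, j)"
      using ij loop[OF sg] by (auto simp: seidel_of_graph_def adj_mat_def seidel_of_roots_entry[OF us] split: if_splits)
  qed (use len in \<open>auto simp: seidel_of_graph_def adj_mat_def seidel_of_roots_def\<close>)
qed

text \<open>Replacing \<open>u\<close> by \<open>r - u\<close> turns a product \<open>p\<close> into
  \<open>1 - p\<close> and so negates \<open>1 - 2p\<close>: flips become the signs, the order of
  the list becomes the permutation.\<close>

lemma orbit_eq_imp_switching:
  assumes us: "representatives r n us" and vs: "representatives r n vs" and orb: "orbit_of r us = orbit_of r vs"
  shows "(seidel_of_roots us, seidel_of_roots vs) \<in> sw_rel n"
proof -
  have sub: "set us \<subseteq> root_nbrs r" "set vs \<subseteq> root_nbrs r" using us vs by (auto simp: representatives_def)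
  obtain w where w: "w \<in> E8_Weyl" "w r = r" "(\<lambda>u. root_class r (w u)) ` set us = root_class r ` set vs"
    using orb unfolding orbit_eq_iff[OF sub] by blast
  have N: "w (us ! i) \<in> root_nbrs r" "vs ! i \<in> root_nbrs r" if "i < n" for i
    using stab_nbr[OF r w(1,2)] representativesD(2)[OF us that] representativesD(2)[OF vs that] by auto
  have "\<exists>k. k < n \<and> root_class r (vs ! i) = root_class r (w (us ! k))" if "i < n" for i
  proof -
    have "root_class r (vs ! i) \<in> (\<lambda>u. root_class r (w u)) ` set us"
      unfolding w(3) using that representativesD(1)[OF vs] by auto
    then show ?thesis unfolding representatives_set[OF us] by auto
  qed
  then obtain p where p: "\<And>i. i < n \<Longrightarrow> p i < n" "\<And>i. i < n \<Longrightarrow> root_class r (vs ! i) = root_class r (w (us ! p i))"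
    by metis
  have inj: "inj_on p {..<n}"
  proof (rule inj_onI)
    fix i j assume ij: "i \<in> {..<n}" "j \<in> {..<n}" "p i = p j"
    then have "root_class r (vs ! i) = root_class r (vs ! j)" using p(2) by (metis lessThan_iff)
    then have "vs ! i = vs ! j \<or> vs ! i = r - vs ! j" using root_class_eq_iff[OF r N(2) N(2)] ij by auto
    then have "vs ! i \<bullet> vs ! j \<notin> {0, 1}"
      using root_nbrsD[OF N(2), of j] root_nbrs_sym[OF r N(2), of j] r_facts[OF r] ij by (auto simp: ip8_simps)
    then show "i = j" using representativesD(3)[OF vs] ij by auto
  qed
  have "p ` {..<n} \<subseteq> {..<n}" using p(1) by auto
  with inj have bij: "bij_betw p {..<n} {..<n}" by (simp add: bij_betw_def endo_inj_surj)
  define b where "b i = (vs ! i \<noteq> w (us ! p i))" for i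
  have vflip: "vs ! i = flip r (b i) (w (us ! p i))" if "i < n" for i
    using p(2)[OF that] root_class_eq_iff[OF r N(2)[OF that] N(1)[OF p(1)[OF that]]] by (auto simp: flip_def b_def)
  define d where "d i = (if b i then -1 else 1 :: real)" for i
  have "seidel_of_roots vs $$ (i, j) = d i * d j * seidel_of_roots us $$ (p i, p j)" if ij: "i < n" "j < n" for i j
  proof (cases "i = j")
    case True
    then show ?thesis using ij p(1) seidel_of_roots_entry[OF us] seidel_of_roots_entry[OF vs] by simp
  next
    case False
    then have "p i \<noteq> p j" using inj ij by (auto dest: inj_onD)
    moreover have "vs ! i \<bullet> vs ! j = (if b i = b j then us ! p i \<bullet> us ! p j else 1 - us ! p i \<bullet> us ! p j)"
      using flip_product[OF r N(1)[OF p(1)[OF ij(1)]] N(1)[OF p(1)[OF ij(2)]]]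
        E8_Weyl_scalar_prod[OF w(1) root_nbrsD(4) root_nbrsD(4), OF representativesD(2)[OF us p(1)[OF ij(1)]] representativesD(2)[OF us p(1)[OF ij(2)]]]
      by (simp add: vflip[OF ij(1)] vflip[OF ij(2)])
    ultimately show ?thesis
      using False ij p(1) seidel_of_roots_entry[OF us] seidel_of_roots_entry[OF vs] by (auto simp: d_def)
  qed
  then have "switching n p d (seidel_of_roots us) (seidel_of_roots vs)"
    using bij by (auto simp: switching_def d_def)
  then show ?thesis using seidel_of_roots_seidel us vs unfolding sw_rel_iff by blast
qed

text \<open>Discharges the definite description: another list for the same orbit gives a switching
  equivalent matrix, and the graph is determined by the list.\<close>

lemma phi_orbit:
  assumes us: "representatives r n us"
  shows "phi r n (orbit_of r us) = sw_class n (seidel_of_roots us)"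
  unfolding phi_def
proof (rule the_equality)
  obtain E where "simple_graph n E" "adj_mat n E + 2 \<cdot>\<^sub>m 1\<^sub>m n = (mat_of_cols 8 us)\<^sup>T * mat_of_cols 8 us"
    using graph_of_representatives(1)[OF us] by blast
  moreover from this have "seidel_of_graph n E = seidel_of_roots us" by (rule graph_of_representatives(2)[OF us])
  ultimately show "\<exists>vs E. length vs = n \<and> set vs \<subseteq> root_nbrs r \<and> root_class r ` set vs \<in> nsets (root_classes r) n \<and>
     orbit_of r us = class_orbit r (root_class r ` set vs) \<and> simple_graph n E \<and>
     adj_mat n E + 2 \<cdot>\<^sub>m 1\<^sub>m n = (mat_of_cols 8 vs)\<^sup>T * mat_of_cols 8 vs \<and>
     sw_class n (seidel_of_roots us) = sw_class n (seidel_of_graph n E)"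
    using us by (intro exI[of _ us] exI[of _ E]) (simp add: representatives_def orbit_of_def)
next
  fix C assume "\<exists>vs E. length vs = n \<and> set vs \<subseteq> root_nbrs r \<and> root_class r ` set vs \<in> nsets (root_classes r) n \<and>
     orbit_of r us = class_orbit r (root_class r ` set vs) \<and> simple_graph n E \<and>
     adj_mat n E + 2 \<cdot>\<^sub>m 1\<^sub>m n = (mat_of_cols 8 vs)\<^sup>T * mat_of_cols 8 vs \<and> C = sw_class n (seidel_of_graph n E)"
  then obtain vs E where vs: "representatives r n vs" and orb: "orbit_of r us = orbit_of r vs"
    and E: "simple_graph n E" "adj_mat n E + 2 \<cdot>\<^sub>m 1\<^sub>m n = (mat_of_cols 8 vs)\<^sup>T * mat_of_cols 8 vs"
    and C: "C = sw_class n (seidel_of_graph n E)" unfolding representatives_def orbit_of_def by blast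
  have "C = sw_class n (seidel_of_roots vs)" using C graph_of_representatives(2)[OF vs E] by simp
  also have "\<dots> = sw_class n (seidel_of_roots us)"
    using equiv_class_eq[OF sw_rel_equiv orbit_eq_imp_switching[OF us vs orb]] by simp
  finally show "C = sw_class n (seidel_of_roots us)" .
qed

lemma class_orbits_iff: "Q \<in> class_orbits r n \<longleftrightarrow> (\<exists>us. representatives r n us \<and> Q = orbit_of r us)"
proof
  assume "Q \<in> class_orbits r n"
  then obtain X where X: "X \<in> nsets (root_classes r) n" "Q = class_orbit r X" by (auto simp: class_orbits_def)
  then obtain cs where cs: "set cs = X" "distinct cs" using finite_distinct_list unfolding nsets_def by blast
  have len: "length cs = n" using cs X(1) distinct_card[OF cs(2)] by (auto simp: nsets_def)
  have "\<exists>u\<in>root_nbrs r. root_class r u = c" if "c \<in> X" for c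
    using that X(1) by (auto simp: nsets_def root_classes_def quotient_def)
  then obtain f where f: "\<And>c. c \<in> X \<Longrightarrow> f c \<in> root_nbrs r" "\<And>c. c \<in> X \<Longrightarrow> root_class r (f c) = c" by metis
  have "root_class r ` set (map f cs) = X" using f(2) cs(1) by (force simp: image_iff)
  then show "\<exists>us. representatives r n us \<and> Q = orbit_of r us"
    using X f(1) cs len by (intro exI[of _ "map f cs"]) (auto simp: representatives_def orbit_of_def)
next
  assume "\<exists>us. representatives r n us \<and> Q = orbit_of r us"
  then show "Q \<in> class_orbits r n"
    unfolding representatives_def orbit_of_def class_orbits_def by blast
qed

end

section \<open>Image and fibres of the mapping\<close>

lemma move_to_std:
  assumes "r \<in> E8_roots"
  obtains g k where "g \<in> E8_Weyl" "g r = half_vec r0l" "k \<in> E8_Weyl" "k (half_vec r0l) = r"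
    "\<And>x. x \<in> carrier_vec 8 \<Longrightarrow> k (g x) = x" "\<And>x. x \<in> carrier_vec 8 \<Longrightarrow> g (k x) = x"
proof -
  obtain g where g: "g \<in> E8_Weyl" "map g ([] @ [r]) = map half_vec ([] @ [r0l])"
    using move_next[OF hub_r0 E8_Weyl_id, of "[]" r] assms by auto
  obtain k where k: "k \<in> E8_Weyl" "\<And>x. x \<in> carrier_vec 8 \<Longrightarrow> k (g x) = x" "\<And>x. x \<in> carrier_vec 8 \<Longrightarrow> g (k x) = x"
    using E8_Weyl_inverse[OF g(1)] by blast
  have gr: "g r = half_vec r0l" using g(2) by simp
  moreover have "k (half_vec r0l) = r" using k(2)[OF E8_root_carrier[OF assms]] gr by simp
  ultimately show ?thesis using that[of g k] g(1) k by blast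
qed

lemma Weyl_nbr:
  assumes "w \<in> E8_Weyl" "r \<in> E8_roots" "w r = s" "u \<in> root_nbrs r"
  shows "w u \<in> root_nbrs s"
proof -
  have "w u \<bullet> s = u \<bullet> r"
    using E8_Weyl_scalar_prod[OF assms(1) root_nbrsD(4)[OF assms(4)] E8_root_carrier[OF assms(2)]] unfolding assms(3) .
  then show ?thesis
    using E8_Weyl_roots[OF assms(1) root_nbrsD(1)[OF assms(4)]] root_nbrsD(2)[OF assms(4)] by (simp add: root_nbrs_def)
qed

abbreviation complete_seidel :: "nat \<Rightarrow> real mat" where
  "complete_seidel n \<equiv> seidel_of_graph n (complete_edges n)"

lemma complete_seidel_entry:
  assumes "i < n" "j < n"
  shows "complete_seidel n $$ (i, j) = (if i = j then 0 else -1)"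
proof -
  have "{i, j} \<in> complete_edges n \<longleftrightarrow> i \<noteq> j"
    using assms by (auto simp: complete_edges_def nsets_def card_insert_if)
  then show ?thesis using assms by (auto simp: seidel_of_graph_def adj_mat_def)
qed

lemma complete_seidel_seidel: "complete_seidel n \<in> seidel_mats n"
proof -
  have c: "complete_seidel n \<in> carrier_mat n n"
    by (rule carrier_matI) (simp_all add: seidel_of_graph_def adj_mat_def)
  then have "(complete_seidel n)\<^sup>T = complete_seidel n"
    by (intro eq_matI) (auto simp: complete_seidel_entry)
  then show ?thesis using c complete_seidel_entry by (auto simp: seidel_mats_def)
qed

context
  fixes r :: "real vec"
  assumes r: "r \<in> E8_roots"
begin

lemma flip_flip: "u \<in> root_nbrs r \<Longrightarrow> flip r c (flip r b u) = flip r (c \<noteq> b) u"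
  using root_nbrs_compl_compl[OF r] by (auto simp: flip_def)

lemma orbit_eqI:
  assumes us: "representatives r n us" and vs: "representatives r n vs" and p: "bij_betw p {..<n} {..<n}"
    and w: "w \<in> E8_Weyl" "w r = r"
    and eq: "(\<lambda>i. root_class r (w (flip r (b i) (us ! p i)))) ` {..<n} = (\<lambda>i. root_class r (flip r (c i) (vs ! i))) ` {..<n}"
  shows "orbit_of r us = orbit_of r vs"
proof -
  have pn: "p i < n" if "i < n" for i using bij_betw_apply[OF p] that by auto
  have sub: "set us \<subseteq> root_nbrs r" "set vs \<subseteq> root_nbrs r" using us vs by (auto simp: representatives_def)
  have "(\<lambda>u. root_class r (w u)) ` set us = (\<lambda>i. root_class r (w (us ! i))) ` (p ` {..<n})"
    using p by (simp add: representatives_set[OF r us] image_image bij_betw_def)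
  also have "\<dots> = (\<lambda>i. root_class r (w (flip r (b i) (us ! p i)))) ` {..<n}"
    unfolding image_image
  proof (rule image_cong[OF refl])
    fix i assume "i \<in> {..<n}"
    then have N: "us ! p i \<in> root_nbrs r" using representativesD(2)[OF r us pn] by simp
    show "root_class r (w (us ! p i)) = root_class r (w (flip r (b i) (us ! p i)))"
      using stab_nbr[OF r w N] by (simp add: stab_flip[OF r w N] root_class_flip[OF r])
  qed
  also have "\<dots> = (\<lambda>i. root_class r (flip r (c i) (vs ! i))) ` {..<n}" by (rule eq)
  also have "\<dots> = root_class r ` set vs"
    unfolding representatives_set[OF r vs] image_image
    using root_class_flip[OF r] representativesD(2)[OF r vs] by (intro image_cong) auto
  finally show ?thesis unfolding orbit_eq_iff[OF r sub] using w by blast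
qed

lemma seidel_flip_product:
  assumes us: "representatives r n us" and ij: "i < n" "j < n" "i \<noteq> j"
  shows "1 - 2 * (flip r (b i) (us ! i) \<bullet> flip r (b j) (us ! j)) =
    (if b i then -1 else 1) * (if b j then -1 else 1) * seidel_of_roots us $$ (i, j)"
  using flip_product[OF r representativesD(2)[OF r us ij(1)] representativesD(2)[OF r us ij(2)]] ij
  by (simp add: seidel_of_roots_entry[OF r us])

lemma clique_card:
  assumes "\<And>i. i < n \<Longrightarrow> x i \<in> root_nbrs r" and "\<And>i j. i < n \<Longrightarrow> j < n \<Longrightarrow> i \<noteq> j \<Longrightarrow> x i \<bullet> x j = 1"
  shows "card (x ` {..<n}) = n"
proof -
  have "inj_on x {..<n}"
  proof (rule inj_onI, rule ccontr)
    fix i j assume "i \<in> {..<n}" "j \<in> {..<n}" "x i = x j" "i \<noteq> j"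
    then show False using assms(2)[of i j] root_nbrsD(3)[OF assms(1)[of i]] by auto
  qed
  then show ?thesis by (simp add: card_image)
qed

lemma clique_family:
  assumes N: "\<And>i. i < n \<Longrightarrow> x i \<in> root_nbrs r" and one: "\<And>i j. i < n \<Longrightarrow> j < n \<Longrightarrow> i \<noteq> j \<Longrightarrow> x i \<bullet> x j = 1"
  obtains w where "w \<in> E8_Weyl" "w r = half_vec r0l"
    "w ` x ` {..<n} = clique_std n \<or> n = 6 \<and> w ` x ` {..<n} = clique_twisted"
proof -
  have "x ` {..<n} \<subseteq> root_nbrs r" using N by auto
  moreover have "a \<bullet> b = 1" if "a \<in> x ` {..<n}" "b \<in> x ` {..<n}" "a \<noteq> b" for a b
  proof -
    obtain i j where "a = x i" "b = x j" "i < n" "j < n" using \<open>a \<in> _\<close> \<open>b \<in> _\<close> by auto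
    then show ?thesis using one[of i j] \<open>a \<noteq> b\<close> by auto
  qed
  ultimately have ex: "\<exists>w\<in>E8_Weyl. w r = half_vec r0l \<and> (w ` x ` {..<n} = clique_std (card (x ` {..<n})) \<or>
      card (x ` {..<n}) = 6 \<and> w ` x ` {..<n} = clique_twisted)"
    by (intro clique_standard_form[OF r]) auto
  have card: "card (x ` {..<n}) = n" by (rule clique_card) (rule N one; assumption)+
  from ex[unfolded card] obtain w where "w \<in> E8_Weyl" "w r = half_vec r0l"
    "w ` x ` {..<n} = clique_std n \<or> n = 6 \<and> w ` x ` {..<n} = clique_twisted" by (elim bexE conjE)
  then show ?thesis by (rule that)
qed

text \<open>The switching data turn \<open>us\<close> into a family with the Gram matrix of
  \<open>vs\<close>. If some flips of it contain a triple, \<open>triple_equivalent\<close> applies;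
  otherwise both families flip to cliques, and for \<open>n\<close> other than 6 these share one
  standard form.\<close>

lemma switching_imp_orbit_eq:
  assumes us: "representatives r n us" and vs: "representatives r n vs"
    and rel: "(seidel_of_roots us, seidel_of_roots vs) \<in> sw_rel n"
    and not_K6: "n = 6 \<Longrightarrow> (seidel_of_roots vs, complete_seidel 6) \<notin> sw_rel 6"
  shows "orbit_of r us = orbit_of r vs"
proof -
  obtain p d where sw: "switching n p d (seidel_of_roots us) (seidel_of_roots vs)" using rel unfolding sw_rel_iff by blast
  then have p: "bij_betw p {..<n} {..<n}" and d: "\<And>i. i < n \<Longrightarrow> d i \<in> {1, -1}" by (auto simp: switching_def)
  have pn: "p i < n" if "i < n" for i using bij_betw_apply[OF p] that by auto
  define u where "u i = flip r (d i = -1) (us ! p i)" for i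
  define v where "v i = vs ! i" for i
  have usN: "us ! p i \<in> root_nbrs r" if "i < n" for i using representativesD(2)[OF r us pn[OF that]] .
  have N: "u i \<in> root_nbrs r" "v i \<in> root_nbrs r" if "i < n" for i
    using flip_nbr[OF r usN[OF that]] representativesD(2)[OF r vs that] by (auto simp: u_def v_def)
  have gram: "u i \<bullet> u j = v i \<bullet> v j" if ij: "i < n" "j < n" for i j
  proof (cases "i = j")
    case True
    then show ?thesis using root_nbrsD(3)[OF N(1)[OF ij(1)]] root_nbrsD(3)[OF N(2)[OF ij(1)]] by simp
  next
    case False
    then have "p i \<noteq> p j" using ij p by (auto simp: bij_betw_def dest: inj_onD)
    moreover have "seidel_of_roots vs $$ (i, j) = d i * d j * seidel_of_roots us $$ (p i, p j)"
      using sw ij by (simp add: switching_def)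
    ultimately have "1 - 2 * (v i \<bullet> v j) = d i * d j * (1 - 2 * (us ! p i \<bullet> us ! p j))"
      unfolding seidel_of_roots_entry[OF r us pn[OF ij(1)] pn[OF ij(2)]] seidel_of_roots_entry[OF r vs ij]
      using False by (simp add: v_def)
    then show ?thesis
      using d[OF ij(1)] d[OF ij(2)] flip_product[OF r usN[OF ij(1)] usN[OF ij(2)]] by (auto simp: u_def)
  qed
  have distinct: "v i \<bullet> v j \<in> {0, 1}" if "i < n" "j < n" "i \<noteq> j" for i j
    using representativesD(3)[OF r vs that] by (simp add: v_def)
  have gram': "flip r (b i) (u i) \<bullet> flip r (b j) (u j) = flip r (b i) (v i) \<bullet> flip r (b j) (v j)" if "i < n" "j < n" for i j b
    using flip_product[OF r N(1)[OF that(1)] N(1)[OF that(2)]] flip_product[OF r N(2)[OF that(1)] N(2)[OF that(2)]] gram[OF that] by simp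
  have distinct': "flip r (b i) (v i) \<bullet> flip r (b j) (v j) \<in> {0, 1}" if "i < n" "j < n" "i \<noteq> j" for i j b
    using flip_product[OF r N(2)[OF that(1)] N(2)[OF that(2)]] distinct[OF that] by auto
  have finish: ?thesis
    if w: "w \<in> E8_Weyl" "w r = r"
      and eq: "(\<lambda>i. root_class r (w (flip r (b i) (u i)))) ` {..<n} = (\<lambda>i. root_class r (flip r (b i) (v i))) ` {..<n}" for w b
  proof (rule orbit_eqI[OF us vs p w])
    show "(\<lambda>i. root_class r (w (flip r (b i \<noteq> (d i = -1)) (us ! p i)))) ` {..<n} = (\<lambda>i. root_class r (flip r (b i) (vs ! i))) ` {..<n}"
      using eq usN by (simp add: u_def v_def flip_flip)
  qed
  show ?thesis
  proof (cases "\<exists>i1<n. \<exists>i2<n. \<exists>i3<n. \<exists>b. flip r (b i1) (v i1) \<bullet> flip r (b i2) (v i2) = 0 \<and>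
      flip r (b i1) (v i1) \<bullet> flip r (b i3) (v i3) = 0 \<and> flip r (b i2) (v i2) \<bullet> flip r (b i3) (v i3) = 0")
    case True
    then obtain i1 i2 i3 b where i: "i1 < n" "i2 < n" "i3 < n"
      and o: "flip r (b i1) (v i1) \<bullet> flip r (b i2) (v i2) = 0" "flip r (b i1) (v i1) \<bullet> flip r (b i3) (v i3) = 0"
        "flip r (b i2) (v i2) \<bullet> flip r (b i3) (v i3) = 0" by blast
    have "\<exists>w\<in>E8_Weyl. w r = r \<and> (\<lambda>i. root_class r (w (flip r (b i) (u i)))) ` {..<n} = (\<lambda>i. root_class r (flip r (b i) (v i))) ` {..<n}"
    proof (rule triple_equivalent[OF r, where ?i1.0 = i1 and ?i2.0 = i2 and ?i3.0 = i3])
      show "flip r (b i) (u i) \<bullet> flip r (b j) (u j) \<in> {0, 1}" if "i \<in> {..<n}" "j \<in> {..<n}" "i \<noteq> j" for i j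
        using distinct' gram' that by auto
    qed (use i o gram' N flip_nbr[OF r] in auto)
    then show ?thesis by (elim bexE conjE) (rule finish)
  next
    case no: False
    have no': False if "i1 < n" "i2 < n" "i3 < n" "flip r (b i1) (v i1) \<bullet> flip r (b i2) (v i2) = 0"
      "flip r (b i1) (v i1) \<bullet> flip r (b i3) (v i3) = 0" "flip r (b i2) (v i2) \<bullet> flip r (b i3) (v i3) = 0" for i1 i2 i3 b
      using no that by blast
    \<comment> \<open>These flips make all products with the root of index 0 equal to 1.\<close>
    define c where "c i = (i \<noteq> 0 \<and> v i \<bullet> v 0 \<noteq> 1)" for i
    define x where "x i = flip r (c i) (u i)" for i
    define y where "y i = flip r (c i) (v i)" for i
    have xyN: "x i \<in> root_nbrs r" "y i \<in> root_nbrs r" if "i < n" for i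
      using N[OF that] flip_nbr[OF r] by (auto simp: x_def y_def)
    have y0: "y i \<bullet> y 0 = 1" if i: "i < n" "i \<noteq> 0" for i
    proof -
      have "0 < n" using i by simp
      then show ?thesis
        using flip_product[OF r N(2)[OF i(1)] N(2)[of 0]] distinct[OF i(1) _ i(2)] i(2) by (auto simp: y_def c_def)
    qed
    have y1: "y i \<bullet> y j = 1" if ij: "i < n" "j < n" "i \<noteq> j" for i j
    proof (cases "i = 0 \<or> j = 0")
      case True
      have "y i \<bullet> y j = y j \<bullet> y i"
        by (rule comm_scalar_prod[OF root_nbrsD(4)[OF xyN(2)[OF ij(1)]] root_nbrsD(4)[OF xyN(2)[OF ij(2)]]])
      then show ?thesis using True y0[of i] y0[of j] ij by auto
    next
      case False
      have n0: "0 < n" using ij by simp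
      \<comment> \<open>Flipping index 0 in addition turns its products with \<open>y i\<close> and
        \<open>y j\<close> into 0, so orthogonal \<open>y i\<close> and \<open>y j\<close> would
        complete a triple.\<close>
      define b where "b k = (k = 0 \<or> c k)" for k
      have y0': "y 0 \<bullet> y i = 1" "y 0 \<bullet> y j = 1"
        using y0[of i] y0[of j] False ij
          comm_scalar_prod[OF root_nbrsD(4)[OF xyN(2)[OF n0]] root_nbrsD(4)[OF xyN(2)[OF ij(1)]]]
          comm_scalar_prod[OF root_nbrsD(4)[OF xyN(2)[OF n0]] root_nbrsD(4)[OF xyN(2)[OF ij(2)]]] by auto
      have y00: "y 0 = v 0" by (simp add: y_def c_def flip_def)
      have by_eq: "flip r (b k) (v k) = y k" if "k \<noteq> 0" for k using that by (simp add: b_def y_def)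
      have b0: "flip r (b 0) (v 0) \<bullet> y k = 1 - y 0 \<bullet> y k" if "k < n" for k
        using flip_product[OF r xyN(2)[OF n0] xyN(2)[OF that], of True False] by (simp add: y00 b_def flip_def)
      have "y i \<bullet> y j \<noteq> 0"
      proof
        assume "y i \<bullet> y j = 0"
        then show False
          using no'[OF n0 ij(1,2), of b] by_eq[of i] by_eq[of j] b0[OF ij(1)] b0[OF ij(2)] y0' False by simp
      qed
      then show ?thesis using distinct'[OF ij, of c] by (simp add: y_def)
    qed
    have x1: "x i \<bullet> x j = 1" if "i < n" "j < n" "i \<noteq> j" for i j
      using y1[OF that] gram'[OF that(1,2), of c] by (simp add: x_def y_def)
    \<comment> \<open>Up to the signs given by \<open>c\<close>, a clique has the Seidel matrix of
      the complete graph, the class excluded for \<open>n = 6\<close>.\<close>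
    have n6: "n \<noteq> 6"
    proof
      assume n: "n = 6"
      have "switching n id (\<lambda>i. if c i then -1 else 1) (seidel_of_roots vs) (complete_seidel n)"
        unfolding switching_def
      proof (intro conjI allI impI)
        fix i j assume ij: "i < n" "j < n"
        show "complete_seidel n $$ (i, j) = (if c i then -1 else 1) * (if c j then -1 else 1) * seidel_of_roots vs $$ (id i, id j)"
        proof (cases "i = j")
          case True
          then show ?thesis using ij by (simp add: complete_seidel_entry seidel_of_roots_entry[OF r vs])
        next
          case False
          have "1 - 2 * (y i \<bullet> y j) = (if c i then -1 else 1) * (if c j then -1 else 1) * seidel_of_roots vs $$ (i, j)"
            unfolding y_def v_def by (rule seidel_flip_product[OF vs ij False])
          then show ?thesis using y1[OF ij False] ij False by (simp add: complete_seidel_entry)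
        qed
      qed auto
      then have "(seidel_of_roots vs, complete_seidel n) \<in> sw_rel n"
        using seidel_of_roots_seidel[OF r vs] complete_seidel_seidel unfolding sw_rel_iff by blast
      then show False using not_K6 n by simp
    qed
    obtain w1 where w1: "w1 \<in> E8_Weyl" "w1 r = half_vec r0l"
      "w1 ` x ` {..<n} = clique_std n \<or> n = 6 \<and> w1 ` x ` {..<n} = clique_twisted"
      by (rule clique_family[OF xyN(1) x1])
    obtain w2 where w2: "w2 \<in> E8_Weyl" "w2 r = half_vec r0l"
      "w2 ` y ` {..<n} = clique_std n \<or> n = 6 \<and> w2 ` y ` {..<n} = clique_twisted"
      by (rule clique_family[OF xyN(2) y1])
    have std: "w1 ` x ` {..<n} = clique_std n" "w2 ` y ` {..<n} = clique_std n"
      using w1(3) w2(3) n6 by (simp_all only: simp_thms)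
    obtain k where k: "k \<in> E8_Weyl" "\<And>z. z \<in> carrier_vec 8 \<Longrightarrow> k (w2 z) = z" using E8_Weyl_inverse[OF w2(1)] by blast
    let ?w = "compose (carrier_vec 8) k w1"
    have wr: "?w r = r" using r_facts[OF r] k(2)[of r] w1 w2 by (simp add: compose_def)
    have "?w ` x ` {..<n} = k ` w1 ` x ` {..<n}"
      unfolding image_image using xyN(1) root_nbrsD(4) by (intro image_cong) (auto simp: compose_def)
    also have "\<dots> = k ` w2 ` y ` {..<n}" unfolding std ..
    also have "\<dots> = y ` {..<n}"
      unfolding image_image using xyN(2) root_nbrsD(4) k(2) by (intro image_cong) auto
    finally have "root_class r ` ?w ` x ` {..<n} = root_class r ` y ` {..<n}" by (simp only:)
    then show ?thesis
      using finish[OF E8_Weyl_compose[OF k(1) w1(1)] wr, of c] by (simp only: image_image x_def y_def)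
  qed
qed

lemma Omega_representatives:
  assumes S: "S \<in> Omega n"
  shows "\<exists>us. representatives r n us \<and> seidel_of_roots us = S"
proof -
  obtain g k where g: "g \<in> E8_Weyl" "g r = half_vec r0l" "k \<in> E8_Weyl" "k (half_vec r0l) = r" using move_to_std[OF r] by blast
  obtain f where f: "\<And>i. i < n \<Longrightarrow> f i \<in> root_nbrs (half_vec r0l)"
    "\<And>i j. i < n \<Longrightarrow> j < n \<Longrightarrow> i \<noteq> j \<Longrightarrow> S $$ (i, j) = 1 - 2 * (f i \<bullet> f j)" using Omega_realized[OF S] by blast
  have Sm: "S \<in> carrier_mat n n" "\<And>i. i < n \<Longrightarrow> S $$ (i, i) = 0" "\<And>i j. i < n \<Longrightarrow> j < n \<Longrightarrow> i \<noteq> j \<Longrightarrow> S $$ (i, j) \<in> {1, -1}"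
    using S by (auto simp: Omega_def seidel_mats_def)
  have r0: "half_vec r0l \<in> E8_roots" using std_roots by auto
  let ?us = "map (\<lambda>i. k (f i)) [0..<n]"
  have prod: "k (f i) \<bullet> k (f j) = f i \<bullet> f j" if "i < n" "j < n" for i j
    using E8_Weyl_scalar_prod[OF g(3)] root_nbrsD(4)[OF f(1)] that by blast
  have us: "representatives r n ?us"
    unfolding representatives_iff[OF r]
  proof (intro conjI allI impI)
    show "set ?us \<subseteq> root_nbrs r" using Weyl_nbr[OF g(3) r0 g(4)] f(1) by auto
    fix i j assume ij: "i < n" "j < n" "i \<noteq> j"
    show "?us ! i \<bullet> ?us ! j \<in> {0, 1}" using Sm(3)[OF ij] f(2)[OF ij] prod ij by auto
  qed simp
  have "seidel_of_roots ?us = S"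
    using Sm f(2) prod by (intro eq_matI) (auto simp: seidel_of_roots_def)
  then show ?thesis using us by blast
qed

lemma phi_image: "phi r n ` class_orbits r n = Omega n // sw_rel n"
proof (intro equalityI subsetI)
  fix C assume "C \<in> phi r n ` class_orbits r n"
  then obtain us where us: "representatives r n us" "C = sw_class n (seidel_of_roots us)"
    using phi_orbit[OF r] by (auto simp: class_orbits_iff[OF r])
  then show "C \<in> Omega n // sw_rel n" using seidel_of_roots_Omega[OF r us(1)] by (auto simp: quotient_def)
next
  fix C assume "C \<in> Omega n // sw_rel n"
  then obtain S where S: "S \<in> Omega n" "C = sw_class n S" by (auto simp: quotient_def)
  obtain us where us: "representatives r n us" "seidel_of_roots us = S" using Omega_representatives[OF S(1)] by blast
  have "orbit_of r us \<in> class_orbits r n" using us(1) by (auto simp: class_orbits_iff[OF r])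
  then show "C \<in> phi r n ` class_orbits r n" using phi_orbit[OF r us(1)] us(2) S(2) by (metis image_eqI)
qed

lemma phi_injective:
  assumes Q: "Q \<in> class_orbits r n" "Q' \<in> class_orbits r n" and eq: "phi r n Q = phi r n Q'"
    and not_K6: "n = 6 \<Longrightarrow> phi r n Q' \<noteq> sw_class 6 (complete_seidel 6)"
  shows "Q = Q'"
proof -
  obtain us where us: "representatives r n us" "Q = orbit_of r us" using Q(1) by (auto simp: class_orbits_iff[OF r])
  obtain vs where vs: "representatives r n vs" "Q' = orbit_of r vs" using Q(2) by (auto simp: class_orbits_iff[OF r])
  have "sw_class n (seidel_of_roots us) = sw_class n (seidel_of_roots vs)"
    using eq us vs phi_orbit[OF r] by simp
  then have "(seidel_of_roots us, seidel_of_roots vs) \<in> sw_rel n"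
    using eq_equiv_class[OF _ sw_rel_equiv] seidel_of_roots_seidel[OF r vs(1)] by blast
  moreover have "(seidel_of_roots vs, complete_seidel 6) \<notin> sw_rel 6" if n: "n = 6"
  proof
    assume "(seidel_of_roots vs, complete_seidel 6) \<in> sw_rel 6"
    then have "sw_class 6 (seidel_of_roots vs) = sw_class 6 (complete_seidel 6)"
      by (rule equiv_class_eq[OF sw_rel_equiv])
    then show False using not_K6[OF n] phi_orbit[OF r vs(1)] vs(2) n by simp
  qed
  ultimately show ?thesis using switching_imp_orbit_eq[OF us(1) vs(1)] us(2) vs(2) by blast
qed

lemma complete_fibre: "card {Q \<in> class_orbits r 6. phi r 6 Q = sw_class 6 (complete_seidel 6)} = 2"
proof -
  obtain g k where g: "g \<in> E8_Weyl" "g r = half_vec r0l" and k: "k \<in> E8_Weyl" "k (half_vec r0l) = r"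
    and kg: "\<And>x. x \<in> carrier_vec 8 \<Longrightarrow> k (g x) = x" and gk: "\<And>x. x \<in> carrier_vec 8 \<Longrightarrow> g (k x) = x"
    using move_to_std[OF r] by blast
  have r0: "half_vec r0l \<in> E8_roots" using std_roots by auto
  define l1 where "l1 = [a1l, b2l, b3l, b4l, b5l, b6l]"
  define l2 where "l2 = [a1l, b2l, b3l, b4l, b5l, c6l]"
  define X where "X l = map (\<lambda>a. k (half_vec a)) l" for l
  have N0: "half_vec a \<in> root_nbrs (half_vec r0l)" if "a \<in> {a1l, b2l, b3l, b4l, b5l, b6l, b7l, c6l}" for a
  proof -
    have "dotl a r0l = 4" "length a = 8" using that by (auto simp: list_defs)
    then show ?thesis
      using that std_roots half_vec_scalar_prod[of a r0l] list_lengths(1) by (auto simp: root_nbrs_def)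
  qed
  have kN: "k (half_vec a) \<in> root_nbrs r" if "a \<in> {a1l, b2l, b3l, b4l, b5l, b6l, b7l, c6l}" for a
    using Weyl_nbr[OF k(1) r0 k(2) N0[OF that]] .
  have kprod: "k (half_vec a) \<bullet> k (half_vec b) = of_int (dotl a b) / 4" if "length a = 8" "length b = 8" for a b
    using E8_Weyl_scalar_prod[OF k(1)] half_vec_carrier that half_vec_scalar_prod[OF that] by simp
  have l: "length l = 6" "set l \<subseteq> {a1l, b2l, b3l, b4l, b5l, b6l, b7l, c6l}" "\<forall>a\<in>set l. length a = 8"
    "sorted_wrt (\<lambda>a b. dotl a b = 4 \<and> dotl b a = 4) l" if "l \<in> {l1, l2}" for l
    using that by (auto simp: l1_def l2_def list_lengths) (simp_all add: list_defs)
  have Xprod: "X l ! i \<bullet> X l ! j = 1" if l': "l \<in> {l1, l2}" and ij: "i < 6" "j < 6" "i \<noteq> j" for l i j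
  proof -
    have "dotl (l ! i) (l ! j) = 4"
      using l(4)[OF l'] l(1)[OF l'] ij by (cases "i < j") (auto simp: sorted_wrt_iff_nth_less)
    then show ?thesis using l(1,3)[OF l'] ij by (simp add: X_def kprod)
  qed
  have rep: "representatives r 6 (X l)" if l': "l \<in> {l1, l2}" for l
    unfolding representatives_iff[OF r] using Xprod[OF l'] l(1)[OF l'] l(2)[OF l'] kN by (auto simp: X_def)
  have seidel: "seidel_of_roots (X l) = complete_seidel 6" if l': "l \<in> {l1, l2}" for l
  proof (rule eq_matI)
    fix i j assume "i < dim_row (complete_seidel 6)" "j < dim_col (complete_seidel 6)"
    then have ij: "i < 6" "j < 6" by (auto simp: seidel_of_graph_def adj_mat_def)
    then show "seidel_of_roots (X l) $$ (i, j) = complete_seidel 6 $$ (i, j)"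
      using Xprod[OF l'] by (simp add: seidel_of_roots_entry[OF r rep[OF l']] complete_seidel_entry)
  qed (use l(1)[OF l'] in \<open>auto simp: seidel_of_roots_def seidel_of_graph_def adj_mat_def X_def\<close>)
  have std: "k ` clique_std 6 = set (X l1)" "k ` clique_twisted = set (X l2)"
    by (simp_all add: clique_std_def clique_twisted_def X_def l1_def l2_def)
  \<comment> \<open>Up to flips, a member of the fibre is a clique of six and so has one of the two
    standard forms.\<close>
  have two: "Q \<in> {orbit_of r (X l1), orbit_of r (X l2)}"
    if Q: "Q \<in> class_orbits r 6" "phi r 6 Q = sw_class 6 (complete_seidel 6)" for Q
  proof -
    obtain us where us: "representatives r 6 us" "Q = orbit_of r us" using Q(1) by (auto simp: class_orbits_iff[OF r])
    have "sw_class 6 (complete_seidel 6) = sw_class 6 (seidel_of_roots us)" using Q(2) us phi_orbit[OF r us(1)] by simp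
    then have "(complete_seidel 6, seidel_of_roots us) \<in> sw_rel 6"
      using eq_equiv_class[OF _ sw_rel_equiv] seidel_of_roots_seidel[OF r us(1)] by blast
    then obtain p d where sw: "switching 6 p d (complete_seidel 6) (seidel_of_roots us)" unfolding sw_rel_iff by blast
    define x where "x i = flip r (d i = -1) (us ! i)" for i
    have xN: "x i \<in> root_nbrs r" if "i < 6" for i
      using flip_nbr[OF r representativesD(2)[OF r us(1) that]] by (simp add: x_def)
    have x1: "x i \<bullet> x j = 1" if ij: "i < 6" "j < 6" "i \<noteq> j" for i j
    proof -
      have "bij_betw p {..<6} {..<6}" using sw by (simp add: switching_def)
      then have "p i \<noteq> p j" "p i < 6" "p j < 6"
        using ij bij_betw_apply[of p] by (auto simp: bij_betw_def dest: inj_onD)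
      then have "seidel_of_roots us $$ (i, j) = - (d i * d j)"
        using sw ij by (simp add: switching_def complete_seidel_entry)
      moreover have "d i \<in> {1, -1}" "d j \<in> {1, -1}" using sw ij by (auto simp: switching_def)
      ultimately have "1 - 2 * (x i \<bullet> x j) = -1"
        using seidel_flip_product[OF us(1) ij, of "\<lambda>i. d i = -1"] by (auto simp: x_def)
      then show ?thesis by simp
    qed
    obtain w where w: "w \<in> E8_Weyl" "w r = half_vec r0l"
      "w ` x ` {..<6} = clique_std 6 \<or> (6::nat) = 6 \<and> w ` x ` {..<6} = clique_twisted"
      by (rule clique_family[OF xN x1])
    let ?w = "compose (carrier_vec 8) k w"
    have wr: "?w r = r" using r_facts[OF r] w k by (simp add: compose_def)
    have kw: "?w ` x ` {..<6} = k ` w ` x ` {..<6}"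
      unfolding image_image using xN root_nbrsD(4) by (intro image_cong) (auto simp: compose_def)
    have "?w ` x ` {..<6} = set (X l1) \<or> ?w ` x ` {..<6} = set (X l2)"
      using w(3) unfolding kw by (elim disjE conjE) (simp_all only: std simp_thms)
    then obtain l where l': "l \<in> {l1, l2}" "?w ` x ` {..<6} = set (X l)" by blast
    have "root_class r ` ?w ` x ` {..<6} = root_class r ` (!) (X l) ` {..<6}"
      unfolding l'(2) representatives_set[OF r rep[OF l'(1)]] ..
    then have "(\<lambda>i. root_class r (?w (flip r (d i = -1) (us ! id i)))) ` {..<6} = (\<lambda>i. root_class r (flip r False (X l ! i))) ` {..<6}"
      by (simp only: image_image x_def flip_def id_apply if_False)
    then have "orbit_of r us = orbit_of r (X l)"
      by (rule orbit_eqI[OF us(1) rep[OF l'(1)] bij_betw_id E8_Weyl_compose[OF k(1) w(1)] wr])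
    then show ?thesis using us(2) l'(1) by auto
  qed
  have phi: "phi r 6 (orbit_of r (X l)) = sw_class 6 (complete_seidel 6)" "orbit_of r (X l) \<in> class_orbits r 6" if "l \<in> {l1, l2}" for l
    using phi_orbit[OF r rep[OF that]] seidel[OF that] rep[OF that] by (auto simp: class_orbits_iff[OF r])
  have "{Q \<in> class_orbits r 6. phi r 6 Q = sw_class 6 (complete_seidel 6)} = {orbit_of r (X l1), orbit_of r (X l2)}"
    using two phi by auto
  moreover have "orbit_of r (X l1) \<noteq> orbit_of r (X l2)"
  proof
    assume "orbit_of r (X l1) = orbit_of r (X l2)"
    moreover have sub: "set (X l) \<subseteq> root_nbrs r" if "l \<in> {l1, l2}" for l using rep[OF that] by (simp add: representatives_def)
    ultimately obtain w where w: "w \<in> E8_Weyl" "w r = r"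
      "(\<lambda>u. root_class r (w u)) ` set (X l1) = root_class r ` set (X l2)"
      using orbit_eq_iff[OF r sub sub, of l1 l2] by auto
    \<comment> \<open>\<open>b7l\<close> extends the first clique to seven roots; under an
      equivalence its image would extend the second clique, up to a flip.\<close>
    define z where "z = w (k (half_vec b7l))"
    have zN: "z \<in> root_nbrs r" unfolding z_def by (rule stab_nbr[OF r w(1,2) kN]) simp
    have ex: "\<exists>i b. i < 6 \<and> X l2 ! j = flip r b (w (X l1 ! i))" if j: "j < 6" for j
    proof -
      have y: "X l2 ! j \<in> root_nbrs r" using representativesD(2)[OF r rep j] by simp
      have "root_class r (X l2 ! j) \<in> (\<lambda>u. root_class r (w u)) ` set (X l1)"
        unfolding w(3) using representatives_set[OF r rep, of l2] j by auto
      then obtain i where i: "i < 6" "root_class r (X l2 ! j) = root_class r (w (X l1 ! i))"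
        using representatives_set[OF r rep, of l1] by auto
      have "w (X l1 ! i) \<in> root_nbrs r" using stab_nbr[OF r w(1,2) representativesD(2)[OF r rep i(1)]] by simp
      then have "X l2 ! j = flip r False (w (X l1 ! i)) \<or> X l2 ! j = flip r True (w (X l1 ! i))"
        using root_class_eq_iff[OF r y] i(2) by (auto simp: flip_def)
      then show ?thesis using i(1) by blast
    qed
    then obtain q b where q: "\<And>j. j < 6 \<Longrightarrow> q j < 6" "\<And>j. j < 6 \<Longrightarrow> X l2 ! j = flip r (b j) (w (X l1 ! q j))" by metis
    have wN: "w (X l1 ! i) \<in> root_nbrs r" if "i < 6" for i
      using stab_nbr[OF r w(1,2) representativesD(2)[OF r rep that]] by simp
    have wprod: "w (X l1 ! i) \<bullet> w (X l1 ! j) = X l1 ! i \<bullet> X l1 ! j" if "i < 6" "j < 6" for i j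
      using E8_Weyl_scalar_prod[OF w(1)] representativesD(2)[OF r rep] root_nbrsD(4) that by blast
    \<comment> \<open>The flips relating the two cliques agree: unequal ones would turn a product 1
      or 2 into 0 or -1, against product 1 within \<open>X l2\<close>.\<close>
    have b: "b j = b 0" if j: "j < 6" for j
    proof (rule ccontr)
      assume ne: "b j \<noteq> b 0"
      then have "j \<noteq> 0" by (cases "j = 0") simp_all
      then have one: "X l2 ! j \<bullet> X l2 ! 0 = 1" using Xprod[of l2 j 0] j by simp
      have "X l2 ! j \<bullet> X l2 ! 0 = 1 - w (X l1 ! q j) \<bullet> w (X l1 ! q 0)"
        using q(2)[OF j] q(2)[of 0] flip_product[OF r wN[OF q(1)[OF j]] wN[OF q(1)], of 0 "b j" "b 0"] ne by simp
      also have "w (X l1 ! q j) \<bullet> w (X l1 ! q 0) \<in> {1, 2}"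
        using wprod[OF q(1)[OF j] q(1)[of 0]] Xprod[of l1 "q j" "q 0"] q(1)[OF j] q(1)[of 0]
          root_nbrsD(3)[OF representativesD(2)[OF r rep, of l1 "q 0"]] by (cases "q j = q 0") auto
      ultimately show False using one by auto
    qed
    have zw: "w (X l1 ! i) \<bullet> z = 1" if i: "i < 6" for i
    proof -
      have "w (X l1 ! i) \<bullet> z = X l1 ! i \<bullet> k (half_vec b7l)"
        unfolding z_def using E8_Weyl_scalar_prod[OF w(1) root_nbrsD(4) root_nbrsD(4), OF representativesD(2)[OF r rep i] kN[of b7l], of l1] by simp
      also have "\<dots> = of_int (dotl (l1 ! i) b7l) / 4"
        using i l(1,3)[of l1] by (simp add: X_def kprod list_lengths)
      also have "dotl (l1 ! i) b7l = 4"
      proof -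
        have "\<forall>a\<in>set l1. dotl a b7l = 4" by (simp add: l1_def) (simp add: list_defs)
        then show ?thesis using i l(1)[of l1] by auto
      qed
      finally show ?thesis by simp
    qed
    define y where "y = flip r (b 0) z"
    have yN: "y \<in> root_nbrs r" unfolding y_def by (rule flip_nbr[OF r zN])
    have yprod: "X l2 ! j \<bullet> y = 1" if j: "j < 6" for j
      using flip_product[OF r wN[OF q(1)[OF j]] zN, of "b j" "b 0"] zw[OF q(1)[OF j]] q(2)[OF j] b[OF j] by (simp add: y_def)
    have gy: "g y \<bullet> half_vec a = 1" if al: "a \<in> set l2" for a
    proof -
      obtain j where j: "j < 6" "a = l2 ! j" using al l(1)[of l2] by (auto simp: in_set_conv_nth)
      have c: "half_vec a \<in> carrier_vec 8" using al l(3)[of l2] half_vec_carrier by auto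
      have cy: "y \<in> carrier_vec 8" using root_nbrsD(4)[OF yN] .
      have ck: "k (half_vec a) \<in> carrier_vec 8" using E8_Weyl_carrier[OF k(1) c] .
      have "g y \<bullet> half_vec a = g y \<bullet> g (k (half_vec a))" using gk[OF c] by simp
      also have "\<dots> = y \<bullet> k (half_vec a)" by (rule E8_Weyl_scalar_prod[OF g(1) cy ck])
      also have "\<dots> = k (half_vec a) \<bullet> y" by (rule comm_scalar_prod[OF cy ck])
      also have "k (half_vec a) = X l2 ! j" using j l(1)[of l2] by (simp add: X_def)
      finally show ?thesis using yprod j by simp
    qed
    have gN: "g y \<in> root_nbrs (half_vec r0l)" by (rule Weyl_nbr[OF g(1) r g(2) yN])
    \<comment> \<open>Back in standard position \<open>g y\<close> would be a seventh clique root,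
      which \<open>products_c6\<close> excludes.\<close>
    have "list_all2 (\<lambda>t c. g y \<bullet> half_vec t = of_int c / 4) [r0l, a1l, b2l, b3l, b4l, b5l, c6l] [4, 4, 4, 4, 4, 4, 4]"
      using root_nbrsD(2)[OF gN] gy by (simp add: l2_def)
    then show False
      using roots_with_products_iff[of "g y" "[r0l, a1l, b2l, b3l, b4l, b5l, c6l]" "[4, 4, 4, 4, 4, 4, 4]"] root_nbrsD(1)[OF gN]
      by (simp only: products_c6) (simp add: list_lengths)
  qed
  ultimately show ?thesis by simp
qed

end

theorem theorem8p4:
  fixes r :: "real vec"
  assumes "r \<in> E8_roots"
  shows "(\<forall>n. n \<noteq> 6 \<longrightarrow> bij_betw (phi r n) (class_orbits r n) (Omega n // sw_rel n)) \<and>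
    card {Q \<in> class_orbits r 6. phi r 6 Q = sw_class 6 (seidel_of_graph 6 (complete_edges 6))} = 2 \<and>
    (\<forall>C \<in> Omega 6 // sw_rel 6. C \<noteq> sw_class 6 (seidel_of_graph 6 (complete_edges 6)) \<longrightarrow>
       card {Q \<in> class_orbits r 6. phi r 6 Q = C} = 1)"
proof (intro conjI allI impI ballI)
  fix n :: nat assume n: "n \<noteq> 6"
  have "inj_on (phi r n) (class_orbits r n)"
  proof (rule inj_onI)
    fix Q Q' assume "Q \<in> class_orbits r n" "Q' \<in> class_orbits r n" "phi r n Q = phi r n Q'"
    then show "Q = Q'" by (rule phi_injective[OF assms]) (use n in simp)
  qed
  then show "bij_betw (phi r n) (class_orbits r n) (Omega n // sw_rel n)"
    unfolding bij_betw_def using phi_image[OF assms] by blast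
next
  show "card {Q \<in> class_orbits r 6. phi r 6 Q = sw_class 6 (complete_seidel 6)} = 2"
    by (rule complete_fibre[OF assms])
next
  fix C assume C: "C \<in> Omega 6 // sw_rel 6" "C \<noteq> sw_class 6 (complete_seidel 6)"
  have "C \<in> phi r 6 ` class_orbits r 6" unfolding phi_image[OF assms] by (rule C(1))
  then obtain Q where Q: "Q \<in> class_orbits r 6" "phi r 6 Q = C" by blast
  have "{Q \<in> class_orbits r 6. phi r 6 Q = C} = {Q}"
  proof (intro equalityI subsetI)
    fix Q' assume "Q' \<in> {Q \<in> class_orbits r 6. phi r 6 Q = C}"
    then have Q': "Q' \<in> class_orbits r 6" "phi r 6 Q' = C" by simp_all
    have "phi r 6 Q' = phi r 6 Q" using Q'(2) Q(2) by simp
    moreover have "phi r 6 Q \<noteq> sw_class 6 (complete_seidel 6)" unfolding Q(2) by (rule C(2))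
    ultimately show "Q' \<in> {Q}" using phi_injective[OF assms Q'(1) Q(1)] by blast
  next
    fix Q' assume "Q' \<in> {Q}"
    then show "Q' \<in> {Q \<in> class_orbits r 6. phi r 6 Q = C}" using Q by simp
  qed
  then show "card {Q \<in> class_orbits r 6. phi r 6 Q = C} = 1" by simp
qed

end
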